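(* Assume the following. (i) $f$ is continuous on $\mathbb{R}^{d+1}$, $g$ is continuous on $\mathbb{R}^d$, $g$ satisfies a Lipschitz condition, and $g(x)>0$ for all $x\in S$. (ii) There exists $D\ge 0$ such that, as soon as $\mathrm{dist}(\mathbf{i},\mathbf{j})>D$, the pairs $(X_{\mathbf{i}},X_{\mathbf{j}})$ and $((X_{\mathbf{i}},Y_{\mathbf{i}}),(X_{\mathbf{j}},Y_{\mathbf{j}}))$ admit densities $g_{\mathbf{i},\mathbf{j}}$ and $f_{\mathbf{i},\mathbf{j}}$; moreover, for some constant $c\ge 0$, $|f_{\mathbf{i},\mathbf{j}}(s,t)-f(s)f(t)|\le c$ for all $s,t\in\mathbb{R}^{d+1}$ and $|g_{\mathbf{i},\mathbf{j}}(u,v)-g(u)g(v)|\le c$ for all $u,v\in\mathbb{R}^d$. (iii) For $0\le i+j\le 2$ and $1\le l\le d$, the partial derivative $\frac{\partial^{i+j}f}{\partial x_l^i\partial y^j}$ exists, is bounded and integrable; and $F(y|x)$ has continuous second partial derivatives with respect to $x$. (iv) $F(y|x)$ has a continuous second derivative with respect to $y$. (v) $K$ is an integrable, symmetric, Lipschitz density function on $\mathbb{R}^d$ with compact support, and $\int_{\mathbb{R}^d}\|s\|^2K(s)\,ds<\infty$. (vi) $w$ is a symmetric Lipschitz density function on $\mathbb{R}$ with compact support. (vii) $\lim_{\mathbf{n}\to\infty}\widehat{\mathbf{n}}h^{d+2}(\log\widehat{\mathbf{n}})^{-1}=0$. (viii) For every $\varepsilon'>0$ there exists $\eta>0$ such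 that for every function $r:S\to\mathbb{R}$, $\sup_{x\in S}|\mu_p(x)-r(x)|\ge\varepsilon'$ implies $\sup_{x\in S}|F(\mu_p(x)|x)-F(r(x)|x)|\ge\eta$. (ix) At least one of the following holds: (a) $\phi(n,m)\le C\min(n,m)$ for all $n,m\in\mathbb{N}$ and some $C>0$, and $\widehat{\mathbf{n}}h^{\theta_1}(\log\widehat{\mathbf{n}})^{\theta_2}(u(\mathbf{n}))^{-2N/(\beta-N(d+5))}\to\infty$ as $\mathbf{n}\to\infty$; (b) $\phi(n,m)\le C(n+m+1)^{\kappa}$ for all $n,m\in\mathbb{N}$ and some $\kappa\ge1$, $C>0$, and $\widehat{\mathbf{n}}h^{\theta_3}(\log\widehat{\mathbf{n}})^{\theta_4}(u(\mathbf{n}))^{-2N/(\beta-N(d+4+2\kappa))}\to\infty$ as $\mathbf{n}\to\infty$. Then $$\sup_{x\in S}|\mu_{p,\mathbf{n}}(x)-\mu_p(x)|\to0\quad\text{almost surely as }\mathbf{n}\to\infty.$$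
   Context: Let $d,N\ge1$ be integers and $\mathbb{N}^*=\{1,2,\dots\}$. $(X,Y)$ is a pair of random variables with values in $\mathbb{R}^d\times\mathbb{R}$, with joint density $f(x,y)$; $X$ has marginal density $g$; $F(\cdot|x)$ is the conditional distribution function of $Y$ given $X=x$, with density $f(\cdot|x)$. For fixed $p\in\,]0,1[$, $\mu_p(x)$ is the conditional quantile of order $p$, a solution $y$ of $F(y|x)=p$. $((X_{\mathbf{i}},Y_{\mathbf{i}}))_{\mathbf{i}\in(\mathbb{N}^* )^N}$ is a strictly stationary random field, each $(X_{\mathbf{i}},Y_{\mathbf{i}})$ having the law of $(X,Y)$. For $\mathbf{n}=(n_1,\dots,n_N)\in(\mathbb{N}^* )^N$: $\mathcal{I}_{\mathbf{n}}=\{\mathbf{i}=(i_1,\dots,i_N)\in(\mathbb{N}^* )^N:1\le i_k\le n_k,\ k=1,\dots,N\}$, $\widehat{\mathbf{n}}=n_1\cdots n_N$, and $\mathbf{n}\to\infty$ means $\min_k n_k\to\infty$. The bandwidth $h=h(\mathbf{n})>0$ satisfies $h\to0$ as $\mathbf{n}\to\infty$; $K$ and $w$ are probability densities on $\mathbb{R}^d$ and $\mathbb{R}$. Estimators: $g_{\mathbf{n}}(x)=\frac{1}{\widehat{\mathbf{n}}h^d}\sum_{\mathbf{i}\in\mathcal{I}_{\mathbf{n}}}K\left(\frac{x-X_{\mathbf{i}}}{h}\right)$, $\psi_{\mathbf{n}}(x,y)=\frac{1}{\widehat{\mathbf{n}}h^{d+1}}\sum_{\mathbf{i}\in\mathcal{I}_{\mathbf{n}}}K\left(\frac{x-X_{\mathbf{i}}}{h}\right)\int_{-\infty}^{y}w\left(\frac{z-Y_{\mathbf{i}}}{h}\right)dz$,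 and $F_{\mathbf{n}}(y|x)=\frac{\psi_{\mathbf{n}}(x,y)}{g_{\mathbf{n}}(x)}\mathbf{1}_{\{g_{\mathbf{n}}(x)\neq0\}}$. The estimator $\mu_{p,\mathbf{n}}(x)$ of the conditional quantile is the root $z$ of the equation $F_{\mathbf{n}}(z|x)=p$. Mixing: there are a function $\chi:\mathbb{R}^+\to\mathbb{R}^+$ with $\chi(t)\downarrow0$ as $t\to\infty$ and a symmetric positive function $\phi:\mathbb{N}^2\to\mathbb{R}^+$, nondecreasing in each variable, such that for all finite $E,E'\subset(\mathbb{N}^* )^N$, $\sup\{|P(A\cap B)-P(A)P(B)|:A\in\mathcal{B}(E),B\in\mathcal{B}(E')\}\le\phi(\mathrm{Card}\,E,\mathrm{Card}\,E')\,\chi(\mathrm{dist}(E,E'))$, where $\mathcal{B}(E)$ is the $\sigma$-field generated by $(X_{\mathbf{i}},Y_{\mathbf{i}})_{\mathbf{i}\in E}$ and $\mathrm{dist}$ is Euclidean distance; moreover $\chi(i)=O(i^{-\beta})$ for some $\beta>0$. $S\subset\mathbb{R}^d$ is a fixed compact set. With $a=\inf\{y:F(y|x)>0\}$ and $b=\sup\{y:F(y|x)<1\}$, $\mathcal{V}\subseteq[a,b]$ is a fixed compact neighborhood of the quantile $\mu_p(x)$. $u(\mathbf{n})=\prod_{i=1}^N(\log n_i)(\log\log n_i)^{1+\varepsilon}$ for an arbitrary small fixed $\varepsilon>0$; $\theta_1=\frac{N(d+1)(d+2)+(d+1)\beta}{\beta-N(d+5)}$, $\theta_2=\frac{N(d+2)-\beta}{\beta-N(d+5)}$,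 $\theta_3=\frac{N(d^2+4d+2)+(d+1)\beta}{\beta-N(d+4+2\kappa)}$, $\theta_4=\frac{N(d+1)-\beta}{\beta-N(d+4+2\kappa)}$.
   Formalization: The formal theorem additionally requires β > N(d+5) in (ix)(a) and β > N(d+4+2κ) in (ix)(b); otherwise the exponents are undefined or the bandwidth condition admits arbitrarily small h, for which the claim fails even for i.i.d. data. *)

theory Defs
  imports "HOL-Probability.Probability" "HOL-Library.Landau_Symbols"
begin

definition real_index :: "nat ^ 'N \<Rightarrow> real ^ 'N" where
  "real_index i = (\<chi> k. real (i $ k))"

definition pos_indices :: "(nat ^ 'N) set" where
  "pos_indices = {i. \<forall>k. 1 \<le> i $ k}"

definition index_box :: "nat ^ 'N \<Rightarrow> (nat ^ 'N) set" where
  "index_box n = {i. \<forall>k. 1 \<le> i $ k \<and> i $ k \<le> n $ k}"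

definition index_volume :: "nat ^ 'N \<Rightarrow> nat" where
  "index_volume n = (\<Prod>k\<in>UNIV. n $ k)"

definition index_at_top :: "(nat ^ 'N) filter" where
  "index_at_top = filtercomap (\<lambda>n. Min (range (\<lambda>k. n $ k))) at_top"

definition prob_density :: "('a::euclidean_space \<Rightarrow> real) \<Rightarrow> bool" where
  "prob_density k \<longleftrightarrow> (\<forall>s. 0 \<le> k s) \<and> integrable lborel k \<and> (LINT s|lborel. k s) = 1"

definition compact_support :: "('a::euclidean_space \<Rightarrow> real) \<Rightarrow> bool" where
  "compact_support k \<longleftrightarrow> compact (closure {s. k s \<noteq> 0})"

definition marginal_density :: "((real ^ 'd) \<times> real \<Rightarrow> real) \<Rightarrow> real ^ 'd \<Rightarrow> real" where
  "marginal_density f x = (LINT y|lborel. f (x, y))"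

text \<open>
  The conditional distribution function is meaningful where the marginal density is positive.
\<close>

definition cond_cdf :: "((real ^ 'd) \<times> real \<Rightarrow> real) \<Rightarrow> real \<Rightarrow> real ^ 'd \<Rightarrow> real" where
  "cond_cdf f y x = (LINT z:{..y}|lborel. f (x, z) / marginal_density f x)"

definition cond_domain :: "((real ^ 'd) \<times> real \<Rightarrow> real) \<Rightarrow> ((real ^ 'd) \<times> real) set" where
  "cond_domain f = {(x, y). 0 < marginal_density f x}"


text \<open>Partial derivatives, taken along the directions \<open>x_dir l\<close> (the variable \<open>x\<^sub>l\<close>) and
  \<open>y_dir\<close> (the variable \<open>y\<close>).\<close>

definition x_dir :: "'d \<Rightarrow> (real ^ 'd) \<times> real" where
  "x_dir l = (axis l 1, 0)"

definition y_dir :: "(real ^ 'd) \<times> real" where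
  "y_dir = (0, 1)"

definition partial_deriv :: "'a::real_normed_vector \<Rightarrow> ('a \<Rightarrow> real) \<Rightarrow> 'a \<Rightarrow> real" where
  "partial_deriv v F z = deriv (\<lambda>t. F (z + t *\<^sub>R v)) 0"

definition partially_differentiable_on ::
    "'a::real_normed_vector \<Rightarrow> ('a \<Rightarrow> real) \<Rightarrow> 'a set \<Rightarrow> bool" where
  "partially_differentiable_on v F U \<longleftrightarrow>
     (\<forall>z\<in>U. (\<lambda>t. F (z + t *\<^sub>R v)) field_differentiable (at 0))"

definition continuous_second_partial_on ::
    "'a::real_normed_vector \<Rightarrow> 'a \<Rightarrow> ('a \<Rightarrow> real) \<Rightarrow> 'a set \<Rightarrow> bool" where
  "continuous_second_partial_on v v' F U \<longleftrightarrow>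
     partially_differentiable_on v' F U \<and>
     partially_differentiable_on v (partial_deriv v' F) U \<and>
     continuous_on U (partial_deriv v (partial_deriv v' F))"

text \<open>The derivative \<open>\<partial>\<^sup>i\<^sup>+\<^sup>j f / \<partial>x\<^sub>l\<^sup>i \<partial>y\<^sup>j\<close>: \<open>j\<close> times in \<open>y\<close>, then \<open>i\<close> times in \<open>x\<^sub>l\<close>.\<close>

definition mixed_partial ::
    "'d \<Rightarrow> nat \<Rightarrow> nat \<Rightarrow> ((real ^ 'd) \<times> real \<Rightarrow> real) \<Rightarrow> (real ^ 'd) \<times> real \<Rightarrow> real" where
  "mixed_partial l i j f = (partial_deriv (x_dir l) ^^ i) ((partial_deriv y_dir ^^ j) f)"

definition mixed_partial_exists ::
    "'d \<Rightarrow> nat \<Rightarrow> nat \<Rightarrow> ((real ^ 'd) \<times> real \<Rightarrow> real) \<Rightarrow> bool" where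
  "mixed_partial_exists l i j f \<longleftrightarrow>
     (\<forall>b<j. partially_differentiable_on y_dir (mixed_partial l 0 b f) UNIV) \<and>
     (\<forall>a<i. partially_differentiable_on (x_dir l) (mixed_partial l a j f) UNIV)"


definition strictly_stationary ::
    "'w measure \<Rightarrow> (nat ^ 'N \<Rightarrow> 'w \<Rightarrow> 'b::topological_space) \<Rightarrow> bool" where
  "strictly_stationary M Z \<longleftrightarrow>
     (\<forall>i\<in>pos_indices. Z i \<in> borel_measurable M) \<and>
     (\<forall>k. distr M (\<Pi>\<^sub>M i\<in>pos_indices. borel) (\<lambda>\<omega>. \<lambda>i\<in>pos_indices. Z (i + k) \<omega>) =
          distr M (\<Pi>\<^sub>M i\<in>pos_indices. borel) (\<lambda>\<omega>. \<lambda>i\<in>pos_indices. Z i \<omega>))"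

definition generated_events ::
    "'w measure \<Rightarrow> ('i \<Rightarrow> 'w \<Rightarrow> 'b::topological_space) \<Rightarrow> 'i set \<Rightarrow> 'w set set" where
  "generated_events M Z E =
     sigma_sets (space M) (\<Union>i\<in>E. {Z i -` A \<inter> space M | A. A \<in> sets borel})"

text \<open>
  Positivity of \<open>\<phi>\<close> means \<open>\<ge> 0\<close>: strict positivity at \<open>(0, 0)\<close> would rule out
  \<open>\<phi> n m \<le> C * min n m\<close>.  The value of \<^const>\<open>setdist\<close> at an empty set is irrelevant, since
  an empty set of indices generates only trivial events.
\<close>

definition mixing_field ::
    "'w measure \<Rightarrow> (nat ^ 'N \<Rightarrow> 'w \<Rightarrow> 'b::topological_space) \<Rightarrow>
     (nat \<Rightarrow> nat \<Rightarrow> real) \<Rightarrow> (real \<Rightarrow> real) \<Rightarrow> bool" where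
  "mixing_field M Z \<phi> chi \<longleftrightarrow>
     (\<forall>t\<ge>0. 0 \<le> chi t) \<and> antimono_on {0..} chi \<and> (chi \<longlongrightarrow> 0) at_top \<and>
     (\<forall>n m. 0 \<le> \<phi> n m \<and> \<phi> n m = \<phi> m n) \<and>
     (\<forall>n n' m. n \<le> n' \<longrightarrow> \<phi> n m \<le> \<phi> n' m) \<and>
     (\<forall>n m m'. m \<le> m' \<longrightarrow> \<phi> n m \<le> \<phi> n m') \<and>
     (\<forall>E E'. finite E \<longrightarrow> finite E' \<longrightarrow> E \<subseteq> pos_indices \<longrightarrow> E' \<subseteq> pos_indices \<longrightarrow>
       (\<forall>A\<in>generated_events M Z E. \<forall>B\<in>generated_events M Z E'.
          \<bar>measure M (A \<inter> B) - measure M A * measure M B\<bar>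
            \<le> \<phi> (card E) (card E') * chi (setdist (real_index ` E) (real_index ` E'))))"


definition g_est ::
    "(real ^ 'd \<Rightarrow> real) \<Rightarrow> (nat ^ 'N \<Rightarrow> real) \<Rightarrow> (nat ^ 'N \<Rightarrow> 'w \<Rightarrow> real ^ 'd) \<Rightarrow>
     nat ^ 'N \<Rightarrow> 'w \<Rightarrow> real ^ 'd \<Rightarrow> real" where
  "g_est K h X n \<omega> x =
     1 / (real (index_volume n) * h n ^ CARD('d)) *
     (\<Sum>i\<in>index_box n. K ((x - X i \<omega>) /\<^sub>R h n))"

definition psi_est ::
    "(real ^ 'd \<Rightarrow> real) \<Rightarrow> (real \<Rightarrow> real) \<Rightarrow> (nat ^ 'N \<Rightarrow> real) \<Rightarrow>
     (nat ^ 'N \<Rightarrow> 'w \<Rightarrow> real ^ 'd) \<Rightarrow> (nat ^ 'N \<Rightarrow> 'w \<Rightarrow> real) \<Rightarrow>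
     nat ^ 'N \<Rightarrow> 'w \<Rightarrow> real ^ 'd \<Rightarrow> real \<Rightarrow> real" where
  "psi_est K w h X Y n \<omega> x y =
     1 / (real (index_volume n) * h n ^ (CARD('d) + 1)) *
     (\<Sum>i\<in>index_box n. K ((x - X i \<omega>) /\<^sub>R h n) *
        (LINT z:{..y}|lborel. w ((z - Y i \<omega>) / h n)))"

definition F_est ::
    "(real ^ 'd \<Rightarrow> real) \<Rightarrow> (real \<Rightarrow> real) \<Rightarrow> (nat ^ 'N \<Rightarrow> real) \<Rightarrow>
     (nat ^ 'N \<Rightarrow> 'w \<Rightarrow> real ^ 'd) \<Rightarrow> (nat ^ 'N \<Rightarrow> 'w \<Rightarrow> real) \<Rightarrow>
     nat ^ 'N \<Rightarrow> 'w \<Rightarrow> real \<Rightarrow> real ^ 'd \<Rightarrow> real" where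
  "F_est K w h X Y n \<omega> y x =
     (if g_est K h X n \<omega> x \<noteq> 0 then psi_est K w h X Y n \<omega> x y / g_est K h X n \<omega> x else 0)"

text \<open>
  A root of \<open>F_est \<dots> z x = p\<close> need not be unique, and none exists where \<open>g_est\<close> vanishes, which
  has positive probability in general.  An estimator is therefore any selection of roots
  wherever roots exist, with arbitrary values elsewhere.
\<close>

definition quantile_estimator ::
    "(real ^ 'd \<Rightarrow> real) \<Rightarrow> (real \<Rightarrow> real) \<Rightarrow> (nat ^ 'N \<Rightarrow> real) \<Rightarrow>
     (nat ^ 'N \<Rightarrow> 'w \<Rightarrow> real ^ 'd) \<Rightarrow> (nat ^ 'N \<Rightarrow> 'w \<Rightarrow> real) \<Rightarrow> real \<Rightarrow>
     'w measure \<Rightarrow> (real ^ 'd) set \<Rightarrow> (nat ^ 'N \<Rightarrow> 'w \<Rightarrow> real ^ 'd \<Rightarrow> real) \<Rightarrow> bool" where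
  "quantile_estimator K w h X Y p M S q \<longleftrightarrow>
     (\<forall>n\<in>pos_indices. \<forall>\<omega>\<in>space M. \<forall>x\<in>S.
        (\<exists>z. F_est K w h X Y n \<omega> z x = p) \<longrightarrow> F_est K w h X Y n \<omega> (q n \<omega> x) x = p)"


text \<open>
  The supremum of distances over \<open>S\<close>, in \<^typ>\<open>ennreal\<close>: infinite if unbounded, and \<open>0\<close> if \<open>S\<close> is empty.
\<close>

definition sup_dist_on :: "'a set \<Rightarrow> ('a \<Rightarrow> real) \<Rightarrow> ('a \<Rightarrow> real) \<Rightarrow> ennreal" where
  "sup_dist_on S p q = (SUP x\<in>S. ennreal \<bar>p x - q x\<bar>)"

definition u_fun :: "real \<Rightarrow> nat ^ 'N \<Rightarrow> real" where
  "u_fun \<epsilon> n = (\<Prod>i\<in>UNIV. ln (real (n $ i)) * ln (ln (real (n $ i))) powr (1 + \<epsilon>))"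

text \<open>In the following exponents \<open>N\<close> and \<open>d\<close> are the dimensions.\<close>

definition theta1 :: "real \<Rightarrow> real \<Rightarrow> real \<Rightarrow> real" where
  "theta1 N d \<beta> = (N * (d + 1) * (d + 2) + (d + 1) * \<beta>) / (\<beta> - N * (d + 5))"

definition theta2 :: "real \<Rightarrow> real \<Rightarrow> real \<Rightarrow> real" where
  "theta2 N d \<beta> = (N * (d + 2) - \<beta>) / (\<beta> - N * (d + 5))"

definition theta3 :: "real \<Rightarrow> real \<Rightarrow> real \<Rightarrow> real \<Rightarrow> real" where
  "theta3 N d \<beta> \<kappa> = (N * (d\<^sup>2 + 4 * d + 2) + (d + 1) * \<beta>) / (\<beta> - N * (d + 4 + 2 * \<kappa>))"

definition theta4 :: "real \<Rightarrow> real \<Rightarrow> real \<Rightarrow> real \<Rightarrow> real" where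
  "theta4 N d \<beta> \<kappa> = (N * (d + 1) - \<beta>) / (\<beta> - N * (d + 4 + 2 * \<kappa>))"

text \<open>
  In both alternatives the denominator of the exponents is required to be positive.  If it were
  negative, the exponent of \<open>h\<close> would be negative as well and the divergence would hold for
  bandwidths tending to \<open>0\<close> arbitrarily fast, for which the estimators are inconsistent even
  for independent data.
\<close>

definition mixing_bandwidth_a ::
    "(nat ^ 'N \<Rightarrow> real) \<Rightarrow> real \<Rightarrow> real \<Rightarrow> real \<Rightarrow> (nat \<Rightarrow> nat \<Rightarrow> real) \<Rightarrow> bool" where
  "mixing_bandwidth_a h d \<epsilon> \<beta> \<phi> \<longleftrightarrow>
     (let N = real CARD('N) in
      N * (d + 5) < \<beta> \<and>
      (\<exists>C>0. \<forall>n m. \<phi> n m \<le> C * real (min n m)) \<and>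
      filterlim (\<lambda>n. real (index_volume n) * h n powr theta1 N d \<beta>
                     * ln (real (index_volume n)) powr theta2 N d \<beta>
                     * u_fun \<epsilon> n powr (- 2 * N / (\<beta> - N * (d + 5))))
        at_top index_at_top)"

definition mixing_bandwidth_b ::
    "(nat ^ 'N \<Rightarrow> real) \<Rightarrow> real \<Rightarrow> real \<Rightarrow> real \<Rightarrow> (nat \<Rightarrow> nat \<Rightarrow> real) \<Rightarrow> bool" where
  "mixing_bandwidth_b h d \<epsilon> \<beta> \<phi> \<longleftrightarrow>
     (let N = real CARD('N) in
      \<exists>\<kappa>\<ge>1. N * (d + 4 + 2 * \<kappa>) < \<beta> \<and>
        (\<exists>C>0. \<forall>n m. \<phi> n m \<le> C * (real n + real m + 1) powr \<kappa>) \<and>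
        filterlim (\<lambda>n. real (index_volume n) * h n powr theta3 N d \<beta> \<kappa>
                       * ln (real (index_volume n)) powr theta4 N d \<beta> \<kappa>
                       * u_fun \<epsilon> n powr (- 2 * N / (\<beta> - N * (d + 4 + 2 * \<kappa>))))
          at_top index_at_top)"

end

theory Submission
  imports Defs
begin

text \<open>
  Write \<open>V\<close> for the number \<^term>\<open>index_volume n\<close> of observations and \<open>N\<close>, \<open>d\<close> for the dimensions.  The
  separation condition on the quantile reduces the claim to
  \<open>sup |F(q(x) | x) - p| \<longlongrightarrow> 0\<close> over \<open>x \<in> S\<close>, and the estimate \<open>q(x)\<close> is a root of the estimated conditional
  distribution function.  It is therefore enough to know that the estimated distribution function is
  uniformly close to the true one; since both are nondecreasing in \<open>y\<close>, finitely many levels \<open>y\<close>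
  suffice, chosen by compactness of \<open>S\<close> (\<open>separating_levels\<close>).

  The integrated kernel \<open>w\<close> has compact support, so it lies between two indicators that are \<open>O(h)\<close> apart.
  This replaces the numerator by averages of \<open>K((x - X\<^sub>i)/h) 1\<^sub>A(Y\<^sub>i)\<close> for a fixed Borel set \<open>A\<close>; the
  denominator is the same average with \<open>A = UNIV\<close>.  Everything thus rests on one uniform strong law
  (\<open>region_est_uniformly_consistent\<close>): these averages converge to \<open>\<integral>\<^sub>A f(x, y) dy\<close> uniformly on \<open>S\<close>.  The bias
  vanishes because that integral is continuous in \<open>x\<close> wherever the marginal density is positive, which is
  Scheffe's lemma.

  The stochastic part needs a tail bound at a single point, summable over all multi-indices after being multiplied by
  the size \<open>O(h\<^bsup>- d (d + 1)\<^esup>)\<close> of a net of \<open>S\<close>.  The index box is cut into cubes of side \<open>q\<close>; cubes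
  whose positions have the same parities are at distance at least \<open>q\<close>, so the sum splits into \<open>2\<^sup>N\<close> sums of
  weakly dependent block sums.  Such a sum is compared with an independent one without any
  coupling: for a bounded Lipschitz test function the summands are averaged out one by one, and each
  replacement costs at most twice the mixing coefficient times the Lipschitz constant times the range of that summand
  (\<open>decouple_summand\<close>, \<open>decouple_sum\<close>).  A ramp as test function turns this into a Chernoff bound
  (\<open>mixing_chernoff\<close>).  As only consistency is wanted, deviations are of fixed size, and it suffices to
  bound the variance of a block by its range times its mean.

  The side is chosen as \<open>q\<^sup>N \<approx> V h\<^sup>d / ln V\<close>.  The Chernoff part is then a power of \<open>1 / V\<close> that can be
  made as high as required, and the mixing part is at most a constant times \<open>1 / (V u(n))\<close> by
  the condition on the bandwidth (\<open>bandwidth_rate\<close>).  Both are summable over the multi-indices, and the first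
  Borel--Cantelli lemma concludes.
\<close>

section \<open>Sums of weakly dependent variables\<close>

text \<open>
  Only events of the form \<open>u \<ge> l b / m\<close> enter the staircase.  This is how the mixing condition,
  which speaks about events, is brought to bear on Lipschitz functions of sums.
\<close>

lemma staircase_approximation:
  fixes \<phi> :: "real \<Rightarrow> real"
  assumes lip: "\<And>x y. \<bar>\<phi> x - \<phi> y\<bar> \<le> L * \<bar>x - y\<bar>" and u: "0 \<le> u" "u \<le> b" and m: "0 < (m::nat)"
  shows "\<bar>\<phi> (v + u) - (\<phi> v + (\<Sum>l=1..m. if real l * b / m \<le> u
           then \<phi> (v + real l * b / m) - \<phi> (v + real (l - 1) * b / m) else 0))\<bar> \<le> L * b / m"
proof (cases "b = 0")
  case True
  then have "u = 0" using u by simp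
  then show ?thesis using True by simp
next
  case False
  then have b: "0 < b" using u by simp
  define k where "k = nat \<lfloor>u * m / b\<rfloor>"
  have k: "real k \<le> u * m / b" "u * m / b < real k + 1"
    unfolding k_def using u b by auto
  have iff: "real l * b / m \<le> u \<longleftrightarrow> l \<le> k" for l
  proof -
    have "real l * b / m \<le> u \<longleftrightarrow> real l \<le> u * m / b"
      using b m by (simp add: field_simps)
    also have "\<dots> \<longleftrightarrow> l \<le> k" using k by linarith
    finally show ?thesis .
  qed
  have "real k \<le> m"
    using k(1) u b m by (smt (verit) divide_le_eq mult.commute mult_right_mono of_nat_0_le_iff)
  then have "k \<le> m" by simp
  have "(\<Sum>l=1..m. if real l * b / m \<le> u
           then \<phi> (v + real l * b / m) - \<phi> (v + real (l - 1) * b / m) else 0)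
        = (\<Sum>l=1..m. if l \<le> k then \<phi> (v + real l * b / m) - \<phi> (v + real (l - 1) * b / m) else 0)"
    by (simp add: iff)
  also have "\<dots> = (\<Sum>l=1..k. \<phi> (v + real l * b / m) - \<phi> (v + real (l - 1) * b / m))"
    using \<open>k \<le> m\<close> by (intro sum.mono_neutral_cong_right) auto
  also have "\<dots> = \<phi> (v + real k * b / m) - \<phi> v"
    using sum_telescope''[of 0 k "\<lambda>l. \<phi> (v + real l * b / m)"] by (simp add: atLeastSucAtMost_greaterThanAtMost)
  finally have "\<phi> v + (\<Sum>l=1..m. if real l * b / m \<le> u
           then \<phi> (v + real l * b / m) - \<phi> (v + real (l - 1) * b / m) else 0)
        = \<phi> (v + real k * b / m)" by simp
  moreover have "\<bar>\<phi> (v + u) - \<phi> (v + real k * b / m)\<bar> \<le> L * \<bar>(v + u) - (v + real k * b / m)\<bar>"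
    by (rule lip)
  moreover have "\<bar>(v + u) - (v + real k * b / m)\<bar> \<le> b / m"
  proof -
    have "real k * b / m \<le> u" using k(1) b m by (simp add: field_simps)
    moreover have "u < (real k + 1) * b / m" using k(2) b m by (simp add: field_simps)
    ultimately show ?thesis by (simp add: field_simps add_divide_distrib)
  qed
  moreover have "0 \<le> L"
    using lip[of 1 0] by simp
  ultimately show ?thesis
    by (smt (verit) mult_left_mono times_divide_eq_right)
qed

lemma le_by_vanishing_error:
  fixes a b x :: real
  assumes "\<And>m. x \<le> a + b / Suc m" shows "x \<le> a"
proof (rule LIMSEQ_le_const)
  show "(\<lambda>m. a + b / Suc m) \<longlonglongrightarrow> a"
    using tendsto_add[OF tendsto_const LIMSEQ_Suc[OF lim_const_over_n[of b]], of a] by simp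
qed (use assms in blast)

context prob_space begin

lemma expectation_diff_bound:
  fixes f g :: "'a \<Rightarrow> real"
  assumes "integrable M f" "integrable M g" "\<And>\<omega>. \<omega> \<in> space M \<Longrightarrow> \<bar>f \<omega> - g \<omega>\<bar> \<le> c"
  shows "\<bar>expectation f - expectation g\<bar> \<le> c"
proof -
  have "\<bar>expectation f - expectation g\<bar> = \<bar>expectation (\<lambda>\<omega>. f \<omega> - g \<omega>)\<bar>" using assms by simp
  also have "\<dots> \<le> expectation (\<lambda>\<omega>. \<bar>f \<omega> - g \<omega>\<bar>)" by (rule integral_abs_bound)
  also have "\<dots> \<le> c" by (rule integral_le_const) (use assms in auto)
  finally show ?thesis .
qed

lemma integrable_indicator_event: "A \<in> events \<Longrightarrow> integrable M (indicator A :: 'a \<Rightarrow> real)"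
  by (rule integrable_real_indicator) (auto simp: emeasure_eq_measure)

text \<open>
  Approximate \<open>D\<close> by the staircase \<open>c/n \<Sum>\<^sub>l 1(D \<ge> l c / n)\<close>: each of the \<open>n\<close> steps contributes at most
  \<open>\<alpha> c / n\<close> to the covariance, and the approximation error disappears as \<open>n\<close> grows.
\<close>

lemma covariance_event_bound:
  fixes D :: "'a \<Rightarrow> real"
  assumes D[measurable]: "random_variable borel D" and B[measurable]: "B \<in> events"
    and bd: "\<And>\<omega>. \<omega> \<in> space M \<Longrightarrow> 0 \<le> D \<omega> \<and> D \<omega> \<le> c" and \<alpha>: "0 \<le> \<alpha>"
    and mix: "\<And>t. \<bar>prob ({\<omega>\<in>space M. t \<le> D \<omega>} \<inter> B) - prob {\<omega>\<in>space M. t \<le> D \<omega>} * prob B\<bar> \<le> \<alpha>"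
  shows "\<bar>expectation (\<lambda>\<omega>. D \<omega> * indicator B \<omega>) - expectation D * prob B\<bar> \<le> c * \<alpha>"
proof -
  have c: "0 \<le> c" using bd not_empty by fastforce
  have approx: "\<bar>expectation (\<lambda>\<omega>. D \<omega> * indicator B \<omega>) - expectation D * prob B\<bar> \<le> c * \<alpha> + 2 * c / Suc m" for m
  proof -
    define n where "n = Suc m"
    have n: "0 < n" by (simp add: n_def)
    define E where "E l = {\<omega>\<in>space M. real l * c / n \<le> D \<omega>}" for l :: nat
    have E[measurable]: "E l \<in> events" for l unfolding E_def by simp
    define G where "G \<omega> = (\<Sum>l=1..n. c / n * indicator (E l) \<omega>)" for \<omega>
    have [measurable]: "random_variable borel G" unfolding G_def by measurable
    have G: "\<bar>D \<omega> - G \<omega>\<bar> \<le> c / n" if "\<omega> \<in> space M" for \<omega>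
    proof -
      have "(\<Sum>l=1..n. if real l * c / n \<le> D \<omega> then (0 + real l * c / n) - (0 + real (l - 1) * c / n) else 0) = G \<omega>"
        unfolding G_def
      proof (intro sum.cong refl)
        fix l assume "l \<in> {1..n}"
        then have "real l * c / n - real (l - 1) * c / n = c / n"
          by (simp add: of_nat_diff field_simps diff_divide_distrib[symmetric])
        then show "(if real l * c / n \<le> D \<omega> then (0 + real l * c / n) - (0 + real (l - 1) * c / n) else 0) = c / n * indicator (E l) \<omega>"
          using that by (simp add: E_def)
      qed
      then show ?thesis
        using staircase_approximation[of "\<lambda>x. x" 1 "D \<omega>" c n 0] bd[OF that] n by simp
    qed
    have iD: "integrable M D"
      by (rule integrable_const_bound[where B=c]) (use bd in auto)
    have iDB: "integrable M (\<lambda>\<omega>. D \<omega> * indicator B \<omega>)"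
      by (rule integrable_const_bound[where B=c]) (use bd c in \<open>auto simp: indicator_def\<close>)
    have iG: "integrable M G" unfolding G_def by (simp add: integrable_indicator_event)
    have iGB: "integrable M (\<lambda>\<omega>. G \<omega> * indicator B \<omega>)"
      by (rule integrable_real_mult_indicator) (use iG in auto)
    have eG: "expectation G = (\<Sum>l=1..n. c / n * prob (E l))"
      unfolding G_def by (simp add: integrable_indicator_event)
    have "G \<omega> * indicator B \<omega> = (\<Sum>l=1..n. c / n * indicator (E l \<inter> B) \<omega>)" for \<omega>
      by (simp add: G_def sum_distrib_right indicator_inter_arith mult.assoc)
    then have eGB: "expectation (\<lambda>\<omega>. G \<omega> * indicator B \<omega>) = (\<Sum>l=1..n. c / n * prob (E l \<inter> B))"
      by (simp add: integrable_indicator_event)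
    have "\<bar>expectation (\<lambda>\<omega>. G \<omega> * indicator B \<omega>) - expectation G * prob B\<bar>
          = \<bar>\<Sum>l=1..n. c / n * (prob (E l \<inter> B) - prob (E l) * prob B)\<bar>"
      unfolding eG eGB sum_distrib_right sum_subtractf[symmetric] by (simp add: right_diff_distrib mult.assoc)
    also have "\<dots> \<le> (\<Sum>l=1..n. c / n * \<alpha>)"
    proof (rule order_trans[OF sum_abs], rule sum_mono)
      fix l
      show "\<bar>c / n * (prob (E l \<inter> B) - prob (E l) * prob B)\<bar> \<le> c / n * \<alpha>"
        using mix[of "real l * c / n"] c by (auto simp: E_def abs_mult intro!: mult_left_mono divide_nonneg_nonneg divide_right_mono)
    qed
    also have "\<dots> = c * \<alpha>" using n by simp
    finally have 1: "\<bar>expectation (\<lambda>\<omega>. G \<omega> * indicator B \<omega>) - expectation G * prob B\<bar> \<le> c * \<alpha>" .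
    have "\<bar>expectation D - expectation G\<bar> \<le> c / n"
      by (rule expectation_diff_bound[OF iD iG G])
    then have "\<bar>expectation D - expectation G\<bar> * prob B \<le> c / n * 1"
      by (intro mult_mono) (auto intro: order_trans)
    then have 2: "\<bar>expectation D * prob B - expectation G * prob B\<bar> \<le> c / n"
      by (simp add: left_diff_distrib[symmetric] abs_mult)
    have 3: "\<bar>expectation (\<lambda>\<omega>. D \<omega> * indicator B \<omega>) - expectation (\<lambda>\<omega>. G \<omega> * indicator B \<omega>)\<bar> \<le> c / n"
      by (rule expectation_diff_bound[OF iDB iGB]) (use G c in \<open>auto simp: indicator_def\<close>)
    have "2 * c / n = c / n + c / n" by simp
    then show ?thesis using 1 2 3 unfolding n_def by linarith
  qed
  then show ?thesis by (rule le_by_vanishing_error)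
qed

text \<open>
  In the inner expectation \<open>U\<close> is an independent copy.  Expanding \<open>\<phi>(v + u)\<close> into a staircase in \<open>u\<close>, the
  \<open>l\<close>-th step is the indicator of \<open>U \<ge> l b / n\<close> times an increment \<open>D l V\<close> of size at most \<open>L b / n\<close>, and
  the covariance of the two is controlled by \<open>covariance_event_bound\<close>.  The bound is linear in \<open>\<alpha>\<close> and
  in the range \<open>b\<close>, so that the cost of decoupling many summands is governed by the total range.
\<close>

lemma decouple_summand:
  fixes V U :: "'a \<Rightarrow> real" and \<phi> :: "real \<Rightarrow> real"
  assumes V[measurable]: "random_variable borel V" and U[measurable]: "random_variable borel U"
    and bd: "\<And>\<omega>. \<omega> \<in> space M \<Longrightarrow> 0 \<le> U \<omega> \<and> U \<omega> \<le> b" and \<alpha>: "0 \<le> \<alpha>"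
    and mix: "\<And>A s. A \<in> sets borel \<Longrightarrow>
       \<bar>prob ({\<omega>\<in>space M. V \<omega> \<in> A} \<inter> {\<omega>\<in>space M. s \<le> U \<omega>})
         - prob {\<omega>\<in>space M. V \<omega> \<in> A} * prob {\<omega>\<in>space M. s \<le> U \<omega>}\<bar> \<le> \<alpha>"
    and lip: "\<And>x y. \<bar>\<phi> x - \<phi> y\<bar> \<le> L * \<bar>x - y\<bar>" and \<phi>: "\<And>x. 0 \<le> \<phi> x \<and> \<phi> x \<le> 1"
  shows "\<bar>expectation (\<lambda>\<omega>. \<phi> (V \<omega> + U \<omega>)) - expectation (\<lambda>\<omega>. expectation (\<lambda>\<omega>'. \<phi> (V \<omega> + U \<omega>')))\<bar>
           \<le> 2 * L * b * \<alpha>"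
proof -
  have b: "0 \<le> b" using bd not_empty by fastforce
  have L: "0 \<le> L" using lip[of 1 0] by simp
  have "continuous_on UNIV \<phi>"
    by (rule lipschitz_on_continuous_on[of L]) (use lip L in \<open>auto simp: lipschitz_on_def dist_real_def\<close>)
  then have [measurable]: "\<phi> \<in> borel_measurable borel" by (rule borel_measurable_continuous_onI)
  have int: "integrable M (\<lambda>\<omega>. \<phi> (f \<omega>))" if [measurable]: "random_variable borel f" for f
    by (rule integrable_const_bound[where B=1]) (use \<phi> in auto)
  have approx: "\<bar>expectation (\<lambda>\<omega>. \<phi> (V \<omega> + U \<omega>)) - expectation (\<lambda>\<omega>. expectation (\<lambda>\<omega>'. \<phi> (V \<omega> + U \<omega>')))\<bar>
           \<le> 2 * L * b * \<alpha> + 2 * (L * b) / Suc m" for m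
  proof -
    define n where "n = Suc m"
    have n: "0 < n" by (simp add: n_def)
    define c where "c = L * b / n"
    have c: "0 \<le> c" using L b by (simp add: c_def)
    define E where "E l = {\<omega>\<in>space M. real l * b / n \<le> U \<omega>}" for l :: nat
    have E[measurable]: "E l \<in> events" for l unfolding E_def by simp
    define D where "D l v = \<phi> (v + real l * b / n) - \<phi> (v + real (l - 1) * b / n)" for l v
    have Dm[measurable]: "D l \<in> borel_measurable borel" for l unfolding D_def by measurable
    have Dbd: "\<bar>D l v\<bar> \<le> c" for l v
    proof -
      have "\<bar>D l v\<bar> \<le> L * \<bar>(v + real l * b / n) - (v + real (l - 1) * b / n)\<bar>"
        unfolding D_def by (rule lip)
      also have "\<dots> = L * \<bar>real l * b / n - real (l - 1) * b / n\<bar>" by simp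
      also have "real l * b / n - real (l - 1) * b / n = (real l - real (l - 1)) * (b / n)"
        by (simp add: left_diff_distrib diff_divide_distrib)
      also have "\<bar>\<dots>\<bar> \<le> 1 * (b / n)"
      proof -
        have "0 \<le> b / n" using b by simp
        moreover have "0 \<le> real l - real (l - 1) \<and> real l - real (l - 1) \<le> 1" by linarith
        ultimately show ?thesis by (simp only: abs_mult) (intro mult_mono, auto)
      qed
      finally show ?thesis using L by (simp add: c_def mult_left_mono)
    qed
    have iD: "integrable M (\<lambda>\<omega>. D l (V \<omega>))" for l
      by (rule integrable_const_bound[where B=c]) (use Dbd in auto)
    have iDE: "integrable M (\<lambda>\<omega>. D l (V \<omega>) * indicator (E l) \<omega>)" for l
      by (rule integrable_real_mult_indicator) (use iD in auto)
    define H where "H v \<omega> = \<phi> v + (\<Sum>l=1..n. D l v * indicator (E l) \<omega>)" for v \<omega>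
    have H: "\<bar>\<phi> (v + U \<omega>) - H v \<omega>\<bar> \<le> c" if "\<omega> \<in> space M" for v \<omega>
    proof -
      have "(\<Sum>l=1..n. if real l * b / n \<le> U \<omega> then \<phi> (v + real l * b / n) - \<phi> (v + real (l - 1) * b / n) else 0)
           = (\<Sum>l=1..n. D l v * indicator (E l) \<omega>)"
        using that by (intro sum.cong) (auto simp: D_def E_def)
      then show ?thesis
        using staircase_approximation[of \<phi> L "U \<omega>" b n v] bd[OF that] lip n unfolding H_def c_def by simp
    qed
    have iH: "integrable M (\<lambda>\<omega>. H v \<omega>)" for v
      unfolding H_def
      by (intro Bochner_Integration.integrable_add Bochner_Integration.integrable_sum integrable_mult_right
            integrable_indicator_event E) simp
    have eH: "expectation (H v) = \<phi> v + (\<Sum>l=1..n. D l v * prob (E l))" for v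
    proof -
      have iDi: "integrable M (\<lambda>\<omega>. D l v * indicator (E l) \<omega>)" for l
        by (intro integrable_mult_right integrable_indicator_event E)
      have "expectation (H v) = expectation (\<lambda>\<omega>. \<phi> v) + expectation (\<lambda>\<omega>. \<Sum>l=1..n. D l v * indicator (E l) \<omega>)"
        unfolding H_def by (intro Bochner_Integration.integral_add Bochner_Integration.integrable_sum iDi) simp
      also have "expectation (\<lambda>\<omega>. \<Sum>l=1..n. D l v * indicator (E l) \<omega>) = (\<Sum>l=1..n. expectation (\<lambda>\<omega>. D l v * indicator (E l) \<omega>))"
        by (intro Bochner_Integration.integral_sum iDi)
      finally show ?thesis by (simp add: prob_space)
    qed
    have iHV: "integrable M (\<lambda>\<omega>. H (V \<omega>) \<omega>)"
      unfolding H_def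
      by (intro Bochner_Integration.integrable_add Bochner_Integration.integrable_sum iDE int V)
    have 1: "\<bar>expectation (\<lambda>\<omega>. \<phi> (V \<omega> + U \<omega>)) - expectation (\<lambda>\<omega>. H (V \<omega>) \<omega>)\<bar> \<le> c"
      by (rule expectation_diff_bound[OF int iHV]) (use H in auto)
    have 2: "\<bar>expectation (\<lambda>\<omega>'. \<phi> (v + U \<omega>')) - expectation (H v)\<bar> \<le> c" for v
      by (rule expectation_diff_bound[OF int iH H]) simp
    have meas: "random_variable borel (\<lambda>\<omega>. expectation (\<lambda>\<omega>'. \<phi> (V \<omega> + U \<omega>')))" by measurable
    have iE: "integrable M (\<lambda>\<omega>. expectation (\<lambda>\<omega>'. \<phi> (V \<omega> + U \<omega>')))"
    proof (rule integrable_const_bound[where B=1, OF _ meas], rule AE_I2)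
      fix \<omega>
      have "0 \<le> expectation (\<lambda>\<omega>'. \<phi> (V \<omega> + U \<omega>'))" using \<phi> by (simp add: integral_nonneg)
      moreover have "expectation (\<lambda>\<omega>'. \<phi> (V \<omega> + U \<omega>')) \<le> 1"
        by (rule integral_le_const) (use \<phi> int in auto)
      ultimately show "norm (expectation (\<lambda>\<omega>'. \<phi> (V \<omega> + U \<omega>'))) \<le> 1" by simp
    qed
    have iEH: "integrable M (\<lambda>\<omega>. expectation (H (V \<omega>)))"
      unfolding eH using iD int by simp
    have 3: "\<bar>expectation (\<lambda>\<omega>. expectation (\<lambda>\<omega>'. \<phi> (V \<omega> + U \<omega>'))) - expectation (\<lambda>\<omega>. expectation (H (V \<omega>)))\<bar> \<le> c"
      by (rule expectation_diff_bound[OF iE iEH 2])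
    have cov: "\<bar>expectation (\<lambda>\<omega>. D l (V \<omega>) * indicator (E l) \<omega>) - expectation (\<lambda>\<omega>. D l (V \<omega>)) * prob (E l)\<bar>
         \<le> 2 * c * \<alpha>" for l
    proof -
      \<comment> \<open>Adding \<open>c\<close> makes the increment nonnegative and leaves the covariance unchanged.\<close>
      have "\<bar>expectation (\<lambda>\<omega>. (D l (V \<omega>) + c) * indicator (E l) \<omega>) - expectation (\<lambda>\<omega>. D l (V \<omega>) + c) * prob (E l)\<bar>
         \<le> (2 * c) * \<alpha>"
      proof (rule covariance_event_bound)
        fix t
        have "{v. t \<le> D l v + c} \<in> sets borel" by measurable
        from mix[OF this, of "real l * b / n"]
        show "\<bar>prob ({\<omega>\<in>space M. t \<le> D l (V \<omega>) + c} \<inter> E l) - prob {\<omega>\<in>space M. t \<le> D l (V \<omega>) + c} * prob (E l)\<bar> \<le> \<alpha>"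
          by (simp add: E_def)
      qed (use \<alpha> Dbd[of l] in \<open>auto simp: abs_le_iff\<close>, smt (verit) Dbd)
      moreover have "expectation (\<lambda>\<omega>. (D l (V \<omega>) + c) * indicator (E l) \<omega>)
          = expectation (\<lambda>\<omega>. D l (V \<omega>) * indicator (E l) \<omega>) + c * prob (E l)"
        using iDE by (simp add: distrib_right integrable_indicator_event)
      moreover have "expectation (\<lambda>\<omega>. D l (V \<omega>) + c) = expectation (\<lambda>\<omega>. D l (V \<omega>)) + c"
        using iD by (simp add: prob_space)
      ultimately show ?thesis by (simp add: algebra_simps)
    qed
    have "expectation (\<lambda>\<omega>. H (V \<omega>) \<omega>) - expectation (\<lambda>\<omega>. expectation (H (V \<omega>)))
        = (\<Sum>l=1..n. expectation (\<lambda>\<omega>. D l (V \<omega>) * indicator (E l) \<omega>) - expectation (\<lambda>\<omega>. D l (V \<omega>)) * prob (E l))"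
    proof -
      have "expectation (\<lambda>\<omega>. H (V \<omega>) \<omega>) = expectation (\<lambda>\<omega>. \<phi> (V \<omega>)) + expectation (\<lambda>\<omega>. \<Sum>l=1..n. D l (V \<omega>) * indicator (E l) \<omega>)"
        unfolding H_def by (intro Bochner_Integration.integral_add Bochner_Integration.integrable_sum iDE int V)
      also have "expectation (\<lambda>\<omega>. \<Sum>l=1..n. D l (V \<omega>) * indicator (E l) \<omega>) = (\<Sum>l=1..n. expectation (\<lambda>\<omega>. D l (V \<omega>) * indicator (E l) \<omega>))"
        by (intro Bochner_Integration.integral_sum iDE)
      finally show ?thesis
        unfolding eH using iD int by (simp add: sum_subtractf)
    qed
    also have "\<bar>\<dots>\<bar> \<le> (\<Sum>l=1..n. 2 * c * \<alpha>)"
      by (rule order_trans[OF sum_abs], rule sum_mono, rule cov)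
    also have "\<dots> = 2 * L * b * \<alpha>" using n by (simp add: c_def)
    finally have 4: "\<bar>expectation (\<lambda>\<omega>. H (V \<omega>) \<omega>) - expectation (\<lambda>\<omega>. expectation (H (V \<omega>)))\<bar> \<le> 2 * L * b * \<alpha>" .
    have "2 * (L * b) / n = c + c" by (simp add: c_def)
    then show ?thesis using 1 3 4 unfolding n_def by linarith
  qed
  then show ?thesis by (rule le_by_vanishing_error)
qed

text \<open>
  Averaging over one summand turns the test function \<open>\<phi>\<close> into \<open>s \<mapsto> E \<phi>(s + U j)\<close>.  This has the same Lipschitz
  constant and range, and its exponential majorant is multiplied by the exponential moment of the
  summand; hence the induction runs over all test functions and all constants \<open>c\<close>.
\<close>

lemma decouple_sum:
  fixes U :: "'j \<Rightarrow> 'a \<Rightarrow> real" and \<phi> :: "real \<Rightarrow> real"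
  assumes "finite J"
    and "\<And>j. j \<in> J \<Longrightarrow> random_variable borel (U j)"
    and "\<And>j \<omega>. j \<in> J \<Longrightarrow> \<omega> \<in> space M \<Longrightarrow> 0 \<le> U j \<omega> \<and> U j \<omega> \<le> b j" and \<alpha>: "0 \<le> \<alpha>"
    and "\<And>j I A s. j \<in> J \<Longrightarrow> I \<subseteq> J \<Longrightarrow> j \<notin> I \<Longrightarrow> A \<in> sets borel \<Longrightarrow>
       \<bar>prob ({\<omega>\<in>space M. (\<Sum>i\<in>I. U i \<omega>) \<in> A} \<inter> {\<omega>\<in>space M. s \<le> U j \<omega>})
         - prob {\<omega>\<in>space M. (\<Sum>i\<in>I. U i \<omega>) \<in> A} * prob {\<omega>\<in>space M. s \<le> U j \<omega>}\<bar> \<le> \<alpha>"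
    and "\<And>x y. \<bar>\<phi> x - \<phi> y\<bar> \<le> L * \<bar>x - y\<bar>" and "\<And>x. 0 \<le> \<phi> x \<and> \<phi> x \<le> 1"
    and "\<And>x. \<phi> x \<le> c * exp (l * x)" and "0 \<le> c"
  shows "expectation (\<lambda>\<omega>. \<phi> (\<Sum>j\<in>J. U j \<omega>)) \<le>
           c * (\<Prod>j\<in>J. expectation (\<lambda>\<omega>. exp (l * U j \<omega>))) + 2 * L * \<alpha> * (\<Sum>j\<in>J. b j)"
  using assms(1-3,5-)
proof (induction J arbitrary: \<phi> c rule: finite_induct)
  case empty
  show ?case using empty(6)[of 0] by (simp add: prob_space)
next
  case (insert j J)
  note lip = insert.prems(4) and \<phi> = insert.prems(5) and exp = insert.prems(6)
  have [measurable]: "random_variable borel (U i)" if "i \<in> insert j J" for i using insert.prems(1) that by blast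
  then have [measurable]: "random_variable borel (U j)" by simp
  define V where "V \<omega> = (\<Sum>i\<in>J. U i \<omega>)" for \<omega>
  have [measurable]: "random_variable borel V" unfolding V_def using insert.prems(1) by measurable
  define \<psi> where "\<psi> s = expectation (\<lambda>\<omega>. \<phi> (s + U j \<omega>))" for s
  have L: "0 \<le> L" using lip[of 1 0] by simp
  have "continuous_on UNIV \<phi>"
    by (rule lipschitz_on_continuous_on[of L]) (use lip L in \<open>auto simp: lipschitz_on_def dist_real_def\<close>)
  then have [measurable]: "\<phi> \<in> borel_measurable borel" by (rule borel_measurable_continuous_onI)
  have int: "integrable M (\<lambda>\<omega>. \<phi> (f \<omega>))" if [measurable]: "random_variable borel f" for f
    by (rule integrable_const_bound[where B=1]) (use \<phi> in auto)
  have bj: "0 \<le> U j \<omega> \<and> U j \<omega> \<le> b j" if "\<omega> \<in> space M" for \<omega> using insert.prems(2) that by blast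
  have iexp: "integrable M (\<lambda>\<omega>. exp (l * U j \<omega>))"
  proof (rule integrable_const_bound[where B="exp (\<bar>l\<bar> * b j)"], rule AE_I2)
    fix \<omega> assume \<omega>: "\<omega> \<in> space M"
    have "l * U j \<omega> \<le> \<bar>l\<bar> * U j \<omega>" using bj[OF \<omega>] by (intro mult_right_mono) auto
    also have "\<dots> \<le> \<bar>l\<bar> * b j" using bj[OF \<omega>] by (intro mult_left_mono) auto
    finally show "norm (exp (l * U j \<omega>)) \<le> exp (\<bar>l\<bar> * b j)" by simp
  qed simp
  have "expectation (\<lambda>\<omega>. \<phi> (\<Sum>i\<in>insert j J. U i \<omega>)) = expectation (\<lambda>\<omega>. \<phi> (V \<omega> + U j \<omega>))"
    using insert.hyps by (simp add: V_def add.commute)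
  also have "\<dots> \<le> expectation (\<lambda>\<omega>. \<psi> (V \<omega>)) + 2 * L * b j * \<alpha>"
  proof -
    have "\<bar>expectation (\<lambda>\<omega>. \<phi> (V \<omega> + U j \<omega>)) - expectation (\<lambda>\<omega>. expectation (\<lambda>\<omega>'. \<phi> (V \<omega> + U j \<omega>')))\<bar>
         \<le> 2 * L * b j * \<alpha>"
    proof (rule decouple_summand)
      show "\<bar>prob ({\<omega>\<in>space M. V \<omega> \<in> A} \<inter> {\<omega>\<in>space M. s \<le> U j \<omega>})
         - prob {\<omega>\<in>space M. V \<omega> \<in> A} * prob {\<omega>\<in>space M. s \<le> U j \<omega>}\<bar> \<le> \<alpha>" if "A \<in> sets borel" for A s
        unfolding V_def by (rule insert.prems(3)) (use insert.hyps that in auto)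
    qed (use bj \<alpha> lip \<phi> in auto)
    then show ?thesis unfolding \<psi>_def by linarith
  qed
  also have "expectation (\<lambda>\<omega>. \<psi> (V \<omega>)) \<le>
      c * expectation (\<lambda>\<omega>. exp (l * U j \<omega>)) * (\<Prod>j\<in>J. expectation (\<lambda>\<omega>. exp (l * U j \<omega>))) + 2 * L * \<alpha> * (\<Sum>j\<in>J. b j)"
    unfolding V_def
  proof (rule insert.IH)
    fix x y
    have "\<bar>\<phi> (x + U j \<omega>) - \<phi> (y + U j \<omega>)\<bar> \<le> L * \<bar>x - y\<bar>" for \<omega>
      using lip[of "x + U j \<omega>" "y + U j \<omega>"] by simp
    then show "\<bar>\<psi> x - \<psi> y\<bar> \<le> L * \<bar>x - y\<bar>"
      unfolding \<psi>_def by (intro expectation_diff_bound int) auto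
  next
    fix x
    have "0 \<le> \<psi> x" unfolding \<psi>_def using \<phi> by (simp add: integral_nonneg)
    moreover have "\<psi> x \<le> 1"
      unfolding \<psi>_def by (rule integral_le_const) (use \<phi> int in auto)
    ultimately show "0 \<le> \<psi> x \<and> \<psi> x \<le> 1" by simp
  next
    fix x
    have "\<psi> x \<le> expectation (\<lambda>\<omega>. c * exp (l * x) * exp (l * U j \<omega>))"
      unfolding \<psi>_def
    proof (rule integral_mono)
      fix \<omega>
      show "\<phi> (x + U j \<omega>) \<le> c * exp (l * x) * exp (l * U j \<omega>)"
        using exp[of "x + U j \<omega>"] by (simp add: distrib_left exp_add mult.assoc)
    qed (use int iexp in auto)
    then show "\<psi> x \<le> c * expectation (\<lambda>\<omega>. exp (l * U j \<omega>)) * exp (l * x)"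
      by (simp add: algebra_simps)
  next
    show "0 \<le> c * expectation (\<lambda>\<omega>. exp (l * U j \<omega>))"
      using insert.prems(7) by (simp add: integral_nonneg)
  next
    fix i I s and A :: "real set" assume "i \<in> J" "I \<subseteq> J" "i \<notin> I" "A \<in> sets borel"
    then show "\<bar>prob ({\<omega>\<in>space M. (\<Sum>i\<in>I. U i \<omega>) \<in> A} \<inter> {\<omega>\<in>space M. s \<le> U i \<omega>})
         - prob {\<omega>\<in>space M. (\<Sum>i\<in>I. U i \<omega>) \<in> A} * prob {\<omega>\<in>space M. s \<le> U i \<omega>}\<bar> \<le> \<alpha>"
      by (intro insert.prems(3)) auto
  qed (use insert.prems in auto)
  finally show ?case using insert.hyps by (simp add: algebra_simps)
qed

text \<open>
  The variance is bounded through \<open>U\<^sup>2 \<le> b U\<close>, so the mean is the only moment that appears.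
\<close>

lemma exp_moment_bound:
  fixes U :: "'a \<Rightarrow> real"
  assumes U[measurable]: "random_variable borel U"
    and bd: "\<And>\<omega>. \<omega> \<in> space M \<Longrightarrow> 0 \<le> U \<omega> \<and> U \<omega> \<le> b" and l: "\<bar>l\<bar> * b \<le> 1"
  shows "expectation (\<lambda>\<omega>. exp (l * U \<omega>)) \<le> exp (l * expectation U + l\<^sup>2 * b * expectation U)"
proof -
  have exp2: "exp x \<le> 1 + x + x\<^sup>2" if "\<bar>x\<bar> \<le> 1" for x :: real
  proof (cases "0 \<le> x")
    case True
    then show ?thesis using exp_bound[of x] that by simp
  next
    case False
    define y where "y = -x"
    have y: "0 < y" "y \<le> 1" using False that by (auto simp: y_def)
    have "1 \<le> (1 - y + y\<^sup>2) * (1 + y)"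
      using y by (simp add: algebra_simps power2_eq_square)
    also have "\<dots> \<le> (1 - y + y\<^sup>2) * exp y"
      using y exp_ge_add_one_self[of y] by (intro mult_left_mono) (auto simp: power2_eq_square)
    finally have "exp (-y) \<le> 1 - y + y\<^sup>2"
      by (simp add: exp_minus field_simps)
    then show ?thesis by (simp add: y_def)
  qed
  have iU: "integrable M U"
    by (rule integrable_const_bound[where B=b]) (use bd in auto)
  have pt: "exp (l * U \<omega>) \<le> 1 + (l + l\<^sup>2 * b) * U \<omega>" if "\<omega> \<in> space M" for \<omega>
  proof -
    have "\<bar>l * U \<omega>\<bar> \<le> \<bar>l\<bar> * b" using bd[OF that] by (auto simp: abs_mult intro!: mult_left_mono)
    then have "exp (l * U \<omega>) \<le> 1 + l * U \<omega> + (l * U \<omega>)\<^sup>2" using l by (intro exp2) auto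
    also have "(l * U \<omega>)\<^sup>2 = l\<^sup>2 * (U \<omega> * U \<omega>)" by (simp add: power2_eq_square)
    also have "\<dots> \<le> l\<^sup>2 * (b * U \<omega>)" using bd[OF that] by (intro mult_left_mono mult_right_mono) auto
    finally show ?thesis by (simp add: algebra_simps)
  qed
  have "expectation (\<lambda>\<omega>. exp (l * U \<omega>)) \<le> expectation (\<lambda>\<omega>. 1 + (l + l\<^sup>2 * b) * U \<omega>)"
  proof (rule integral_mono_AE)
    show "integrable M (\<lambda>\<omega>. exp (l * U \<omega>))"
    proof (rule integrable_const_bound[where B="1 + (\<bar>l\<bar> + l\<^sup>2 * b) * b"], rule AE_I2)
      fix \<omega> assume \<omega>: "\<omega> \<in> space M"
      have "0 \<le> b" using bd[OF \<omega>] by linarith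
      then have "(l + l\<^sup>2 * b) * U \<omega> \<le> (\<bar>l\<bar> + l\<^sup>2 * b) * b"
        using bd[OF \<omega>] by (intro mult_mono) auto
      then show "norm (exp (l * U \<omega>)) \<le> 1 + (\<bar>l\<bar> + l\<^sup>2 * b) * b" using pt[OF \<omega>] by simp
    qed simp
  qed (use iU pt in auto)
  also have "\<dots> = 1 + (l + l\<^sup>2 * b) * expectation U" using iU by (simp add: prob_space)
  also have "\<dots> \<le> exp ((l + l\<^sup>2 * b) * expectation U)" by (rule exp_ge_add_one_self)
  finally show ?thesis by (simp add: algebra_simps)
qed

text \<open>
  The test function is the ramp that rises from 0 to 1 between the deviations \<open>e\<close> and \<open>2 e\<close>: its slope is
  \<open>1 / e\<close>, it dominates the indicator of a deviation beyond \<open>2 e\<close>, and it is dominated by an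
  exponential that equals 1 where the ramp starts.
\<close>

lemma mixing_chernoff:
  fixes U :: "'j \<Rightarrow> 'a \<Rightarrow> real"
  assumes J: "finite J"
    and rv[measurable]: "\<And>j. j \<in> J \<Longrightarrow> random_variable borel (U j)"
    and bd: "\<And>j \<omega>. j \<in> J \<Longrightarrow> \<omega> \<in> space M \<Longrightarrow> 0 \<le> U j \<omega> \<and> U j \<omega> \<le> b j" and \<alpha>: "0 \<le> \<alpha>"
    and mix: "\<And>j I A s. j \<in> J \<Longrightarrow> I \<subseteq> J \<Longrightarrow> j \<notin> I \<Longrightarrow> A \<in> sets borel \<Longrightarrow>
       \<bar>prob ({\<omega>\<in>space M. (\<Sum>i\<in>I. U i \<omega>) \<in> A} \<inter> {\<omega>\<in>space M. s \<le> U j \<omega>})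
         - prob {\<omega>\<in>space M. (\<Sum>i\<in>I. U i \<omega>) \<in> A} * prob {\<omega>\<in>space M. s \<le> U j \<omega>}\<bar> \<le> \<alpha>"
    and B: "0 < B" "\<And>j. j \<in> J \<Longrightarrow> b j \<le> B"
    and m: "(\<Sum>j\<in>J. expectation (U j)) \<le> G" "0 < G" and e: "0 < e"
  shows "prob {\<omega>\<in>space M. 2 * e \<le> \<bar>(\<Sum>j\<in>J. U j \<omega>) - (\<Sum>j\<in>J. expectation (U j))\<bar>}
     \<le> 2 * exp (- (min 1 (e / (2 * G)) * e / 2) / B) + 4 * \<alpha> / e * (\<Sum>j\<in>J. b j)"
proof -
  \<comment> \<open>The exponential rate is \<open>\<tau> / B\<close>; the second bound on \<open>\<tau>\<close> keeps the quadratic term \<open>\<tau>\<^sup>2 G / B\<close>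
    below half of the linear one.\<close>
  define \<tau> where "\<tau> = min 1 (e / (2 * G))"
  define m where "m = (\<Sum>j\<in>J. expectation (U j))"
  define S where "S \<omega> = (\<Sum>j\<in>J. U j \<omega>)" for \<omega>
  have Sm[measurable]: "random_variable borel S" unfolding S_def using rv by measurable
  have \<tau>: "0 < \<tau>" "\<tau> \<le> 1" "\<tau> * G \<le> e / 2"
    using e m by (auto simp: \<tau>_def min_def field_simps)
  have tail: "prob {\<omega>\<in>space M. 2 * e \<le> \<sigma> * (S \<omega> - m)} \<le>
       exp (- (\<tau> * e / 2) / B) + 2 * \<alpha> / e * (\<Sum>j\<in>J. b j)" if \<sigma>: "\<sigma> \<in> {1, -1}" for \<sigma> :: real
  proof -
    define l where "l = \<sigma> * \<tau> / B"
    have l: "\<bar>l\<bar> * B \<le> 1" "l\<^sup>2 = \<tau>\<^sup>2 / B\<^sup>2"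
      using \<sigma> B \<tau> by (auto simp: l_def abs_mult power_mult_distrib power_divide)
    define \<phi> where "\<phi> s = max 0 (min 1 ((\<sigma> * (s - m) - e) / e))" for s
    define c where "c = exp (- (l * m) - \<tau> / B * e)"
    have lip: "\<bar>\<phi> x - \<phi> y\<bar> \<le> 1 / e * \<bar>x - y\<bar>" for x y
    proof -
      have "\<bar>\<phi> x - \<phi> y\<bar> \<le> \<bar>(\<sigma> * (x - m) - e) / e - (\<sigma> * (y - m) - e) / e\<bar>"
        unfolding \<phi>_def by (auto simp: max_def min_def)
      also have "(\<sigma> * (x - m) - e) / e - (\<sigma> * (y - m) - e) / e = \<sigma> * (x - y) / e"
        by (simp add: diff_divide_distrib[symmetric] algebra_simps)
      also have "\<bar>\<dots>\<bar> = 1 / e * \<bar>x - y\<bar>" using \<sigma> e by (auto simp: abs_mult)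
      finally show ?thesis .
    qed
    have \<phi>01: "0 \<le> \<phi> x \<and> \<phi> x \<le> 1" for x by (auto simp: \<phi>_def)
    have \<phi>exp: "\<phi> x \<le> c * exp (l * x)" for x
    proof -
      have *: "c * exp (l * x) = exp (\<tau> / B * (\<sigma> * (x - m) - e))"
        by (simp add: c_def l_def exp_add[symmetric] algebra_simps)
      show ?thesis
      proof (cases "\<sigma> * (x - m) - e \<le> 0")
        case True
        then have "(\<sigma> * (x - m) - e) / e \<le> 0" using e by (simp add: divide_nonpos_pos)
        then have "\<phi> x = 0" by (auto simp: \<phi>_def)
        then show ?thesis by (simp add: c_def)
      next
        case False
        then have "1 \<le> exp (\<tau> / B * (\<sigma> * (x - m) - e))" using \<tau> B by simp
        then show ?thesis using \<phi>01[of x] * by linarith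
      qed
    qed
    have "prob {\<omega>\<in>space M. 2 * e \<le> \<sigma> * (S \<omega> - m)} = expectation (indicator {\<omega>\<in>space M. 2 * e \<le> \<sigma> * (S \<omega> - m)})"
      by simp
    also have "\<dots> \<le> expectation (\<lambda>\<omega>. \<phi> (S \<omega>))"
    proof (rule integral_mono_AE)
      show "integrable M (\<lambda>\<omega>. \<phi> (S \<omega>))"
        by (rule integrable_const_bound[where B=1]) (use \<phi>01 in \<open>auto simp: \<phi>_def\<close>)
      show "AE \<omega> in M. indicator {\<omega>\<in>space M. 2 * e \<le> \<sigma> * (S \<omega> - m)} \<omega> \<le> \<phi> (S \<omega>)"
      proof (rule AE_I2)
        fix \<omega>
        have "\<phi> (S \<omega>) = 1" if "2 * e \<le> \<sigma> * (S \<omega> - m)"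
        proof -
          have "1 \<le> (\<sigma> * (S \<omega> - m) - e) / e" using that e by (simp add: field_simps)
          then show ?thesis by (simp add: \<phi>_def)
        qed
        then show "indicator {\<omega>\<in>space M. 2 * e \<le> \<sigma> * (S \<omega> - m)} \<omega> \<le> \<phi> (S \<omega>)"
          using \<phi>01[of "S \<omega>"] by (auto simp: indicator_def)
      qed
    qed (simp add: integrable_indicator_event)
    also have "\<dots> \<le> c * (\<Prod>j\<in>J. expectation (\<lambda>\<omega>. exp (l * U j \<omega>))) + 2 * (1 / e) * \<alpha> * (\<Sum>j\<in>J. b j)"
      unfolding S_def
      by (rule decouple_sum[OF J rv bd \<alpha> mix lip \<phi>01 \<phi>exp]) (auto simp: c_def)
    also have "(\<Prod>j\<in>J. expectation (\<lambda>\<omega>. exp (l * U j \<omega>)))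
        \<le> (\<Prod>j\<in>J. exp ((l + l\<^sup>2 * B) * expectation (U j)))"
    proof (rule prod_mono, intro conjI)
      fix j assume j: "j \<in> J"
      show "0 \<le> expectation (\<lambda>\<omega>. exp (l * U j \<omega>))" by (simp add: integral_nonneg)
      have "0 \<le> U j \<omega> \<and> U j \<omega> \<le> B" if "\<omega> \<in> space M" for \<omega>
        using bd[OF j that] B(2)[OF j] by linarith
      from exp_moment_bound[OF rv[OF j] this l(1)]
      show "expectation (\<lambda>\<omega>. exp (l * U j \<omega>)) \<le> exp ((l + l\<^sup>2 * B) * expectation (U j))"
        by (simp add: algebra_simps)
    qed
    also have "(\<Prod>j\<in>J. exp ((l + l\<^sup>2 * B) * expectation (U j))) = exp ((l + l\<^sup>2 * B) * m)"
      unfolding m_def using J by (simp add: exp_sum sum_distrib_left)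
    also have "c * exp ((l + l\<^sup>2 * B) * m) = exp (- (\<tau> / B * e) + \<tau>\<^sup>2 / B * m)"
    proof -
      have "l\<^sup>2 * B = \<tau>\<^sup>2 / B" unfolding l(2) using B by (simp add: power2_eq_square)
      then show ?thesis by (simp add: c_def exp_add[symmetric] distrib_right)
    qed
    also have "\<dots> \<le> exp (- (\<tau> * e / 2) / B)"
    proof -
      have "\<tau>\<^sup>2 / B * m \<le> \<tau>\<^sup>2 / B * G" using assms(8) B unfolding m_def by (intro mult_left_mono) auto
      also have "\<dots> = \<tau> / B * (\<tau> * G)" by (simp add: power2_eq_square)
      also have "\<dots> \<le> \<tau> / B * (e / 2)" using \<tau> B by (intro mult_left_mono) auto
      finally show ?thesis by (simp add: field_simps)
    qed
    finally show ?thesis by (simp add: c_def mult_left_mono)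
  qed
  have "prob {\<omega>\<in>space M. 2 * e \<le> \<bar>S \<omega> - m\<bar>} \<le>
     prob ({\<omega>\<in>space M. 2 * e \<le> 1 * (S \<omega> - m)} \<union> {\<omega>\<in>space M. 2 * e \<le> (-1) * (S \<omega> - m)})"
    by (rule finite_measure_mono) auto
  also have "\<dots> \<le> prob {\<omega>\<in>space M. 2 * e \<le> 1 * (S \<omega> - m)} + prob {\<omega>\<in>space M. 2 * e \<le> (-1) * (S \<omega> - m)}"
    by (rule measure_Un_le) auto
  also have "\<dots> \<le> (exp (- (\<tau> * e / 2) / B) + 2 * \<alpha> / e * (\<Sum>j\<in>J. b j)) + (exp (- (\<tau> * e / 2) / B) + 2 * \<alpha> / e * (\<Sum>j\<in>J. b j))"
    by (intro add_mono tail) auto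
  finally show ?thesis unfolding S_def m_def \<tau>_def by simp
qed

end

section \<open>Concentration of sums over index boxes\<close>

lemma bij_betw_vec_nth: "bij_betw vec_nth {i :: 'a ^ 'n. \<forall>k. i $ k \<in> A k} (PiE UNIV A)"
  by (rule bij_betwI[where g=vec_lambda]) (auto simp: PiE_def Pi_def)

lemma finite_vec_box: "(\<And>k. finite (A k)) \<Longrightarrow> finite {i :: 'a ^ 'n. \<forall>k. i $ k \<in> A k}"
  using bij_betw_finite[OF bij_betw_vec_nth[of A]] by (simp add: finite_PiE)

lemma card_vec_box: "card {i :: 'a ^ 'n. \<forall>k. i $ k \<in> A k} = (\<Prod>k\<in>UNIV. card (A k))"
  using bij_betw_same_card[OF bij_betw_vec_nth[of A]] by (simp add: card_PiE)

lemma finite_index_box: "finite (index_box n)"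
  and card_index_box: "card (index_box n) = index_volume n"
proof -
  have eq: "index_box n = {i. \<forall>k. i $ k \<in> {1..n $ k}}" by (auto simp: index_box_def)
  show "finite (index_box n)" unfolding eq by (rule finite_vec_box) simp
  show "card (index_box n) = index_volume n"
    unfolding eq card_vec_box index_volume_def by simp
qed

lemma index_box_pos: "index_box n \<subseteq> pos_indices"
  by (auto simp: index_box_def pos_indices_def)

text \<open>
  Indices start at 1, whence the shift before the division.
\<close>

definition block_index :: "nat \<Rightarrow> nat ^ 'N \<Rightarrow> nat ^ 'N" where
  "block_index q i = (\<chi> k. (i $ k - 1) div q)"

definition block_at :: "nat ^ 'N \<Rightarrow> nat \<Rightarrow> nat ^ 'N \<Rightarrow> (nat ^ 'N) set" where
  "block_at n q v = {i \<in> index_box n. block_index q i = v}"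

lemma card_block_at:
  fixes v :: "nat ^ 'N"
  assumes "0 < q" shows "card (block_at n q v) \<le> q ^ CARD('N)"
proof -
  have "block_at n q v \<subseteq> {i. \<forall>k. i $ k \<in> {v $ k * q + 1..v $ k * q + q}}"
  proof (rule subsetI, rule CollectI, rule allI)
    fix i k assume "i \<in> block_at n q v"
    then have *: "1 \<le> i $ k" "v $ k = (i $ k - 1) div q"
      by (auto simp: block_at_def index_box_def block_index_def)
    have "(i $ k - 1) div q * q + (i $ k - 1) mod q = i $ k - 1" by simp
    moreover have "(i $ k - 1) mod q < q" using assms by simp
    ultimately show "i $ k \<in> {v $ k * q + 1..v $ k * q + q}"
      using *(1) unfolding *(2) atLeastAtMost_iff by linarith
  qed
  then have "card (block_at n q v) \<le> card {i :: nat ^ 'N. \<forall>k. i $ k \<in> {v $ k * q + 1..v $ k * q + q}}"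
    by (intro card_mono finite_vec_box) auto
  also have "\<dots> = q ^ CARD('N)" unfolding card_vec_box by simp
  finally show ?thesis .
qed

text \<open>
  Two distinct block positions with equal parities differ by at least 2 in some coordinate, which leaves a
  full block between them.
\<close>

lemma blocks_separated:
  fixes i j :: "nat ^ 'N"
  assumes q: "0 < q" and pos: "i \<in> pos_indices" "j \<in> pos_indices"
    and ne: "block_index q i \<noteq> block_index q j"
    and par: "\<And>k. odd (block_index q i $ k) \<longleftrightarrow> odd (block_index q j $ k)"
  shows "real q \<le> dist (real_index i) (real_index j)"
proof -
  obtain k where k: "block_index q i $ k \<noteq> block_index q j $ k" using ne by (auto simp: vec_eq_iff)
  have gap: "real q \<le> real y - real x"
    if "(x - 1) div q < (y - 1) div q" "odd ((x - 1) div q) = odd ((y - 1) div q)" "1 \<le> x" "1 \<le> y" for x y :: nat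
  proof -
    have "(x - 1) div q + 2 \<le> (y - 1) div q" using that(1,2) by (metis Suc_leI add_2_eq_Suc' dvd_add_triv_right_iff even_Suc le_neq_implies_less)
    then have "((x - 1) div q + 2) * q \<le> (y - 1) div q * q" by (rule mult_right_mono) simp
    also have "\<dots> \<le> y - 1" by simp
    finally have "(x - 1) div q * q + 2 * q \<le> y - 1" by (simp add: distrib_right)
    moreover have "x - 1 = (x - 1) div q * q + (x - 1) mod q" by simp
    moreover have "(x - 1) mod q < q" using q by simp
    ultimately have "x + q \<le> y" using that(3,4) by linarith
    then show ?thesis by linarith
  qed
  have "real q \<le> \<bar>real (i $ k) - real (j $ k)\<bar>"
    using gap[of "i $ k" "j $ k"] gap[of "j $ k" "i $ k"] k par[of k] pos
    by (auto simp: block_index_def pos_indices_def neq_iff)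
  also have "\<dots> = \<bar>(real_index i - real_index j) $ k\<bar>" by (simp add: real_index_def)
  also have "\<dots> \<le> dist (real_index i) (real_index j)"
    unfolding dist_norm by (rule component_le_norm_cart)
  finally show ?thesis .
qed

lemma generated_events_sum:
  fixes k :: "'b::topological_space \<Rightarrow> real"
  assumes [measurable]: "k \<in> borel_measurable borel" "A \<in> sets borel"
  shows "{\<omega>\<in>space M. (\<Sum>i\<in>E. k (Z i \<omega>)) \<in> A} \<in> generated_events M Z E"
proof -
  define G where "G = (\<Union>i\<in>E. {Z i -` A \<inter> space M | A. A \<in> sets borel})"
  define N where "N = sigma (space M) G"
  have sub: "G \<subseteq> Pow (space M)" by (auto simp: G_def)
  have sets: "sets N = generated_events M Z E" and space: "space N = space M"
    using sub by (auto simp: N_def generated_events_def G_def space_measure_of_conv)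
  have [measurable]: "Z i \<in> measurable N borel" if "i \<in> E" for i
  proof (rule measurableI)
    fix A :: "'b set" assume "A \<in> sets borel"
    then have "Z i -` A \<inter> space M \<in> G" using that by (auto simp: G_def)
    then show "Z i -` A \<inter> space N \<in> sets N"
      unfolding space using sub by (simp add: N_def sigma_sets.Basic)
  qed simp
  have "{\<omega>\<in>space N. (\<Sum>i\<in>E. k (Z i \<omega>)) \<in> A} \<in> sets N"
    by measurable
  then show ?thesis by (simp add: sets space)
qed

text \<open>
  Each parity class is a family of separated blocks to which \<open>mixing_chernoff\<close> applies, and the
  \<open>2\<^sup>N\<close> classes share the deviation equally.  Blocks at the boundary of the box may be smaller than \<open>q\<^sup>N\<close>, or
  the box may be thinner than \<open>q\<close>; therefore the mixing error is expressed by the total range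
  \<open>c V\<close>, which does not depend on how the box is cut.
\<close>

lemma (in prob_space) index_box_concentration:
  fixes Z :: "nat ^ 'N \<Rightarrow> 'a \<Rightarrow> 'b::topological_space" and k :: "'b \<Rightarrow> real"
  assumes mixing: "mixing_field M Z \<phi> chi"
    and Z[measurable]: "\<And>i. i \<in> pos_indices \<Longrightarrow> random_variable borel (Z i)"
    and k[measurable]: "k \<in> borel_measurable borel" and kbd: "\<And>z. 0 \<le> k z \<and> k z \<le> c" and c: "0 < c"
    and q: "0 < q" and G: "(\<Sum>i\<in>index_box n. expectation (\<lambda>\<omega>. k (Z i \<omega>))) \<le> G" "0 < G" and e: "0 < e"
  shows "prob {\<omega>\<in>space M. 2 ^ CARD('N) * (2 * e) \<le>
            \<bar>(\<Sum>i\<in>index_box n. k (Z i \<omega>)) - (\<Sum>i\<in>index_box n. expectation (\<lambda>\<omega>. k (Z i \<omega>)))\<bar>}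
     \<le> 2 ^ CARD('N) * (2 * exp (- (min 1 (e / (2 * G)) * e / 2) / (c * real q ^ CARD('N)))
         + 4 * (\<phi> (index_volume n) (q ^ CARD('N)) * chi q) / e * (c * real (index_volume n)))"
proof -
  define B where "B = index_box n"
  have Bfin: "finite B" unfolding B_def by (rule finite_index_box)
  have Bpos: "B \<subseteq> pos_indices" unfolding B_def by (rule index_box_pos)
  define \<alpha> where "\<alpha> = \<phi> (index_volume n) (q ^ CARD('N)) * chi q"
  have mix_ineq: "\<bar>prob (A \<inter> A') - prob A * prob A'\<bar> \<le> \<phi> (card E) (card E') * chi (setdist (real_index ` E) (real_index ` E'))"
    if "finite E" "finite E'" "E \<subseteq> pos_indices" "E' \<subseteq> pos_indices"
      "A \<in> generated_events M Z E" "A' \<in> generated_events M Z E'" for E E' A A'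
    by (rule mixing[unfolded mixing_field_def, THEN conjunct2, THEN conjunct2, THEN conjunct2, THEN conjunct2,
          THEN conjunct2, THEN conjunct2, rule_format, OF that])
  have phi_mono: "\<phi> a b \<le> \<phi> a' b'" if "a \<le> a'" "b \<le> b'" for a b a' b'
  proof -
    have "\<phi> a b \<le> \<phi> a' b" "\<phi> a' b \<le> \<phi> a' b'"
      using mixing that unfolding mixing_field_def by simp_all
    then show ?thesis by linarith
  qed
  have phi0: "0 \<le> \<phi> a b" for a b using mixing by (auto simp: mixing_field_def)
  have chi0: "0 \<le> chi t" if "0 \<le> t" for t using mixing that by (auto simp: mixing_field_def)
  have \<alpha>: "0 \<le> \<alpha>" unfolding \<alpha>_def using phi0 chi0 by simp
  define U where "U v \<omega> = (\<Sum>i\<in>block_at n q v. k (Z i \<omega>))" for v \<omega>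
  define b where "b v = c * real (card (block_at n q v))" for v
  define par where "par v = {k. odd (v $ k)}" for v :: "nat ^ 'N"
  define J where "J p = {v \<in> block_index q ` B. par v = p}" for p
  have Jfin: "finite (J p)" for p unfolding J_def using Bfin by simp
  have blk: "block_at n q v \<subseteq> B" for v by (auto simp: block_at_def B_def)
  have blkfin: "finite (block_at n q v)" for v using finite_subset[OF blk Bfin] .
  have kZ[measurable]: "random_variable borel (\<lambda>\<omega>. k (Z i \<omega>))" if "i \<in> B" for i
    by (rule measurable_compose[OF Z k]) (use that Bpos in blast)
  have kint: "integrable M (\<lambda>\<omega>. k (Z i \<omega>))" if "i \<in> B" for i
    by (rule integrable_const_bound[where B=c]) (use kbd that in auto)
  have Um[measurable]: "random_variable borel (U v)" for v
    unfolding U_def by (rule borel_measurable_sum) (use kZ blk in blast)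
  have Ubd: "0 \<le> U v \<omega> \<and> U v \<omega> \<le> b v" for v \<omega>
  proof
    show "0 \<le> U v \<omega>" unfolding U_def using kbd by (simp add: sum_nonneg)
    have "U v \<omega> \<le> (\<Sum>i\<in>block_at n q v. c)" unfolding U_def by (rule sum_mono) (use kbd in auto)
    then show "U v \<omega> \<le> b v" by (simp add: b_def mult.commute)
  qed
  have Ue: "expectation (U v) = (\<Sum>i\<in>block_at n q v. expectation (\<lambda>\<omega>. k (Z i \<omega>)))" for v
    unfolding U_def by (rule Bochner_Integration.integral_sum) (use kint blk in auto)
  have split: "(\<Sum>p\<in>UNIV. \<Sum>v\<in>J p. \<Sum>i\<in>block_at n q v. t i) = (\<Sum>i\<in>B. t i)" for t :: "nat ^ 'N \<Rightarrow> real"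
  proof -
    have "(\<Sum>p\<in>UNIV. \<Sum>v\<in>J p. \<Sum>i\<in>block_at n q v. t i) = (\<Sum>v\<in>block_index q ` B. \<Sum>i\<in>block_at n q v. t i)"
      unfolding J_def by (rule sum.group) (use Bfin in auto)
    also have "\<dots> = (\<Sum>i\<in>B. t i)"
      unfolding block_at_def B_def[symmetric] by (rule sum.group) (use Bfin in auto)
    finally show ?thesis .
  qed
  have part: "(\<Sum>v\<in>J p. \<Sum>i\<in>block_at n q v. t i) \<le> (\<Sum>i\<in>B. t i)" if "\<And>i. 0 \<le> t i" for t :: "nat ^ 'N \<Rightarrow> real" and p
    unfolding split[symmetric]
    by (rule member_le_sum[of p UNIV "\<lambda>p. \<Sum>v\<in>J p. \<Sum>i\<in>block_at n q v. t i"]) (use that in \<open>auto intro!: sum_nonneg\<close>)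
  have class_tail: "prob {\<omega>\<in>space M. 2 * e \<le> \<bar>(\<Sum>v\<in>J p. U v \<omega>) - (\<Sum>v\<in>J p. expectation (U v))\<bar>} \<le>
     2 * exp (- (min 1 (e / (2 * G)) * e / 2) / (c * real q ^ CARD('N))) + 4 * \<alpha> / e * (c * real (index_volume n))" for p
  proof -
    have "prob {\<omega>\<in>space M. 2 * e \<le> \<bar>(\<Sum>v\<in>J p. U v \<omega>) - (\<Sum>v\<in>J p. expectation (U v))\<bar>} \<le>
     2 * exp (- (min 1 (e / (2 * G)) * e / 2) / (c * real q ^ CARD('N))) + 4 * \<alpha> / e * (\<Sum>v\<in>J p. b v)"
    proof (rule mixing_chernoff)
      fix v I A s assume v: "v \<in> J p" and I: "I \<subseteq> J p" "v \<notin> I" and A: "(A :: real set) \<in> sets borel"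
      let ?A = "{\<omega>\<in>space M. (\<Sum>i\<in>I. U i \<omega>) \<in> A}" and ?B = "{\<omega>\<in>space M. s \<le> U v \<omega>}"
      show "\<bar>prob (?A \<inter> ?B)
         - prob ?A * prob ?B\<bar> \<le> \<alpha>"
      \<comment> \<open>The empty family is treated apart: it generates only trivial events, whereas the distance
        from an empty set is 0 by convention and not at least \<open>q\<close>.\<close>
      proof (cases "I = {}")
        case True
        then show ?thesis using \<alpha> by (cases "0 \<in> A") (auto simp: prob_space Int_absorb1 Collect_conj_eq)
      next
        case False
        define E where "E = (\<Union>u\<in>I. block_at n q u)"
        have Ifin: "finite I" using I Jfin finite_subset by blast
        have EB: "E \<subseteq> B" unfolding E_def using blk by blast
        have Efin: "finite E" using finite_subset[OF EB Bfin] .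
        have ne: "block_at n q u \<noteq> {}" if "u \<in> J p" for u
          using that by (auto simp: J_def block_at_def B_def)
        have Ene: "E \<noteq> {}" unfolding E_def using False I(1) ne by blast
        have "(\<Sum>i\<in>I. U i \<omega>) = (\<Sum>i\<in>E. k (Z i \<omega>))" for \<omega>
          unfolding U_def E_def by (rule sum.UNION_disjoint[symmetric]) (use Ifin blkfin in \<open>auto simp: block_at_def\<close>)
        then have 1: "?A \<in> generated_events M Z E"
          using generated_events_sum[OF k A, where M=M and E=E and Z=Z] by simp
        have 2: "?B \<in> generated_events M Z (block_at n q v)"
          using generated_events_sum[OF k, where A="{s..}" and M=M and E="block_at n q v" and Z=Z] by (simp add: U_def)
        have "\<bar>prob (?A \<inter> ?B)
         - prob ?A * prob ?B\<bar>
           \<le> \<phi> (card E) (card (block_at n q v)) * chi (setdist (real_index ` E) (real_index ` block_at n q v))"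
          using mix_ineq[OF Efin blkfin _ _ 1 2] EB blk Bpos by blast
        also have "\<dots> \<le> \<alpha>"
          unfolding \<alpha>_def
        proof (rule mult_mono)
          have "card E \<le> index_volume n"
            using card_mono[OF Bfin EB] by (simp add: B_def card_index_box)
          then show "\<phi> (card E) (card (block_at n q v)) \<le> \<phi> (index_volume n) (q ^ CARD('N))"
            using card_block_at[OF q] by (rule phi_mono)
          have "real q \<le> setdist (real_index ` E) (real_index ` block_at n q v)"
          proof (rule le_setdistI)
            fix x y assume "x \<in> real_index ` E" "y \<in> real_index ` block_at n q v"
            then obtain i j u where ij: "x = real_index i" "y = real_index j" "i \<in> block_at n q u" "u \<in> I" "j \<in> block_at n q v"
              by (auto simp: E_def)
            then have bi: "block_index q i = u" "block_index q j = v" by (auto simp: block_at_def)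
            have "par u = par v" using I ij v by (auto simp: J_def)
            then have "odd (u $ k) \<longleftrightarrow> odd (v $ k)" for k by (auto simp: par_def set_eq_iff)
            moreover have "i \<in> pos_indices" "j \<in> pos_indices" using ij blk Bpos by blast+
            moreover have "u \<noteq> v" using ij I by auto
            ultimately show "real q \<le> dist x y" unfolding ij(1,2) using bi by (intro blocks_separated[OF q]) auto
          qed (use Ene ne[OF v] in auto)
          moreover have "antimono_on {0..} chi" using mixing by (auto simp: mixing_field_def)
          ultimately show "chi (setdist (real_index ` E) (real_index ` block_at n q v)) \<le> chi q"
            by (intro monotone_onD[of "{0..}" "(\<le>)" "(\<ge>)" chi]) (auto intro: order_trans)
        qed (auto intro: phi0 chi0 setdist_pos_le)
        finally show ?thesis .
      qed
    next
      fix v assume "v \<in> J p"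
      show "b v \<le> c * real q ^ CARD('N)"
        unfolding b_def using card_block_at[OF q, of n v] c
        by (intro mult_left_mono) (auto simp: of_nat_power[symmetric] simp del: of_nat_power)
    next
      show "(\<Sum>v\<in>J p. expectation (U v)) \<le> G"
        unfolding Ue using part[of "\<lambda>i. expectation (\<lambda>\<omega>. k (Z i \<omega>))" p] G kbd
        by (auto simp: B_def integral_nonneg intro: order_trans)
    qed (use Jfin Ubd \<alpha> c q G e in auto)
    also have "4 * \<alpha> / e * (\<Sum>v\<in>J p. b v) \<le> 4 * \<alpha> / e * (c * real (index_volume n))"
    proof (rule mult_left_mono)
      have "(\<Sum>v\<in>J p. b v) = (\<Sum>v\<in>J p. \<Sum>i\<in>block_at n q v. c)" by (simp add: b_def mult.commute)
      also have "\<dots> \<le> (\<Sum>i\<in>B. c)" by (rule part) (use c in simp)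
      finally show "(\<Sum>v\<in>J p. b v) \<le> c * real (index_volume n)" by (simp add: B_def card_index_box mult.commute)
    qed (use \<alpha> e in simp)
    finally show ?thesis by simp
  qed
  define T where "T p = {\<omega>\<in>space M. 2 * e \<le> \<bar>(\<Sum>v\<in>J p. U v \<omega>) - (\<Sum>v\<in>J p. expectation (U v))\<bar>}" for p
  have [measurable]: "T p \<in> events" for p unfolding T_def by measurable
  have "prob {\<omega>\<in>space M. 2 ^ CARD('N) * (2 * e) \<le>
            \<bar>(\<Sum>i\<in>index_box n. k (Z i \<omega>)) - (\<Sum>i\<in>index_box n. expectation (\<lambda>\<omega>. k (Z i \<omega>)))\<bar>} \<le> prob (\<Union>p\<in>UNIV. T p)"
  proof (rule finite_measure_mono)
    show "{\<omega>\<in>space M. 2 ^ CARD('N) * (2 * e) \<le>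
            \<bar>(\<Sum>i\<in>index_box n. k (Z i \<omega>)) - (\<Sum>i\<in>index_box n. expectation (\<lambda>\<omega>. k (Z i \<omega>)))\<bar>} \<subseteq> (\<Union>p\<in>UNIV. T p)"
    proof (rule subsetI, rule ccontr)
      fix \<omega> assume 1: "\<omega> \<in> {\<omega>\<in>space M. 2 ^ CARD('N) * (2 * e) \<le>
            \<bar>(\<Sum>i\<in>index_box n. k (Z i \<omega>)) - (\<Sum>i\<in>index_box n. expectation (\<lambda>\<omega>. k (Z i \<omega>)))\<bar>}"
        and 2: "\<omega> \<notin> (\<Union>p\<in>UNIV. T p)"
      have "(\<Sum>i\<in>index_box n. k (Z i \<omega>)) - (\<Sum>i\<in>index_box n. expectation (\<lambda>\<omega>. k (Z i \<omega>)))
          = (\<Sum>p\<in>UNIV. (\<Sum>v\<in>J p. U v \<omega>) - (\<Sum>v\<in>J p. expectation (U v)))"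
        unfolding sum_subtractf Ue unfolding U_def by (simp add: split B_def)
      also have "\<bar>\<dots>\<bar> \<le> (\<Sum>p\<in>UNIV. \<bar>(\<Sum>v\<in>J p. U v \<omega>) - (\<Sum>v\<in>J p. expectation (U v))\<bar>)" by (rule sum_abs)
      also have "\<dots> < (\<Sum>p\<in>(UNIV :: 'N set set). 2 * e)"
        by (rule sum_strict_mono) (use 1 2 in \<open>auto simp: T_def not_le\<close>)
      also have "\<dots> = 2 ^ CARD('N) * (2 * e)"
        by (simp add: card_UNIV_set)
      finally show False using 1 by simp
    qed
  qed simp
  also have "\<dots> \<le> (\<Sum>p\<in>UNIV. prob (T p))"
    by (rule finite_measure_subadditive_finite) auto
  also have "\<dots> \<le> (\<Sum>p\<in>(UNIV :: 'N set set). 2 * exp (- (min 1 (e / (2 * G)) * e / 2) / (c * real q ^ CARD('N))) + 4 * \<alpha> / e * (c * real (index_volume n)))"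
    unfolding T_def by (rule sum_mono) (rule class_tail)
  also have "\<dots> = 2 ^ CARD('N) * (2 * exp (- (min 1 (e / (2 * G)) * e / 2) / (c * real q ^ CARD('N))) + 4 * \<alpha> / e * (c * real (index_volume n)))"
    by (simp add: card_UNIV_set)
  finally show ?thesis unfolding \<alpha>_def .
qed

section \<open>Summation over multi-indices and the first Borel--Cantelli lemma\<close>

lemma eventually_index_at_top:
  "eventually P (index_at_top :: (nat ^ 'N) filter) \<longleftrightarrow> (\<exists>m. \<forall>n. (\<forall>k. m \<le> n $ k) \<longrightarrow> P n)"
proof -
  have "m \<le> Min (range (\<lambda>k. n $ k)) \<longleftrightarrow> (\<forall>k. m \<le> n $ k)" for m and n :: "nat ^ 'N"
    by (subst Min_ge_iff) auto
  then show ?thesis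
    unfolding index_at_top_def eventually_filtercomap_at_top_linorder by simp
qed

lemma eventually_index_ge: "eventually (\<lambda>n. \<forall>k. m \<le> n $ k) (index_at_top :: (nat ^ 'N) filter)"
  by (auto simp: eventually_index_at_top)

lemma eventually_index_ge_real: "eventually (\<lambda>n. \<forall>k. c \<le> real (n $ k)) (index_at_top :: (nat ^ 'N) filter)"
  using eventually_index_ge[of "nat \<lceil>c\<rceil>"]
proof eventually_elim
  case (elim n)
  show ?case
  proof
    fix k
    have "c \<le> real (nat \<lceil>c\<rceil>)" by linarith
    also have "\<dots> \<le> real (n $ k)" using elim by simp
    finally show "c \<le> real (n $ k)" .
  qed
qed

lemma eventually_index_pos: "eventually (\<lambda>n. n \<in> pos_indices) index_at_top"
  using eventually_index_ge[of 1] by eventually_elim (simp add: pos_indices_def)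

lemma eventually_index_not_in_finite:
  assumes "finite A" shows "eventually (\<lambda>n. n \<notin> A) (index_at_top :: (nat ^ 'N) filter)"
proof -
  define m where "m = Suc (\<Sum>n\<in>A. \<Sum>k\<in>UNIV. n $ k)"
  show ?thesis
    using eventually_index_ge[of m]
  proof eventually_elim
    case (elim n)
    show ?case
    proof
      assume n: "n \<in> A"
      have "n $ undefined \<le> (\<Sum>k\<in>UNIV. n $ k)" by (rule member_le_sum) auto
      also have "\<dots> \<le> (\<Sum>n\<in>A. \<Sum>k\<in>UNIV. n $ k)" by (rule member_le_sum) (use n assms in auto)
      finally show False using elim unfolding m_def by (metis not_less_eq_eq)
    qed
  qed
qed

lemma summable_on_index_product:
  fixes a :: "nat \<Rightarrow> real"
  assumes a: "\<And>m. 0 \<le> a m" "summable a"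
  shows "(\<lambda>n :: nat ^ 'N. \<Prod>k\<in>UNIV. a (n $ k)) summable_on UNIV"
proof (rule nonneg_bdd_above_summable_on)
  show "0 \<le> (\<Prod>k\<in>UNIV. a (n $ k))" for n :: "nat ^ 'N" using a by (simp add: prod_nonneg)
  show "bdd_above (sum (\<lambda>n :: nat ^ 'N. \<Prod>k\<in>UNIV. a (n $ k)) ` {F. F \<subseteq> UNIV \<and> finite F})"
  proof (rule bdd_aboveI2)
    fix F :: "(nat ^ 'N) set" assume "F \<in> {F. F \<subseteq> UNIV \<and> finite F}"
    then have F: "finite F" by simp
    define m where "m = Suc (\<Sum>n\<in>F. \<Sum>k\<in>UNIV. n $ k)"
    have fin: "finite {n :: nat ^ 'N. \<forall>k. n $ k \<in> {..<m}}" by (rule finite_vec_box) simp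
    have sub: "F \<subseteq> {n. \<forall>k. n $ k \<in> {..<m}}"
    proof (rule subsetI, rule CollectI, rule allI)
      fix n k assume n: "n \<in> F"
      have "n $ k \<le> (\<Sum>k\<in>UNIV. n $ k)" by (rule member_le_sum) auto
      also have "\<dots> \<le> (\<Sum>n\<in>F. \<Sum>k\<in>UNIV. n $ k)" by (rule member_le_sum) (use n F in auto)
      finally show "n $ k \<in> {..<m}" by (simp add: m_def)
    qed
    have "(\<Sum>n\<in>F. \<Prod>k\<in>UNIV. a (n $ k)) \<le> (\<Sum>n\<in>{n :: nat ^ 'N. \<forall>k. n $ k \<in> {..<m}}. \<Prod>k\<in>UNIV. a (n $ k))"
      by (rule sum_mono2[OF fin sub]) (use a in \<open>auto intro: prod_nonneg\<close>)
    also have "\<dots> = (\<Sum>f\<in>PiE UNIV (\<lambda>_. {..<m}). \<Prod>k\<in>(UNIV :: 'N set). a (f k))"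
      by (rule sum.reindex_bij_betw[OF bij_betw_vec_nth])
    also have "\<dots> = (\<Prod>k\<in>(UNIV :: 'N set). \<Sum>j<m. a j)"
      by (rule prod_sum_PiE[symmetric]) auto
    also have "\<dots> \<le> (\<Prod>k\<in>(UNIV :: 'N set). suminf a)"
      by (rule prod_mono) (use a in \<open>auto intro: sum_nonneg sum_le_suminf\<close>)
    finally show "(\<Sum>n\<in>F. \<Prod>k\<in>UNIV. a (n $ k)) \<le> suminf a ^ CARD('N)" by simp
  qed
qed

text \<open>
  The summand is the derivative of \<open>- (ln (ln x))\<^bsup>- \<epsilon>\<^esup> / \<epsilon>\<close> and decreases, so the partial sums are bounded by a
  telescoping sum.  The cut-off \<open>exp (exp 1)\<close> is where the iterated logarithm reaches 1.
\<close>

lemma summable_bertrand: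
  fixes \<epsilon> :: real
  assumes "0 < \<epsilon>"
  shows "summable (\<lambda>m::nat. if exp (exp 1) \<le> real m
           then 1 / (real m * (ln (real m) * ln (ln (real m)) powr (1 + \<epsilon>))) else 0)"
proof -
  define b where "b x = 1 / (x * (ln x * ln (ln x) powr (1 + \<epsilon>)))" for x :: real
  define \<Phi> where "\<Phi> x = - (ln (ln x) powr (- \<epsilon>)) / \<epsilon>" for x :: real
  define c where "c = exp (exp (1::real))"
  have big: "1 < x" "exp 1 \<le> ln x" "1 \<le> ln (ln x)" if "c \<le> x" for x
  proof -
    have c1: "1 < c" unfolding c_def by simp
    then show "1 < x" using that by simp
    have "ln c \<le> ln x" using that c1 by (subst ln_le_cancel_iff) auto
    then show "exp 1 \<le> ln x" by (simp add: c_def)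
    then have "ln (exp 1) \<le> ln (ln x)" by (subst ln_le_cancel_iff) (auto intro: less_le_trans[OF exp_gt_zero])
    then show "1 \<le> ln (ln x)" by simp
  qed
  have der: "(\<Phi> has_real_derivative b x) (at x)" if "c \<le> x" for x
  proof -
    have l: "0 < x" "0 < ln x" "0 < ln (ln x)" using big[OF that] exp_gt_zero[of "1::real"] by linarith+
    have "ln (ln x) powr (1 + \<epsilon>) = ln (ln x) powr (\<epsilon> + 1)" by (simp add: add.commute)
    also have "\<dots> = inverse (ln (ln x) powr (- \<epsilon> - 1))" by (subst powr_minus[symmetric]) (simp add: add.commute)
    finally have eq: "b x = ln (ln x) powr (- \<epsilon> - 1) / ln x / x" by (simp add: b_def field_simps)
    have "((\<lambda>x. ln (ln x) powr (- \<epsilon>)) has_real_derivative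
        (- \<epsilon>) * ln (ln x) powr (- \<epsilon> - 1) * (1 / ln x * (1 / x))) (at x)"
      by (rule derivative_eq_intros refl l | simp add: l)+
    from DERIV_cdivide[OF DERIV_minus[OF this], of \<epsilon>] show ?thesis
      unfolding \<Phi>_def eq using assms by simp
  qed
  have mono: "b y \<le> b x" if "c \<le> x" "x \<le> y" for x y
  proof -
    have x: "1 < x" "exp 1 \<le> ln x" "1 \<le> ln (ln x)" using big that by auto
    have l0: "0 < ln x" using x by (smt (verit) exp_gt_zero)
    have l: "ln x \<le> ln y" using x that by simp
    have lx: "1 \<le> ln x" using x exp_ge_add_one_self[of "1::real"] by linarith
    then have "ln (ln x) \<le> ln (ln y)" using l0 l by (subst ln_le_cancel_iff) auto
    then have "ln (ln x) powr (1 + \<epsilon>) \<le> ln (ln y) powr (1 + \<epsilon>)" using x lx assms by (intro powr_mono2) auto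
    then have "x * (ln x * ln (ln x) powr (1 + \<epsilon>)) \<le> y * (ln y * ln (ln y) powr (1 + \<epsilon>))"
      using x l l0 that lx by (intro mult_mono) auto
    moreover have "0 < x * (ln x * ln (ln x) powr (1 + \<epsilon>))"
    proof (intro mult_pos_pos)
      have "ln (ln x) \<noteq> 0" using x(3) by linarith
      then show "0 < ln (ln x) powr (1 + \<epsilon>)" by (rule powr_gt_zero[THEN iffD2])
    qed (use x l0 in auto)
    ultimately show ?thesis unfolding b_def by (intro frac_le) auto
  qed
  define m0 where "m0 = nat \<lceil>c\<rceil>"
  have m0: "c \<le> real m" if "m0 \<le> m" for m using that unfolding m0_def by linarith
  have step: "b (real (Suc m)) \<le> \<Phi> (real (Suc m)) - \<Phi> (real m)" if "m0 \<le> m" for m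
  proof -
    have m: "c \<le> real m" using m0[OF that] .
    obtain z where z: "real m < z" "z < real (Suc m)" "\<Phi> (real (Suc m)) - \<Phi> (real m) = (real (Suc m) - real m) * b z"
      using MVT2[of "real m" "real (Suc m)" \<Phi> b] der m by (metis lessI of_nat_less_iff order_trans)
    moreover have "b (real (Suc m)) \<le> b z" using z m by (intro mono) auto
    ultimately show ?thesis by simp
  qed
  have "summable (\<lambda>m. b (real (m + Suc m0)))"
  proof (rule summableI_nonneg_bounded)
    fix m
    show "0 \<le> b (real (m + Suc m0))"
      using big[OF m0[of "m + Suc m0"]] unfolding b_def by (intro divide_nonneg_nonneg mult_nonneg_nonneg) (auto simp: ln_ge_zero)
    have "(\<Sum>j<m. b (real (j + Suc m0))) \<le> (\<Sum>j<m. \<Phi> (real (Suc (j + m0))) - \<Phi> (real (j + m0)))"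
    proof (rule sum_mono)
      fix j
      show "b (real (j + Suc m0)) \<le> \<Phi> (real (Suc (j + m0))) - \<Phi> (real (j + m0))"
        using step[of "j + m0"] by simp
    qed
    also have "\<dots> = \<Phi> (real (m + m0)) - \<Phi> (real m0)"
      using sum_lessThan_telescope[of "\<lambda>j. \<Phi> (real (j + m0))" m] by simp
    also have "\<dots> \<le> - \<Phi> (real m0)" using assms by (simp add: \<Phi>_def)
    finally show "(\<Sum>j<m. b (real (j + Suc m0))) \<le> - \<Phi> (real m0)" .
  qed
  moreover have "(\<lambda>m. if c \<le> real (m + Suc m0) then b (real (m + Suc m0)) else 0) = (\<lambda>m. b (real (m + Suc m0)))"
    using m0[of "m + Suc m0" for m] by (intro ext) simp
  ultimately have "summable (\<lambda>m. if c \<le> real (m + Suc m0) then b (real (m + Suc m0)) else 0)" by simp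
  then show ?thesis
    unfolding b_def c_def by (subst (asm) summable_iff_shift)
qed

text \<open>
  Convergence along the filter concerns all multi-indices with large coordinates, in no particular
  order, so the probabilities have to be summed over the whole grid.  Afterwards only finitely many bad indices
  remain, and these are left behind by the filter.
\<close>

lemma (in prob_space) borel_cantelli_index:
  fixes A :: "nat ^ 'N \<Rightarrow> 'a set"
  assumes A: "\<And>n. A n \<in> events" and s: "s summable_on UNIV" "\<And>n. 0 \<le> s n"
    and le: "eventually (\<lambda>n. prob (A n) \<le> s n) index_at_top"
  shows "AE \<omega> in M. eventually (\<lambda>n. \<omega> \<notin> A n) index_at_top"
proof -
  define B where "B j = (if j \<in> range (to_nat :: nat ^ 'N \<Rightarrow> nat) \<and> prob (A (from_nat j)) \<le> s (from_nat j)
      then A (from_nat j) else {})" for j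
  define t where "t j = (if j \<in> range (to_nat :: nat ^ 'N \<Rightarrow> nat) then s (from_nat j) else 0)" for j
  have Bm[measurable]: "B j \<in> events" for j using A by (simp add: B_def)
  have "(s \<circ> from_nat) summable_on range (to_nat :: nat ^ 'N \<Rightarrow> nat)"
    by (subst summable_on_reindex) (use s in \<open>auto simp: o_def\<close>)
  then have "t summable_on UNIV"
    by (subst summable_on_cong_neutral[where T="range (to_nat :: nat ^ 'N \<Rightarrow> nat)" and g="s \<circ> from_nat"]) (auto simp: t_def)
  then have "summable t" by (rule summable_on_imp_summable)
  then have "summable (\<lambda>j. prob (B j))"
    by (rule summable_comparison_test'[where N=0]) (use s in \<open>auto simp: B_def t_def\<close>)
  then have "AE \<omega> in M. eventually (\<lambda>j. \<omega> \<in> space M - B j) sequentially"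
    by (intro borel_cantelli_AE1) (auto simp: emeasure_eq_measure)
  then show ?thesis
  proof eventually_elim
    case (elim \<omega>)
    then obtain j0 where j0: "\<And>j. j0 \<le> j \<Longrightarrow> \<omega> \<notin> B j" by (auto simp: eventually_sequentially)
    define C where "C = {n. \<omega> \<in> A n \<and> prob (A n) \<le> s n}"
    have "to_nat ` C \<subseteq> {..<j0}"
    proof
      fix j assume "j \<in> to_nat ` C"
      then obtain n where "n \<in> C" "j = to_nat n" by blast
      then have "\<omega> \<in> B j" by (auto simp: C_def B_def)
      then show "j \<in> {..<j0}" using j0 by (meson lessThan_iff not_le)
    qed
    then have "finite (to_nat ` C)" using finite_subset by blast
    then have "finite C" by (rule finite_imageD) auto
    from eventually_index_not_in_finite[OF this] le show ?case
      by eventually_elim (auto simp: C_def)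
  qed
qed

section \<open>What the bandwidth condition provides\<close>

lemma index_volume_ge:
  fixes n :: "nat ^ 'N"
  assumes "n \<in> pos_indices" shows "n $ k \<le> index_volume n"
proof -
  have "(\<Prod>j\<in>UNIV - {k}. n $ j) \<ge> 1"
    using assms by (auto simp: pos_indices_def Suc_le_eq intro!: prod_pos)
  moreover have "index_volume n = n $ k * (\<Prod>j\<in>UNIV - {k}. n $ j)"
    unfolding index_volume_def by (subst prod.remove[of UNIV k]) auto
  ultimately show ?thesis by simp
qed

lemma u_fun_ge_1:
  assumes "0 < \<epsilon>" "\<And>k. exp (exp 1) \<le> real (n $ k)" shows "1 \<le> u_fun \<epsilon> n"
  unfolding u_fun_def
proof (rule prod_ge_1)
  fix k
  have "ln (exp (exp (1::real))) \<le> ln (real (n $ k))"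
    using assms(2)[of k] less_le_trans[OF exp_gt_zero assms(2)[of k]] by (subst ln_le_cancel_iff) auto
  then have 1: "exp 1 \<le> ln (real (n $ k))" by simp
  then have "ln (exp 1) \<le> ln (ln (real (n $ k)))"
    by (subst ln_le_cancel_iff) (auto intro: less_le_trans[OF exp_gt_zero])
  then have 2: "1 \<le> ln (ln (real (n $ k)))" by simp
  have "1 \<le> exp (1::real)" by simp
  then have 3: "1 \<le> ln (real (n $ k))" using 1 by linarith
  from 2 assms(1) have "1 \<le> ln (ln (real (n $ k))) powr (1 + \<epsilon>)" by (simp add: ge_one_powr_ge_zero)
  with 3 show "1 \<le> ln (real (n $ k)) * ln (ln (real (n $ k))) powr (1 + \<epsilon>)"
    by (metis mult_mono' mult_1 zero_le_one)
qed

text \<open>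
  Here \<open>r n\<close> is the order of the admissible block size \<open>q\<^sup>N\<close>, and \<open>r n powr (- \<beta> / N)\<close> is then the order of the
  mixing coefficient at distance \<open>q\<close>.  The factor \<open>1 / h\<^bsup>d (d + 2)\<^esup>\<close> collects the size \<open>h\<^bsup>- d (d + 1)\<^esup>\<close>
  of the net and the total range \<open>h\<^bsup>- d\<^esup>\<close> of the summands.

  In logarithmic coordinates every quantity is linear.  With \<open>v = ln V\<close>, \<open>H = - ln h\<close>, \<open>l = ln (ln V)\<close>,
  \<open>U = ln u\<close>, \<open>B = \<beta> / N\<close> and \<open>t = v - (d + 1) H - l\<close>, the bandwidth condition becomes an upper bound for \<open>2 U\<close>.
  Rewritten in \<open>t\<close>, \<open>H\<close> and \<open>l\<close> it has a positive coefficient at \<open>t\<close> only, which forces \<open>t\<close> to grow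
  at least like \<open>l\<close>; and the claimed estimate follows from the same inequality by dropping terms of known sign.
\<close>

lemma bandwidth_rate:
  fixes h :: "nat ^ 'N \<Rightarrow> real" and d :: nat and \<phi> :: "nat \<Rightarrow> nat \<Rightarrow> real"
  defines "r \<equiv> \<lambda>n. real (index_volume n) * h n ^ d / ln (real (index_volume n))"
  assumes hpos: "\<forall>n\<in>pos_indices. 0 < h n" and h0: "(h \<longlongrightarrow> 0) index_at_top" and eps: "0 < \<epsilon>"
    and phi0: "\<And>a b. 0 \<le> \<phi> a b"
    and ix: "mixing_bandwidth_a h (real d) \<epsilon> \<beta> \<phi> \<or> mixing_bandwidth_b h (real d) \<epsilon> \<beta> \<phi>"
  shows "filterlim r at_top index_at_top"
    and "eventually (\<lambda>n. ln (real (index_volume n)) \<le> real (index_volume n) * h n ^ (d + 1)) index_at_top"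
    and "0 < c' \<Longrightarrow> \<exists>C>0. eventually (\<lambda>n. \<forall>m::nat. real m \<le> c' * r n \<longrightarrow>
            \<phi> (index_volume n) m * r n powr (- \<beta> / CARD('N)) * (1 / h n ^ (d * (d + 2)))
              \<le> C / (real (index_volume n) * u_fun \<epsilon> n)) index_at_top"
proof -
  define N where "N = real CARD('N)"
  have N: "0 < N" by (simp add: N_def)
  define B where "B = \<beta> / N"
  define v where "v n = ln (real (index_volume n))" for n :: "nat ^ 'N"
  define H where "H n = - ln (h n)" for n
  define l where "l n = ln (v n)" for n :: "nat ^ 'N"
  define U where "U n = ln (u_fun \<epsilon> n)" for n :: "nat ^ 'N"
  define t where "t n = v n - (real d + 1) * H n - l n" for n
  define good where "good n \<longleftrightarrow> n \<in> pos_indices \<and> 1 \<le> v n \<and> 0 < h n \<and> h n \<le> 1 \<and> 1 \<le> u_fun \<epsilon> n" for n :: "nat ^ 'N"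
  have vinf: "filterlim v at_top index_at_top"
    unfolding filterlim_at_top
  proof
    fix c :: real
    show "eventually (\<lambda>n. c \<le> v n) (index_at_top :: (nat ^ 'N) filter)"
      using eventually_index_ge_real[of "exp c"] eventually_index_pos
    proof eventually_elim
      case (elim n)
      then have "exp c \<le> real (n $ undefined)" by blast
      also have "\<dots> \<le> real (index_volume n)" using index_volume_ge[OF elim(2)] by simp
      finally have V: "exp c \<le> real (index_volume n)" .
      then have "ln (exp c) \<le> v n"
        unfolding v_def using less_le_trans[OF exp_gt_zero V] by (subst ln_le_cancel_iff) auto
      then show ?case by simp
    qed
  qed
  then have linf: "filterlim l at_top index_at_top"
    unfolding l_def by (rule filterlim_compose[OF ln_at_top])
  have ev1: "eventually (\<lambda>n. 1 \<le> v n) index_at_top" using vinf by (simp add: filterlim_at_top)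
  have ev2: "eventually (\<lambda>n. h n < 1) index_at_top" by (rule order_tendstoD(2)[OF h0]) simp
  have good: "eventually good index_at_top"
    using ev1 ev2 eventually_index_pos eventually_index_ge_real[of "exp (exp 1)"]
  proof eventually_elim
    case (elim n)
    then show ?case using hpos u_fun_ge_1[OF eps, of n] by (auto simp: good_def)
  qed
  have V: "real (index_volume n) = exp (v n)" and hH: "h n = exp (- H n)" and vl: "v n = exp (l n)"
    and uU: "u_fun \<epsilon> n = exp (U n)" and nn: "0 \<le> H n" "0 \<le> l n" "0 \<le> U n" "0 \<le> v n" if "good n" for n
  proof -
    have "real (index_volume n) > 0"
    proof (rule ccontr)
      assume "\<not> 0 < real (index_volume n)"
      then have "v n = 0" by (simp add: v_def)
      then show False using that by (simp add: good_def)
    qed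
    then show "real (index_volume n) = exp (v n)" by (simp add: v_def)
    show "h n = exp (- H n)" "v n = exp (l n)" "u_fun \<epsilon> n = exp (U n)"
      using that by (auto simp: H_def l_def U_def good_def)
    show "0 \<le> H n" "0 \<le> l n" "0 \<le> U n" "0 \<le> v n"
      using that by (auto simp: H_def l_def U_def good_def)
  qed
  have r_eq: "r n = exp (t n + H n)" if "good n" for n
    unfolding r_def v_def[symmetric] V[OF that] hH[OF that]
    using vl[OF that] by (simp add: exp_of_nat_mult[symmetric] t_def exp_add[symmetric] exp_diff[symmetric] algebra_simps)
  have log_ge: "0 \<le> v n - \<theta> * H n + \<theta>' * l n - \<delta> * U n"
    if "good n" and 1: "1 \<le> real (index_volume n) * h n powr \<theta> * ln (real (index_volume n)) powr \<theta>' * u_fun \<epsilon> n powr (- \<delta>)"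
    for n \<theta> \<theta>' \<delta>
  proof -
    note 1
    also have "real (index_volume n) * h n powr \<theta> * ln (real (index_volume n)) powr \<theta>' * u_fun \<epsilon> n powr (- \<delta>)
       = exp (v n - \<theta> * H n + \<theta>' * l n - \<delta> * U n)"
      unfolding v_def[symmetric] uU[OF that(1)] hH[OF that(1)] V[OF that(1)]
      by (subst vl[OF that(1)]) (simp add: exp_powr_real exp_add[symmetric] exp_diff[symmetric] algebra_simps)
    finally show ?thesis by simp
  qed
  let ?cost = "\<lambda>n m. \<phi> (index_volume n) m * exp (- B * (t n + H n)) * exp (real d * (real d + 2) * H n)"
  have key: "\<exists>D>0. eventually (\<lambda>n. 3 * l n \<le> D * t n) index_at_top \<and>
     (\<forall>c>0. \<exists>C>0. eventually (\<lambda>n. \<forall>m::nat. real m \<le> c * r n \<longrightarrow>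
        ?cost n m \<le> C * exp (- v n - U n)) index_at_top)"
    using ix
  proof
    let ?rate = "\<lambda>n. real (index_volume n) * h n powr theta1 N d \<beta>
                     * ln (real (index_volume n)) powr theta2 N d \<beta>
                     * u_fun \<epsilon> n powr (- 2 * N / (\<beta> - N * (d + 5)))"
    assume "mixing_bandwidth_a h (real d) \<epsilon> \<beta> \<phi>"
    then obtain C where gam: "N * (d + 5) < \<beta>" and C: "0 < C" "\<And>n m. \<phi> n m \<le> C * real (min n m)"
      and lim: "filterlim ?rate at_top index_at_top"
      by (auto simp: mixing_bandwidth_a_def Let_def N_def)
    let ?bound = "\<lambda>n. 2 * U n \<le> (B - d - 5) * v n - ((d + 1) * (d + 2) + (d + 1) * B) * H n + (d + 2 - B) * l n"
    have Bg: "d + 5 < B" using gam N by (simp add: B_def field_simps)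
    have "eventually (\<lambda>n. 1 \<le> ?rate n) index_at_top"
      using lim by (simp add: filterlim_at_top)
    then have main: "eventually (\<lambda>n. good n \<and> ?bound n) index_at_top"
      using good
    proof eventually_elim
      case (elim n)
      define \<gamma> where "\<gamma> = \<beta> - N * (d + 5)"
      have \<gamma>: "0 < \<gamma>" using gam by (simp add: \<gamma>_def)
      have "0 \<le> v n - theta1 N d \<beta> * H n + theta2 N d \<beta> * l n - (2 * N / \<gamma>) * U n"
        by (rule log_ge[OF elim(2)]) (use elim(1) in \<open>simp add: \<gamma>_def\<close>)
      then have "0 \<le> (\<gamma> / N) * (v n - theta1 N d \<beta> * H n + theta2 N d \<beta> * l n - (2 * N / \<gamma>) * U n)"
        using \<gamma> N by simp
      also have "\<dots> = (\<gamma> / N) * v n - (\<gamma> * theta1 N d \<beta> / N) * H n + (\<gamma> * theta2 N d \<beta> / N) * l n - 2 * U n"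
        using \<gamma> N by (simp add: field_simps)
      also have "\<gamma> * theta1 N d \<beta> = N * (d + 1) * (d + 2) + (d + 1) * \<beta>"
        using \<gamma> by (simp add: theta1_def \<gamma>_def add_ac)
      also have "(N * (d + 1) * (d + 2) + (d + 1) * \<beta>) / N = (d + 1) * (d + 2) + (d + 1) * B"
        using N by (simp add: B_def field_simps)
      also have "\<gamma> * theta2 N d \<beta> = N * (d + 2) - \<beta>"
        using \<gamma> by (simp add: theta2_def \<gamma>_def add_ac)
      also have "(N * (d + 2) - \<beta>) / N = d + 2 - B"
        using N by (simp add: B_def field_simps)
      also have "\<gamma> / N = B - d - 5"
        using N by (simp add: B_def \<gamma>_def field_simps)
      finally show ?case using elim(2) by simp
    qed
    have scale: "3 * l n \<le> (B - d - 5) * t n"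
      if "good n" "?bound n" for n
    proof -
      have "0 \<le> (d + 1) * (2 * d + 7) * H n" using nn[of n] that by simp
      moreover have "0 \<le> U n" using nn[of n] that by simp
      ultimately show ?thesis using that by (simp add: t_def algebra_simps)
    qed
    show ?thesis
    proof (rule exI[of _ "B - d - 5"], intro conjI allI impI)
      show "0 < B - d - 5" using Bg by simp
      show "eventually (\<lambda>n. 3 * l n \<le> (B - d - 5) * t n) index_at_top"
        using main by eventually_elim (use scale in blast)
    next
      fix c :: real assume c: "0 < c"
      show "\<exists>C>0. eventually (\<lambda>n. \<forall>m::nat. real m \<le> c * r n \<longrightarrow>
        ?cost n m \<le> C * exp (- v n - U n)) index_at_top"
      proof (intro exI[of _ "C * c"] conjI)
        show "0 < C * c" using C c by simp
        show "eventually (\<lambda>n. \<forall>m::nat. real m \<le> c * r n \<longrightarrow>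
          ?cost n m \<le> C * c * exp (- v n - U n)) index_at_top"
          using main
        proof (eventually_elim, intro allI impI)
          fix n m assume n: "good n \<and> ?bound n"
            and m: "real m \<le> c * r n"
          note nn = nn[of n]
          have tpos: "0 \<le> t n"
          proof -
            have "0 \<le> (B - d - 5) * t n" using scale[of n] n nn by simp
            then show ?thesis using Bg by (simp add: zero_le_mult_iff)
          qed
          have "\<phi> (index_volume n) m \<le> C * real m"
            using C(2)[of "index_volume n" m] C(1) by (smt (verit) min.cobounded2 mult_left_mono of_nat_mono)
          also have "\<dots> \<le> C * (c * r n)" using m C(1) by (intro mult_left_mono) auto
          finally have "?cost n m
             \<le> C * (c * r n) * exp (- B * (t n + H n)) * exp (real d * (real d + 2) * H n)"
            by (intro mult_right_mono) auto
          also have "\<dots> = C * c * exp ((t n + H n) - B * (t n + H n) + real d * (real d + 2) * H n)"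
            using n by (simp add: r_eq exp_add exp_diff exp_minus field_simps)
          also have "\<dots> \<le> C * c * exp (- v n - U n)"
          proof -
            \<comment> \<open>The factors are twice the slack of the claim in the coefficients of \<open>t\<close> and \<open>H\<close>.\<close>
            have "0 \<le> (B + d + 1) * t n" using Bg tpos by simp
            moreover have "0 \<le> (2 * B + (d + 1) * (2 * d + 5) - 2 * (real d * (d + 2)) - 2) * H n"
            proof (rule mult_nonneg_nonneg)
              have "0 \<le> real d" by simp
              then show "0 \<le> 2 * B + (d + 1) * (2 * d + 5) - 2 * (real d * (d + 2)) - 2"
                using Bg by (simp add: algebra_simps)
            qed (use nn n in simp)
            ultimately have "(t n + H n) - B * (t n + H n) + real d * (real d + 2) * H n \<le> - v n - U n"
              using n nn by (simp add: t_def algebra_simps)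
            then show ?thesis using C c by simp
          qed
          finally show "?cost n m \<le> C * c * exp (- v n - U n)" .
        qed
      qed
    qed
  next
    let ?rate = "\<lambda>(\<kappa>::real) n. real (index_volume n) * h n powr theta3 N d \<beta> \<kappa>
                     * ln (real (index_volume n)) powr theta4 N d \<beta> \<kappa>
                     * u_fun \<epsilon> n powr (- 2 * N / (\<beta> - N * (d + 4 + 2 * \<kappa>)))"
    assume "mixing_bandwidth_b h (real d) \<epsilon> \<beta> \<phi>"
    then obtain \<kappa> C :: real where \<kappa>: "1 \<le> \<kappa>" and gam: "N * (d + 4 + 2 * \<kappa>) < \<beta>"
      and C: "0 < C" "\<And>n m. \<phi> n m \<le> C * (real n + real m + 1) powr \<kappa>"
      and lim: "filterlim (?rate \<kappa>) at_top index_at_top"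
      by (auto simp: mixing_bandwidth_b_def Let_def N_def)
    let ?bound = "\<lambda>n. 2 * U n \<le> (B - d - 4 - 2 * \<kappa>) * v n - ((d\<^sup>2 + 4 * d + 2) + (d + 1) * B) * H n + (d + 1 - B) * l n"
    have Bg: "d + 4 + 2 * \<kappa> < B" using gam N by (simp add: B_def field_simps)
    have "eventually (\<lambda>n. 1 \<le> ?rate \<kappa> n) index_at_top"
      using lim by (simp add: filterlim_at_top)
    then have main: "eventually (\<lambda>n. good n \<and> ?bound n) index_at_top"
      using good
    proof eventually_elim
      case (elim n)
      define \<gamma> where "\<gamma> = \<beta> - N * (d + 4 + 2 * \<kappa>)"
      have \<gamma>: "0 < \<gamma>" using gam by (simp add: \<gamma>_def)
      have "0 \<le> v n - theta3 N d \<beta> \<kappa> * H n + theta4 N d \<beta> \<kappa> * l n - (2 * N / \<gamma>) * U n"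
        by (rule log_ge[OF elim(2)]) (use elim(1) in \<open>simp add: \<gamma>_def\<close>)
      then have "0 \<le> (\<gamma> / N) * (v n - theta3 N d \<beta> \<kappa> * H n + theta4 N d \<beta> \<kappa> * l n - (2 * N / \<gamma>) * U n)"
        using \<gamma> N by simp
      also have "\<dots> = (\<gamma> / N) * v n - (\<gamma> * theta3 N d \<beta> \<kappa> / N) * H n + (\<gamma> * theta4 N d \<beta> \<kappa> / N) * l n - 2 * U n"
        using \<gamma> N by (simp add: field_simps)
      also have "\<gamma> * theta3 N d \<beta> \<kappa> = N * (d\<^sup>2 + 4 * d + 2) + (d + 1) * \<beta>"
        using \<gamma> by (simp add: theta3_def \<gamma>_def add_ac)
      also have "(N * (d\<^sup>2 + 4 * d + 2) + (d + 1) * \<beta>) / N = (d\<^sup>2 + 4 * d + 2) + (d + 1) * B"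
        using N by (simp add: B_def field_simps)
      also have "\<gamma> * theta4 N d \<beta> \<kappa> = N * (d + 1) - \<beta>"
        using \<gamma> by (simp add: theta4_def \<gamma>_def add_ac)
      also have "(N * (d + 1) - \<beta>) / N = d + 1 - B"
        using N by (simp add: B_def field_simps)
      also have "\<gamma> / N = B - d - 4 - 2 * \<kappa>"
        using N by (simp add: B_def \<gamma>_def field_simps)
      finally show ?case using elim(2) by simp
    qed
    have scale: "3 * l n \<le> (B - d - 4 - 2 * \<kappa>) * t n"
      if "good n" "?bound n" for n
    proof -
      have "0 \<le> ((d + 1) * (d + 4 + 2 * \<kappa>) + d\<^sup>2 + 4 * d + 2) * H n" using nn[of n] that \<kappa> by simp
      moreover have "0 \<le> U n" "0 \<le> \<kappa> * l n" using nn[of n] that \<kappa> by simp_all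
      ultimately show ?thesis using that by (simp add: t_def algebra_simps)
    qed
    show ?thesis
    proof (rule exI[of _ "B - d - 4 - 2 * \<kappa>"], intro conjI allI impI)
      show "0 < B - d - 4 - 2 * \<kappa>" using Bg by simp
      show "eventually (\<lambda>n. 3 * l n \<le> (B - d - 4 - 2 * \<kappa>) * t n) index_at_top"
        using main by eventually_elim (use scale in blast)
    next
      fix c :: real assume c: "0 < c"
      show "\<exists>C>0. eventually (\<lambda>n. \<forall>m::nat. real m \<le> c * r n \<longrightarrow>
        ?cost n m \<le> C * exp (- v n - U n)) index_at_top"
      proof (intro exI[of _ "C * (c + 2) powr \<kappa>"] conjI)
        show "0 < C * (c + 2) powr \<kappa>" using C c by simp
        show "eventually (\<lambda>n. \<forall>m::nat. real m \<le> c * r n \<longrightarrow>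
          ?cost n m \<le> C * (c + 2) powr \<kappa> * exp (- v n - U n)) index_at_top"
          using main
        proof (eventually_elim, intro allI impI)
          fix n m assume n: "good n \<and> ?bound n"
            and m: "real m \<le> c * r n"
          note nn = nn[of n]
          have tpos: "0 \<le> t n"
          proof -
            have "0 \<le> (B - d - 4 - 2 * \<kappa>) * t n" using scale[of n] n nn by simp
            then show ?thesis using Bg by (simp add: zero_le_mult_iff)
          qed
          have "t n + H n \<le> v n"
          proof -
            have "0 \<le> real d * H n" using nn n by simp
            then show ?thesis using nn n by (simp add: t_def algebra_simps)
          qed
          then have "c * r n \<le> c * exp (v n)" using c n by (simp add: r_eq)
          moreover have "1 \<le> exp (v n)" using nn n by simp
          ultimately have "real (index_volume n) + real m + 1 \<le> (c + 2) * exp (v n)"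
            using m V[of n] n unfolding distrib_right by linarith
          then have "(real (index_volume n) + real m + 1) powr \<kappa> \<le> ((c + 2) * exp (v n)) powr \<kappa>"
            using \<kappa> by (intro powr_mono2) auto
          also have "\<dots> = (c + 2) powr \<kappa> * exp (\<kappa> * v n)"
            using c by (simp add: powr_mult exp_powr_real mult.commute)
          finally have "C * (real (index_volume n) + real m + 1) powr \<kappa> \<le> C * ((c + 2) powr \<kappa> * exp (\<kappa> * v n))"
            using C(1) by (intro mult_left_mono) auto
          then have "\<phi> (index_volume n) m \<le> C * ((c + 2) powr \<kappa> * exp (\<kappa> * v n))"
            using C(2) order_trans by blast
          then have "?cost n m
             \<le> C * ((c + 2) powr \<kappa> * exp (\<kappa> * v n)) * exp (- B * (t n + H n)) * exp (real d * (real d + 2) * H n)"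
            by (intro mult_right_mono) auto
          also have "\<dots> = C * (c + 2) powr \<kappa> * exp (\<kappa> * v n - B * (t n + H n) + real d * (real d + 2) * H n)"
            by (simp add: exp_add exp_diff exp_minus field_simps)
          also have "\<dots> \<le> C * (c + 2) powr \<kappa> * exp (- v n - U n)"
          proof -
            \<comment> \<open>The factors are again twice the slack in the coefficients of \<open>t\<close> and \<open>H\<close>.\<close>
            have "0 \<le> (B + d + 2) * t n" using Bg tpos \<kappa> by simp
            moreover have "0 \<le> (2 * B + (2 * d\<^sup>2 + 7 * d + 4) - 2 * (real d * (d + 2))) * H n"
            proof (rule mult_nonneg_nonneg)
              have "0 \<le> real d" by simp
              then show "0 \<le> 2 * B + (2 * d\<^sup>2 + 7 * d + 4) - 2 * (real d * (d + 2))"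
                using Bg \<kappa> by (simp add: algebra_simps power2_eq_square)
            qed (use nn n in simp)
            ultimately have "\<kappa> * v n - B * (t n + H n) + real d * (real d + 2) * H n \<le> - v n - U n"
              using n nn by (simp add: t_def algebra_simps power2_eq_square)
            then show ?thesis using C c by simp
          qed
          finally show "?cost n m \<le> C * (c + 2) powr \<kappa> * exp (- v n - U n)" .
        qed
      qed
    qed
  qed
  then obtain D where D: "0 < D" and Dl: "eventually (\<lambda>n. 3 * l n \<le> D * t n) index_at_top" and
    fin: "\<And>c. 0 < c \<Longrightarrow> \<exists>C>0. eventually (\<lambda>n. \<forall>m::nat. real m \<le> c * r n \<longrightarrow>
        ?cost n m \<le> C * exp (- v n - U n)) index_at_top"
    by blast
  show "filterlim r at_top index_at_top"
  proof (rule filterlim_at_top_mono)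
    show "filterlim (\<lambda>n. 3 / D * l n) at_top index_at_top"
      using D linf by (intro filterlim_tendsto_pos_mult_at_top[OF tendsto_const]) auto
    show "eventually (\<lambda>n. 3 / D * l n \<le> r n) index_at_top"
      using good Dl
    proof eventually_elim
      case (elim n)
      have "3 / D * l n \<le> t n" using elim(2) D by (simp add: field_simps)
      also have "\<dots> \<le> t n + H n" using nn[OF elim(1)] by simp
      also have "\<dots> \<le> exp (t n + H n)" using exp_ge_add_one_self[of "t n + H n"] by linarith
      finally show ?case by (simp add: r_eq[OF elim(1)])
    qed
  qed
  show "eventually (\<lambda>n. ln (real (index_volume n)) \<le> real (index_volume n) * h n ^ (d + 1)) index_at_top"
    using good Dl
  proof eventually_elim
    case (elim n)
    have "0 \<le> D * t n" using elim(2) nn[OF elim(1)] by linarith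
    then have "0 \<le> t n" using D by (simp add: zero_le_mult_iff)
    then have "exp (l n) \<le> exp (v n - (real d + 1) * H n)" by (simp add: t_def)
    also have "\<dots> = real (index_volume n) * h n ^ (d + 1)"
      unfolding V[OF elim(1)] hH[OF elim(1)] exp_of_nat_mult[symmetric] exp_add[symmetric] by (simp add: algebra_simps)
    finally show ?case using vl[OF elim(1)] by (simp add: v_def)
  qed
  assume "0 < c'"
  from fin[OF this] obtain C where C: "0 < C" and ev: "eventually (\<lambda>n. \<forall>m::nat. real m \<le> c' * r n \<longrightarrow>
      ?cost n m \<le> C * exp (- v n - U n)) index_at_top"
    by blast
  show "\<exists>C>0. eventually (\<lambda>n. \<forall>m::nat. real m \<le> c' * r n \<longrightarrow>
          \<phi> (index_volume n) m * r n powr (- \<beta> / CARD('N)) * (1 / h n ^ (d * (d + 2)))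
            \<le> C / (real (index_volume n) * u_fun \<epsilon> n)) index_at_top"
  proof (intro exI[of _ C] conjI C)
    show "eventually (\<lambda>n. \<forall>m::nat. real m \<le> c' * r n \<longrightarrow>
          \<phi> (index_volume n) m * r n powr (- \<beta> / CARD('N)) * (1 / h n ^ (d * (d + 2)))
            \<le> C / (real (index_volume n) * u_fun \<epsilon> n)) index_at_top"
      using ev good
    proof eventually_elim
      case (elim n)
      have 1: "r n powr (- \<beta> / CARD('N)) = exp (- B * (t n + H n))"
        using elim(2) by (simp add: r_eq exp_powr_real B_def N_def mult.commute)
      have 2: "1 / h n ^ (d * (d + 2)) = exp (real d * (real d + 2) * H n)"
        unfolding hH[OF elim(2)] exp_of_nat_mult[symmetric] divide_inverse exp_minus[symmetric] by (simp add: algebra_simps)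
      have 3: "C / (real (index_volume n) * u_fun \<epsilon> n) = C * exp (- v n - U n)"
        using elim(2) by (simp add: V uU exp_diff exp_minus field_simps)
      show ?case unfolding 1 2 3 by (rule elim(1))
    qed
  qed
qed

section \<open>Nets, region densities and the bias\<close>

text \<open>
  One point of \<open>S\<close> is chosen from each cube of side \<open>\<rho> / d\<close> that meets \<open>S\<close>.
\<close>

lemma covering_number_bound:
  fixes S :: "(real ^ 'd) set"
  assumes "bounded S"
  shows "\<exists>C>0. \<forall>\<rho>. 0 < \<rho> \<longrightarrow> \<rho> \<le> 1 \<longrightarrow>
    (\<exists>P\<subseteq>S. finite P \<and> real (card P) \<le> C / \<rho> ^ CARD('d) \<and> (\<forall>x\<in>S. \<exists>y\<in>P. dist x y \<le> \<rho>))"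
proof -
  obtain R where R: "\<And>x. x \<in> S \<Longrightarrow> norm x \<le> R" "0 < R"
    using assms by (auto simp: bounded_pos)
  define d where "d = real CARD('d)"
  have d: "1 \<le> d" unfolding d_def by (simp add: Suc_le_eq)
  define C0 where "C0 = (2 * R + 2) * d"
  have C0: "0 < C0" using R d by (simp add: C0_def)
  show ?thesis
  proof (rule exI[of _ "C0 ^ CARD('d)"], intro conjI allI impI)
    show "0 < C0 ^ CARD('d)" using C0 by simp
    fix \<rho> :: real assume \<rho>: "0 < \<rho>" "\<rho> \<le> 1"
    define s where "s = \<rho> / d"
    have s: "0 < s" "s \<le> 1" using \<rho> d by (auto simp: s_def field_simps)
    define cell where "cell x = (\<chi> k. \<lfloor>x $ k / s\<rfloor>)" for x :: "real ^ 'd"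
    define I where "I = {\<lfloor>- R / s\<rfloor>..\<lfloor>R / s\<rfloor>}"
    have fin: "finite {z :: int ^ 'd. \<forall>k. z $ k \<in> I}" by (rule finite_vec_box) (simp add: I_def)
    have card: "card {z :: int ^ 'd. \<forall>k. z $ k \<in> I} = card I ^ CARD('d)" unfolding card_vec_box by simp
    have cardI: "real (card I) \<le> C0 / \<rho>"
    proof -
      have "\<lfloor>- R / s\<rfloor> \<le> \<lfloor>R / s\<rfloor>" using R s by (intro floor_mono divide_right_mono) auto
      then have "0 \<le> \<lfloor>R / s\<rfloor> - \<lfloor>- R / s\<rfloor> + 1" by linarith
      then have "real (card I) = real_of_int (\<lfloor>R / s\<rfloor> - \<lfloor>- R / s\<rfloor> + 1)" by (simp add: I_def)
      also have "\<dots> \<le> 2 * (R / s) + 2" by linarith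
      also have "\<dots> \<le> (2 * R + 2) / s" using s by (simp add: field_simps)
      also have "\<dots> = C0 / \<rho>" using d by (simp add: s_def C0_def)
      finally show ?thesis .
    qed
    have cell_in: "cell ` S \<subseteq> {z. \<forall>k. z $ k \<in> I}"
    proof (rule image_subsetI, rule CollectI, rule allI)
      fix x k assume "x \<in> S"
      then have "\<bar>x $ k\<bar> \<le> R" using R(1) component_le_norm_cart order_trans by blast
      then have "- R \<le> x $ k" "x $ k \<le> R" by linarith+
      then have "- R / s \<le> x $ k / s" "x $ k / s \<le> R / s" using s by (intro divide_right_mono; simp)+
      then show "cell x $ k \<in> I" unfolding I_def cell_def by (auto intro: floor_mono)
    qed
    have cfin: "finite (cell ` S)" using finite_subset[OF cell_in fin] .
    define rep where "rep z = (SOME x. x \<in> S \<and> cell x = z)" for z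
    have rep: "rep (cell x) \<in> S" "cell (rep (cell x)) = cell x" if "x \<in> S" for x
      unfolding rep_def using someI[of "\<lambda>y. y \<in> S \<and> cell y = cell x" x] that by auto
    show "\<exists>P\<subseteq>S. finite P \<and> real (card P) \<le> C0 ^ CARD('d) / \<rho> ^ CARD('d) \<and> (\<forall>x\<in>S. \<exists>y\<in>P. dist x y \<le> \<rho>)"
    proof (intro exI[of _ "rep ` cell ` S"] conjI ballI)
      show "rep ` cell ` S \<subseteq> S" using rep by auto
      show "finite (rep ` cell ` S)" using cfin by simp
      have "card (rep ` cell ` S) \<le> card (cell ` S)" using cfin by (rule card_image_le)
      also have "\<dots> \<le> card I ^ CARD('d)" using card_mono[OF fin cell_in] card by simp
      finally have "real (card (rep ` cell ` S)) \<le> real (card I) ^ CARD('d)"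
        by (simp add: of_nat_power[symmetric] del: of_nat_power)
      also have "\<dots> \<le> (C0 / \<rho>) ^ CARD('d)" using cardI by (intro power_mono) auto
      finally show "real (card (rep ` cell ` S)) \<le> C0 ^ CARD('d) / \<rho> ^ CARD('d)" by (simp add: power_divide)
      fix x assume x: "x \<in> S"
      define y where "y = rep (cell x)"
      have "\<bar>(x - y) $ k\<bar> \<le> s" for k
      proof -
        have "\<lfloor>y $ k / s\<rfloor> = \<lfloor>x $ k / s\<rfloor>"
          using arg_cong[OF rep(2)[OF x], of "\<lambda>z. z $ k"] by (simp add: cell_def y_def)
        then have "\<bar>x $ k / s - y $ k / s\<bar> \<le> 1" by linarith
        then show ?thesis using s by (simp add: diff_divide_distrib[symmetric] abs_divide)
      qed
      then have "(\<Sum>k\<in>UNIV. \<bar>(x - y) $ k\<bar>) \<le> (\<Sum>k\<in>(UNIV :: 'd set). s)" by (intro sum_mono) auto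
      then have "norm (x - y) \<le> d * s" using norm_le_l1_cart[of "x - y"] by (simp add: d_def)
      also have "\<dots> = \<rho>" using d by (simp add: s_def)
      finally show "\<exists>y\<in>rep ` cell ` S. dist x y \<le> \<rho>" using x by (auto simp: y_def dist_norm)
    qed
  qed
qed

text \<open>
  The second point \<open>s\<close> may leave \<open>S\<close>: the kernel averages over a neighbourhood of \<open>x\<close>, not over \<open>S\<close>.
\<close>

lemma uniform_continuity_near_compact:
  fixes \<psi> :: "'a::metric_space \<Rightarrow> real"
  assumes "compact S" "open U" "S \<subseteq> U" "continuous_on U \<psi>" "0 < \<eta>"
  shows "\<exists>\<delta>>0. \<forall>x\<in>S. \<forall>s. dist x s < \<delta> \<longrightarrow> \<bar>\<psi> s - \<psi> x\<bar> < \<eta>"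
proof -
  define W where "W x = U \<inter> \<psi> -` ball (\<psi> x) (\<eta> / 2)" for x
  have W: "open (W x)" for x
    using continuous_open_preimage[OF assms(4,2) open_ball] by (simp add: W_def)
  have SW: "S \<subseteq> \<Union> (W ` S)" using assms by (auto simp: W_def)
  then obtain \<delta> where \<delta>: "0 < \<delta>" "\<And>x. x \<in> S \<Longrightarrow> \<exists>G\<in>W ` S. ball x \<delta> \<subseteq> G"
    by (rule Heine_Borel_lemma[OF assms(1), of "W ` S"]) (use W in auto)
  show ?thesis
  proof (intro exI[of _ \<delta>] conjI ballI allI impI \<delta>(1))
    fix x s assume x: "x \<in> S" and s: "dist x s < \<delta>"
    then obtain y where y: "ball x \<delta> \<subseteq> W y" using \<delta>(2) by blast
    then have "x \<in> W y" "s \<in> W y" using s \<delta>(1) by auto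
    then have "\<bar>\<psi> y - \<psi> x\<bar> < \<eta> / 2" "\<bar>\<psi> y - \<psi> s\<bar> < \<eta> / 2"
      by (auto simp: W_def dist_real_def)
    then show "\<bar>\<psi> s - \<psi> x\<bar> < \<eta>" by linarith
  qed
qed

definition region_density :: "((real ^ 'd) \<times> real \<Rightarrow> real) \<Rightarrow> real set \<Rightarrow> real ^ 'd \<Rightarrow> real" where
  "region_density f A x = (LINT y:A|lborel. f (x, y))"

lemma continuous_slice_measurable:
  assumes "continuous_on UNIV (f :: 'a::topological_space \<times> real \<Rightarrow> real)"
  shows "(\<lambda>y. f (x, y)) \<in> borel_measurable borel"
  by (intro borel_measurable_continuous_onI continuous_on_compose2[OF assms] continuous_intros) auto

lemma integrable_slice:
  assumes "0 < marginal_density f x" shows "integrable lborel (\<lambda>y. f (x, y))"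
  using assms not_integrable_integral_eq unfolding marginal_density_def by fastforce

text \<open>
  Pointwise convergence of the nonnegative slices \<open>f(x\<^sub>n, \<cdot>)\<close> together with convergence of their
  integrals, the marginal densities, gives convergence in \<open>L\<^sup>1\<close> by Scheffe's lemma.  Positivity of the marginal
  density ensures that a slice is integrable, since the integral of a non-integrable function is 0 by convention.
\<close>

lemma continuous_on_region_density:
  fixes f :: "(real ^ 'd) \<times> real \<Rightarrow> real"
  assumes f: "continuous_on UNIV f" "\<And>z. 0 \<le> f z" and g: "continuous_on UNIV (marginal_density f)"
    and A: "A \<in> sets borel"
  shows "continuous_on {x. 0 < marginal_density f x} (region_density f A)"
  unfolding continuous_on_sequentially
proof (intro allI ballI impI)
  fix x :: "nat \<Rightarrow> real ^ 'd" and a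
  assume a: "a \<in> {x. 0 < marginal_density f x}" and "(\<forall>n. x n \<in> {x. 0 < marginal_density f x}) \<and> x \<longlonglongrightarrow> a"
  then have x: "\<And>n. 0 < marginal_density f (x n)" and lim: "x \<longlonglongrightarrow> a" and a0: "0 < marginal_density f a" by auto
  note int = integrable_slice[OF x] integrable_slice[OF a0]
  have gl: "(\<lambda>n. marginal_density f (x n)) \<longlonglongrightarrow> marginal_density f a"
    by (rule continuous_on_tendsto_compose[OF g lim]) auto
  have nng: "(\<integral>\<^sup>+ y. norm (f (u, y)) \<partial>lborel) = ennreal (marginal_density f u)" if "0 < marginal_density f u" for u
    using nn_integral_eq_integral[OF integrable_slice[OF that]] f(2) by (simp add: marginal_density_def)
  have L1: "(\<lambda>n. \<integral>\<^sup>+ y. norm (f (x n, y) - f (a, y)) \<partial>lborel) \<longlonglongrightarrow> 0"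
  proof (rule Scheffe_lemma1)
    show "AE y in lborel. (\<lambda>n. f (x n, y)) \<longlonglongrightarrow> f (a, y)"
      by (rule AE_I2, rule continuous_on_tendsto_compose[OF f(1)]) (auto intro!: tendsto_intros lim)
    have "(\<lambda>n. ennreal (marginal_density f (x n))) \<longlonglongrightarrow> ennreal (marginal_density f a)"
      using gl by (rule tendsto_ennrealI)
    then show "limsup (\<lambda>n. \<integral>\<^sup>+ y. norm (f (x n, y)) \<partial>lborel) \<le> (\<integral>\<^sup>+ y. norm (f (a, y)) \<partial>lborel)"
      unfolding nng[OF x] nng[OF a0] by (simp add: lim_imp_Limsup)
  qed (use int in auto)
  have bd: "ennreal \<bar>region_density f A (x n) - region_density f A a\<bar> \<le> (\<integral>\<^sup>+ y. norm (f (x n, y) - f (a, y)) \<partial>lborel)" for n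
  proof -
    have i: "integrable lborel (\<lambda>y. indicator A y *\<^sub>R f (x n, y))" "integrable lborel (\<lambda>y. indicator A y *\<^sub>R f (a, y))"
      by (intro integrable_mult_indicator int; use A in simp)+
    have id: "integrable lborel (\<lambda>y. norm (f (x n, y) - f (a, y)))" using int by auto
    have "region_density f A (x n) - region_density f A a = (LINT y|lborel. indicator A y *\<^sub>R f (x n, y) - indicator A y *\<^sub>R f (a, y))"
      unfolding region_density_def set_lebesgue_integral_def using i by simp
    also have "\<bar>\<dots>\<bar> \<le> (LINT y|lborel. \<bar>indicator A y *\<^sub>R f (x n, y) - indicator A y *\<^sub>R f (a, y)\<bar>)"
      by (rule integral_abs_bound)
    also have "\<dots> \<le> (LINT y|lborel. norm (f (x n, y) - f (a, y)))"
      by (rule integral_mono) (use i id in \<open>auto simp: indicator_def\<close>)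
    finally have "ennreal \<bar>region_density f A (x n) - region_density f A a\<bar> \<le> ennreal (LINT y|lborel. norm (f (x n, y) - f (a, y)))"
      by (rule ennreal_leI)
    also have "\<dots> = (\<integral>\<^sup>+ y. norm (f (x n, y) - f (a, y)) \<partial>lborel)"
      by (rule nn_integral_eq_integral[symmetric, OF id]) auto
    finally show ?thesis .
  qed
  have "(\<lambda>n. ennreal \<bar>region_density f A (x n) - region_density f A a\<bar>) \<longlonglongrightarrow> 0"
    by (rule tendsto_sandwich[OF _ _ tendsto_const L1]) (use bd in \<open>auto intro: always_eventually\<close>)
  then have "(\<lambda>n. \<bar>region_density f A (x n) - region_density f A a\<bar>) \<longlonglongrightarrow> 0"
    by (subst (asm) ennreal_tendsto_0_iff) auto
  then show "(region_density f A \<circ> x) \<longlonglongrightarrow> region_density f A a"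
    unfolding o_def by (subst LIM_zero_iff[symmetric], subst tendsto_rabs_zero_iff[symmetric]) simp
qed

lemma rescaled_kernel_integral:
  fixes K :: "'a::euclidean_space \<Rightarrow> real"
  assumes K: "prob_density K" "K \<in> borel_measurable borel" and h: "0 < h"
  shows "has_bochner_integral lborel (\<lambda>s. K ((x - s) /\<^sub>R h)) (h ^ DIM('a))"
proof -
  have KI: "integrable lborel K" "(LINT s|lborel. K s) = 1" using K by (auto simp: prob_density_def)
  have eq: "K ((x - (x + (- h) *\<^sub>R s)) /\<^sub>R h) = K s" for s using h by simp
  have [measurable]: "K \<in> borel_measurable borel" by fact
  have m: "(\<lambda>s. K ((x - s) /\<^sub>R h)) \<in> borel_measurable borel" by measurable
  have lb: "(lborel :: 'a measure) = density (distr lborel borel (\<lambda>s. x + (- h) *\<^sub>R s)) (\<lambda>_. \<bar>- h\<bar> ^ DIM('a))"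
    using lborel_affine[of "-h" x] h by simp
  have i: "integrable (distr lborel borel (\<lambda>s. x + (- h) *\<^sub>R s)) (\<lambda>s. K ((x - s) /\<^sub>R h))"
    by (subst integrable_distr_eq) (use KI h in \<open>auto intro!: m\<close>)
  have "integrable lborel (\<lambda>s. K ((x - s) /\<^sub>R h))"
    by (subst lb, subst integrable_density) (use i h in \<open>auto intro!: m integrable_mult_right simp: ennreal_power[symmetric]\<close>)
  moreover have "(LINT s|lborel. K ((x - s) /\<^sub>R h)) = h ^ DIM('a)"
  proof -
    have "(LINT s|lborel. K ((x - s) /\<^sub>R h)) = (LINT s|distr lborel borel (\<lambda>s. x + (- h) *\<^sub>R s). h ^ DIM('a) * K ((x - s) /\<^sub>R h))"
      by (subst lb, subst integral_density) (use h in \<open>auto intro!: m\<close>)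
    also have "\<dots> = h ^ DIM('a) * (LINT s|lborel. K s)"
      by (subst integral_distr) (use eq in \<open>auto intro!: m\<close>)
    finally show ?thesis using KI by simp
  qed
  ultimately show ?thesis by (simp add: has_bochner_integral_iff)
qed

text \<open>
  By Fubini the expectation is a weighted mean of the region density over the ball of radius
  \<open>h R\<close> around \<open>x\<close>, hence within its oscillation there.
\<close>

lemma kernel_region_bias:
  fixes f :: "(real ^ 'd) \<times> real \<Rightarrow> real" and K :: "real ^ 'd \<Rightarrow> real"
  assumes f: "integrable lborel f" and Km: "K \<in> borel_measurable borel"
    and K: "prob_density K" "\<And>s. K s \<le> \<kappa>" "\<And>s. R < norm s \<Longrightarrow> K s = 0"
    and A: "A \<in> sets borel" and h: "0 < h"
    and osc: "\<And>s. dist x s \<le> h * R \<Longrightarrow> \<bar>region_density f A s - region_density f A x\<bar> \<le> \<eta>"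
  shows "\<bar>(LINT z|lborel. f z * (K ((x - fst z) /\<^sub>R h) * indicator A (snd z))) / h ^ CARD('d) - region_density f A x\<bar> \<le> \<eta>"
proof -
  note [measurable] = Km A
  have K0: "0 \<le> K s" for s using K by (simp add: prob_density_def)
  have fm: "f \<in> borel_measurable borel" using f by auto
  have [measurable]: "f \<in> borel_measurable (borel \<Otimes>\<^sub>M borel)" unfolding borel_prod by (rule fm)
  define k where "k s = K ((x - s) /\<^sub>R h)" for s
  have [measurable]: "k \<in> borel_measurable borel" unfolding k_def by measurable
  have ki: "integrable lborel k" "(LINT s|lborel. k s) = h ^ CARD('d)"
    using rescaled_kernel_integral[OF K(1) Km h, of x] by (auto simp: has_bochner_integral_iff k_def[abs_def])
  have kz: "0 \<le> k s" "k s \<le> \<kappa>" for s using K0 K by (auto simp: k_def)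
  have int: "integrable (lborel \<Otimes>\<^sub>M lborel) (\<lambda>z. f z * (k (fst z) * indicator A (snd z)))"
  proof (rule Bochner_Integration.integrable_bound[of _ "\<lambda>z. \<kappa> * f z"])
    show "integrable (lborel \<Otimes>\<^sub>M lborel) (\<lambda>z. \<kappa> * f z)" using f by (simp add: lborel_prod)
    show "AE z in lborel \<Otimes>\<^sub>M lborel. norm (f z * (k (fst z) * indicator A (snd z))) \<le> norm (\<kappa> * f z)"
    proof (rule AE_I2)
      fix z
      have "\<bar>k (fst z) * indicator A (snd z)\<bar> \<le> \<kappa>"
        using kz[of "fst z"] by (auto simp: indicator_def)
      moreover have "\<kappa> = \<bar>\<kappa>\<bar>" using kz[of 0] by linarith
      ultimately show "norm (f z * (k (fst z) * indicator A (snd z))) \<le> norm (\<kappa> * f z)"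
        by (simp add: abs_mult mult.commute[of "\<bar>f z\<bar>"] mult_right_mono)
    qed
    show "(\<lambda>z. f z * (k (fst z) * indicator A (snd z))) \<in> borel_measurable (lborel \<Otimes>\<^sub>M lborel)"
      by measurable
  qed
  have inner: "(LINT y|lborel. f (s, y) * (k s * indicator A y)) = k s * region_density f A s" for s
  proof -
    have "(LINT y|lborel. f (s, y) * (k s * indicator A y)) = (LINT y|lborel. k s * (indicator A y *\<^sub>R f (s, y)))"
      by (intro Bochner_Integration.integral_cong) auto
    then show ?thesis by (simp add: region_density_def set_lebesgue_integral_def)
  qed
  have i2: "integrable lborel (\<lambda>s. k s * region_density f A s)"
    using lborel_pair.integrable_fst'[OF int] by (simp add: inner)
  have "(LINT z|lborel. f z * (k (fst z) * indicator A (snd z))) = (LINT s|lborel. k s * region_density f A s)"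
    using lborel_pair.integral_fst'[OF int] by (simp add: inner lborel_prod)
  then have "(LINT z|lborel. f z * (k (fst z) * indicator A (snd z))) - h ^ CARD('d) * region_density f A x
     = (LINT s|lborel. k s * region_density f A s) - (LINT s|lborel. k s * region_density f A x)"
    using ki by simp
  also have "\<dots> = (LINT s|lborel. k s * region_density f A s - k s * region_density f A x)"
    using i2 ki by simp
  also have "\<bar>\<dots>\<bar> \<le> (LINT s|lborel. \<bar>k s * region_density f A s - k s * region_density f A x\<bar>)"
    by (rule integral_abs_bound)
  also have "\<dots> \<le> (LINT s|lborel. k s * \<eta>)"
  proof (rule integral_mono)
    fix s
    show "\<bar>k s * region_density f A s - k s * region_density f A x\<bar> \<le> k s * \<eta>"
    proof (cases "R < norm ((x - s) /\<^sub>R h)")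
      case True
      then have "k s = 0" using K(3) by (simp add: k_def)
      then show ?thesis by simp
    next
      case False
      have nh: "norm ((x - s) /\<^sub>R h) = norm (x - s) / h"
        using h by (subst norm_scaleR) (simp add: divide_inverse)
      have "norm (x - s) / h \<le> R" using False unfolding nh by linarith
      then have "dist x s \<le> h * R" using h by (simp add: dist_norm pos_divide_le_eq mult.commute)
      from osc[OF this] kz(1)[of s] show ?thesis
        by (simp add: right_diff_distrib[symmetric] abs_mult mult_left_mono)
    qed
  qed (use i2 ki in auto)
  also have "\<dots> = h ^ CARD('d) * \<eta>" using ki by simp
  finally have "\<bar>(LINT z|lborel. f z * (k (fst z) * indicator A (snd z))) - h ^ CARD('d) * region_density f A x\<bar> / h ^ CARD('d) \<le> \<eta>"
    using h by (simp add: field_simps)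
  moreover have "(LINT z|lborel. f z * (k (fst z) * indicator A (snd z))) / h ^ CARD('d) - region_density f A x
     = ((LINT z|lborel. f z * (k (fst z) * indicator A (snd z))) - h ^ CARD('d) * region_density f A x) / h ^ CARD('d)"
    using h by (simp add: field_simps)
  ultimately show ?thesis using h unfolding k_def by (simp add: abs_divide)
qed

section \<open>Uniform strong consistency of kernel averages\<close>

text \<open>
  The kernel estimate of the part of the marginal density that comes from \<open>Y \<in> A\<close>.
  The denominator \<^const>\<open>g_est\<close> is the case \<open>A = UNIV\<close>, and the half-lines \<open>A = {..a}\<close> sandwich the numerator
  \<^const>\<open>psi_est\<close>.
\<close>

definition region_est ::
    "(real ^ 'd \<Rightarrow> real) \<Rightarrow> (nat ^ 'N \<Rightarrow> real) \<Rightarrow> (nat ^ 'N \<Rightarrow> 'w \<Rightarrow> real ^ 'd) \<Rightarrow> (nat ^ 'N \<Rightarrow> 'w \<Rightarrow> real) \<Rightarrow>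
     real set \<Rightarrow> nat ^ 'N \<Rightarrow> 'w \<Rightarrow> real ^ 'd \<Rightarrow> real" where
  "region_est K h X Y A n \<omega> x =
     1 / (real (index_volume n) * h n ^ CARD('d)) *
     (\<Sum>i\<in>index_box n. K ((x - X i \<omega>) /\<^sub>R h n) * indicator A (Y i \<omega>))"

lemma compact_support_zero_outside:
  fixes k :: "'a::euclidean_space \<Rightarrow> real"
  assumes "compact_support k" obtains R where "0 < R" "\<And>s. R < norm s \<Longrightarrow> k s = 0"
proof -
  have "bounded {s. k s \<noteq> 0}"
    using assms unfolding compact_support_def by (meson bounded_subset closure_subset compact_imp_bounded)
  then obtain R where "0 < R" "\<And>s. k s \<noteq> 0 \<Longrightarrow> norm s \<le> R" by (auto simp: bounded_pos)
  then show thesis by (intro that[of R]) (auto simp: not_le[symmetric])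
qed

lemma compact_support_bounded:
  fixes k :: "'a::euclidean_space \<Rightarrow> real"
  assumes "continuous_on UNIV k" "compact_support k"
  obtains \<kappa> where "0 < \<kappa>" "\<And>s. k s \<le> \<kappa>"
proof -
  have "compact (k ` closure {s. k s \<noteq> 0})"
    by (intro compact_continuous_image continuous_on_subset[OF assms(1)]) (use assms(2) in \<open>auto simp: compact_support_def\<close>)
  then have "bounded (k ` closure {s. k s \<noteq> 0})" by (rule compact_imp_bounded)
  then obtain \<kappa> where "0 < \<kappa>" "\<forall>y\<in>k ` closure {s. k s \<noteq> 0}. norm y \<le> \<kappa>" unfolding bounded_pos by blast
  then have \<kappa>: "0 < \<kappa>" "\<And>s. s \<in> closure {s. k s \<noteq> 0} \<Longrightarrow> norm (k s) \<le> \<kappa>" by blast+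
  show thesis
  proof (rule that[OF \<kappa>(1)])
    fix s
    show "k s \<le> \<kappa>"
    proof (cases "k s = 0")
      case False
      then have "s \<in> {s. k s \<noteq> 0}" by (rule CollectI)
      then have "s \<in> closure {s. k s \<noteq> 0}" by (rule subsetD[OF closure_subset])
      from \<kappa>(2)[OF this] show ?thesis unfolding real_norm_def by linarith
    next
      case True
      then show ?thesis using \<kappa>(1) by (simp only:)
    qed
  qed
qed

lemma polynomial_decay_bound:
  fixes chi :: "real \<Rightarrow> real"
  assumes "(\<lambda>i::nat. chi (real i)) \<in> O(\<lambda>i. real i powr (- \<beta>))"
  obtains C i0 where "0 < C" "\<And>i. i0 \<le> i \<Longrightarrow> chi (real i) \<le> C * real i powr (- \<beta>)"
proof -
  from assms obtain C where C: "0 < C" "eventually (\<lambda>i. norm (chi (real i)) \<le> C * norm (real i powr (- \<beta>))) sequentially"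
    by (auto elim!: landau_o.bigE)
  then obtain i0 where "\<And>i. i0 \<le> i \<Longrightarrow> norm (chi (real i)) \<le> C * norm (real i powr (- \<beta>))"
    by (auto simp: eventually_sequentially)
  then show thesis by (intro that[OF C(1), of i0]) (auto simp: abs_le_iff)
qed

locale mixing_kernel_field = prob_space M
  for M :: "'w measure"
    and X :: "nat ^ 'N \<Rightarrow> 'w \<Rightarrow> real ^ 'd" and Y :: "nat ^ 'N \<Rightarrow> 'w \<Rightarrow> real"
    and f :: "(real ^ 'd) \<times> real \<Rightarrow> real" and h :: "nat ^ 'N \<Rightarrow> real" and K :: "real ^ 'd \<Rightarrow> real"
    and \<phi> :: "nat \<Rightarrow> nat \<Rightarrow> real" and chi :: "real \<Rightarrow> real" and \<beta> \<epsilon> :: real and S :: "(real ^ 'd) set" +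
  assumes field_measurable: "\<And>i. i \<in> pos_indices \<Longrightarrow> random_variable borel (\<lambda>\<omega>. (X i \<omega>, Y i \<omega>))"
    and f_nonneg: "\<And>z. 0 \<le> f z"
    and density: "\<And>i. i \<in> pos_indices \<Longrightarrow> distributed M lborel (\<lambda>\<omega>. (X i \<omega>, Y i \<omega>)) (\<lambda>z. ennreal (f z))"
    and mixing: "mixing_field M (\<lambda>i \<omega>. (X i \<omega>, Y i \<omega>)) \<phi> chi"
    and beta: "0 < \<beta>" "(\<lambda>i::nat. chi (real i)) \<in> O(\<lambda>i. real i powr (- \<beta>))"
    and bandwidth: "\<forall>n\<in>pos_indices. 0 < h n" "(h \<longlongrightarrow> 0) index_at_top"
    and eps: "0 < \<epsilon>"
    and S: "compact S" "\<And>x. x \<in> S \<Longrightarrow> 0 < marginal_density f x"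
    and f_continuous: "continuous_on UNIV f" and g_continuous: "continuous_on UNIV (marginal_density f)"
    and K: "prob_density K" "\<exists>L. L-lipschitz_on UNIV K" "compact_support K"
    and rate: "mixing_bandwidth_a h (real CARD('d)) \<epsilon> \<beta> \<phi> \<or> mixing_bandwidth_b h (real CARD('d)) \<epsilon> \<beta> \<phi>"
begin

definition region_summand :: "nat ^ 'N \<Rightarrow> real set \<Rightarrow> real ^ 'd \<Rightarrow> (real ^ 'd) \<times> real \<Rightarrow> real" where
  "region_summand n A x z =
     1 / (real (index_volume n) * h n ^ CARD('d)) * (K ((x - fst z) /\<^sub>R h n) * indicator A (snd z))"

definition region_mean :: "nat ^ 'N \<Rightarrow> real set \<Rightarrow> real ^ 'd \<Rightarrow> real" where
  "region_mean n A x = (\<Sum>i\<in>index_box n. expectation (\<lambda>\<omega>. region_summand n A x (X i \<omega>, Y i \<omega>)))"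

lemma region_est_eq_sum: "region_est K h X Y A n \<omega> x = (\<Sum>i\<in>index_box n. region_summand n A x (X i \<omega>, Y i \<omega>))"
  by (simp add: region_est_def region_summand_def sum_distrib_left)

lemma K_continuous: "continuous_on UNIV K"
  using K(2) lipschitz_on_continuous_on by blast

lemma K_measurable [measurable]: "K \<in> borel_measurable borel"
  using K_continuous by (rule borel_measurable_continuous_onI)

lemma K_nonneg: "0 \<le> K s"
  using K(1) by (simp add: prob_density_def)

lemma f_integrable: "integrable lborel f"
proof -
  have "(\<chi> k. 1) \<in> (pos_indices :: (nat ^ 'N) set)" by (simp add: pos_indices_def)
  from distributed_integrable[OF density[OF this], of "\<lambda>_. 1"] show ?thesis
    using f_nonneg by simp
qed

lemma region_summand_measurable [measurable]:
  assumes "A \<in> sets borel" shows "region_summand n A x \<in> borel_measurable borel"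
proof -
  note [measurable] = assms
  have "region_summand n A x \<in> borel_measurable (borel \<Otimes>\<^sub>M borel)"
    unfolding region_summand_def[abs_def] by measurable
  then show ?thesis by (simp add: borel_prod)
qed

lemma region_density_continuous:
  "A \<in> sets borel \<Longrightarrow> continuous_on {x. 0 < marginal_density f x} (region_density f A)"
  by (rule continuous_on_region_density[OF f_continuous f_nonneg g_continuous])

lemma open_density_support: "open {x. 0 < marginal_density f x}"
  by (rule open_Collect_less[OF continuous_on_const g_continuous])

lemma region_density_uniform:
  assumes A: "A \<in> sets borel" and \<eta>: "0 < \<eta>"
  shows "\<exists>\<delta>>0. \<forall>x\<in>S. \<forall>s. dist x s < \<delta> \<longrightarrow> \<bar>region_density f A s - region_density f A x\<bar> < \<eta>"
proof -
  have "S \<subseteq> {x. 0 < marginal_density f x}" using S(2) by blast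
  from uniform_continuity_near_compact[OF S(1) open_density_support this region_density_continuous[OF A] \<eta>]
  show ?thesis .
qed

lemma volume_pos:
  fixes n :: "nat ^ 'N"
  assumes "n \<in> pos_indices" shows "0 < real (index_volume n)"
proof -
  have "1 \<le> n $ undefined" using assms unfolding pos_indices_def by blast
  then show ?thesis using index_volume_ge[OF assms, of undefined] by linarith
qed

lemma eventually_region_mean:
  assumes A: "A \<in> sets borel" and \<eta>: "0 < \<eta>"
  shows "eventually (\<lambda>n. \<forall>x\<in>S. \<bar>region_mean n A x - region_density f A x\<bar> \<le> \<eta>) index_at_top"
proof -
  obtain R where R: "0 < R" "\<And>s. R < norm s \<Longrightarrow> K s = 0" using compact_support_zero_outside[OF K(3)] by blast
  obtain \<kappa> where \<kappa>: "0 < \<kappa>" "\<And>s. K s \<le> \<kappa>" using compact_support_bounded[OF K_continuous K(3)] by blast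
  from region_density_uniform[OF A \<eta>]
  obtain \<delta> where \<delta>: "0 < \<delta>" "\<forall>x\<in>S. \<forall>s. dist x s < \<delta> \<longrightarrow> \<bar>region_density f A s - region_density f A x\<bar> < \<eta>"
    by (elim exE conjE)
  have "eventually (\<lambda>n. h n < \<delta> / R) index_at_top"
    by (rule order_tendstoD(2)[OF bandwidth(2)]) (use \<delta> R in simp)
  then show ?thesis
    using eventually_index_pos
  proof eventually_elim
    case (elim n)
    note n = elim(2)
    have hn: "0 < h n" "h n * R < \<delta>" using bandwidth(1) elim R by (auto simp: field_simps)
    note V = volume_pos[OF n]
    show ?case
    proof
      fix x assume x: "x \<in> S"
      define I where "I = (LINT z|lborel. f z * (K ((x - fst z) /\<^sub>R h n) * indicator A (snd z)))"
      have "expectation (\<lambda>\<omega>. region_summand n A x (X i \<omega>, Y i \<omega>)) = 1 / (real (index_volume n) * h n ^ CARD('d)) * I"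
        if "i \<in> index_box n" for i
      proof -
        have "expectation (\<lambda>\<omega>. region_summand n A x (X i \<omega>, Y i \<omega>)) = (LINT z|lborel. f z * region_summand n A x z)"
          by (rule distributed_integral[symmetric, OF density]) (use that index_box_pos A f_nonneg in auto)
        also have "\<dots> = (LINT z|lborel. 1 / (real (index_volume n) * h n ^ CARD('d)) * (f z * (K ((x - fst z) /\<^sub>R h n) * indicator A (snd z))))"
          by (intro Bochner_Integration.integral_cong refl) (simp add: region_summand_def)
        finally show ?thesis unfolding I_def by (simp only: integral_mult_right_zero)
      qed
      then have "region_mean n A x = real (index_volume n) * (1 / (real (index_volume n) * h n ^ CARD('d)) * I)"
        by (simp add: region_mean_def card_index_box)
      also have "\<dots> = I / h n ^ CARD('d)" using V by simp
      finally have eq: "region_mean n A x = I / h n ^ CARD('d)" .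
      have "\<bar>I / h n ^ CARD('d) - region_density f A x\<bar> \<le> \<eta>"
        unfolding I_def
      proof (rule kernel_region_bias[OF f_integrable K_measurable K(1) \<kappa>(2) R(2) A hn(1)])
        fix s assume "dist x s \<le> h n * R"
        then have "dist x s < \<delta>" using hn by simp
        from \<delta>(2)[rule_format, OF x this] show "\<bar>region_density f A s - region_density f A x\<bar> \<le> \<eta>" by simp
      qed
      then show "\<bar>region_mean n A x - region_density f A x\<bar> \<le> \<eta>" by (simp add: eq)
    qed
  qed
qed

text \<open>
  The division by \<open>h\<^bsup>d (d + 1)\<^esup>\<close> anticipates the union over a net of mesh proportional to \<open>h\<^bsup>d + 1\<^esup>\<close>.  The Chernoff
  term gives \<open>D1\<close>, the mixing term \<open>D2\<close>.
\<close>

lemma region_tail: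
  assumes A: "A \<in> sets borel" and \<eta>: "0 < \<eta>"
  obtains D1 D2 where "0 < D1" "0 < D2"
    "eventually (\<lambda>n. \<forall>x\<in>S. prob {\<omega>\<in>space M. \<eta> \<le> \<bar>region_est K h X Y A n \<omega> x - region_mean n A x\<bar>}
        / h n ^ (CARD('d) * (CARD('d) + 1)) \<le> D1 / real (index_volume n) ^ 2 + D2 / (real (index_volume n) * u_fun \<epsilon> n)) index_at_top"
proof -
  define d where "d = CARD('d)"
  define N where "N = CARD('N)"
  have N: "0 < N" by (simp add: N_def)
  obtain \<kappa> where \<kappa>: "0 < \<kappa>" "\<And>s. K s \<le> \<kappa>" using compact_support_bounded[OF K_continuous K(3)] by blast
  have "compact (region_density f A ` S)"
    by (intro compact_continuous_image continuous_on_subset[OF region_density_continuous[OF A]] S(1)) (use S(2) in auto)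
  then have "bounded (region_density f A ` S)" by (rule compact_imp_bounded)
  then obtain G0 where "0 < G0" "\<forall>y\<in>region_density f A ` S. norm y \<le> G0" unfolding bounded_pos by blast
  then have G0: "0 < G0" "\<And>x. x \<in> S \<Longrightarrow> \<bar>region_density f A x\<bar> \<le> G0" by auto
  define G where "G = G0 + 1"
  define e where "e = \<eta> / (2 ^ N * 2)"
  have e: "0 < e" "2 ^ N * (2 * e) = \<eta>" using \<eta> by (auto simp: e_def)
  define c1 where "c1 = min 1 (e / (2 * G)) * e / 2"
  have G: "0 < G" using G0 by (simp add: G_def)
  have c1: "0 < c1" using e G by (simp add: c1_def)
  \<comment> \<open>With \<open>q\<^sup>N \<le> c0 r\<close> this makes the Chernoff term at most \<open>V\<^bsup>- (d + 2)\<^esup>\<close>, of which the net uses up \<open>V\<^sup>d\<close>.\<close>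
  define c0 where "c0 = c1 / (\<kappa> * (real d + 2))"
  have c0: "0 < c0" using c1 \<kappa> by (simp add: c0_def add_pos_pos)
  define V where "V n = real (index_volume n)" for n :: "nat ^ 'N"
  define r where "r n = V n * h n ^ d / ln (V n)" for n
  have phi0: "0 \<le> \<phi> a b" for a b using mixing by (auto simp: mixing_field_def)
  have chi0: "0 \<le> chi t" if "0 \<le> t" for t using mixing that by (auto simp: mixing_field_def)
  have rate': "mixing_bandwidth_a h (real d) \<epsilon> \<beta> \<phi> \<or> mixing_bandwidth_b h (real d) \<epsilon> \<beta> \<phi>" using rate by (simp add: d_def)
  note br = bandwidth_rate[where h=h and d=d and \<phi>=\<phi> and \<epsilon>=\<epsilon> and \<beta>=\<beta>,
      OF bandwidth eps phi0 rate', folded V_def, folded r_def N_def]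
  note rinf = br(1) and vol = br(2)
  from br(3) c0 obtain C2 where C2: "0 < C2" and mix: "eventually (\<lambda>n. \<forall>m::nat. real m \<le> c0 * r n \<longrightarrow>
            \<phi> (index_volume n) m * r n powr (- \<beta> / N) * (1 / h n ^ (d * (d + 2))) \<le> C2 / (V n * u_fun \<epsilon> n)) index_at_top"
    by blast
  obtain C3 i0 where C3: "0 < C3" "\<And>i. i0 \<le> i \<Longrightarrow> chi (real i) \<le> C3 * real i powr (- \<beta>)"
    using polynomial_decay_bound[OF beta(2)] by blast
  define q where "q n = nat \<lfloor>(c0 * r n) powr (1 / N)\<rfloor>" for n
  have ev_y: "eventually (\<lambda>n. real (max 1 i0) + 1 \<le> (c0 * r n) powr (1 / N)) index_at_top"
  proof -
    define y where "y = real (max 1 i0) + 1"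
    have y: "0 < y" by (simp add: y_def)
    have "eventually (\<lambda>n. y ^ N / c0 \<le> r n) index_at_top" using rinf unfolding filterlim_at_top by blast
    then show ?thesis
      unfolding y_def[symmetric]
    proof eventually_elim
      case (elim n)
      then have "y ^ N \<le> c0 * r n" using c0 by (simp add: field_simps)
      then have "(y ^ N) powr (1 / N) \<le> (c0 * r n) powr (1 / N)" using y by (intro powr_mono2) auto
      moreover have "(y ^ N) powr (1 / N) = y" using y N by (simp add: powr_realpow[symmetric] powr_powr)
      ultimately show ?case by simp
    qed
  qed
  have ev_r: "eventually (\<lambda>n. 1 \<le> r n) index_at_top" using rinf unfolding filterlim_at_top by blast
  have ev_h: "eventually (\<lambda>n. h n < 1) index_at_top" by (rule order_tendstoD(2)[OF bandwidth(2)]) simp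
  have ev_V: "eventually (\<lambda>n. \<forall>k. exp 1 \<le> real (n $ k)) (index_at_top :: (nat ^ 'N) filter)" by (rule eventually_index_ge_real)
  define D1 where "D1 = 2 ^ N * (2::real)"
  define D2 where "D2 = 2 ^ N * (4 / e * \<kappa> * (C3 * 2 powr \<beta> * c0 powr (- \<beta> / N)) * C2)"
  let ?dev = "\<lambda>n x. {\<omega>\<in>space M. \<eta> \<le> \<bar>region_est K h X Y A n \<omega> x - region_mean n A x\<bar>}"
  show thesis
  proof (rule that)
    show "0 < D1" by (simp add: D1_def)
    show "0 < D2" using e \<kappa> C3 c0 C2 by (simp add: D2_def)
    show "eventually (\<lambda>n. \<forall>x\<in>S. prob (?dev n x)
        / h n ^ (CARD('d) * (CARD('d) + 1)) \<le> D1 / real (index_volume n) ^ 2 + D2 / (real (index_volume n) * u_fun \<epsilon> n)) index_at_top"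
      using eventually_region_mean[OF A zero_less_one] vol mix ev_y ev_r ev_h ev_V eventually_index_pos
    proof (eventually_elim, intro ballI)
      fix n x
      assume mean: "\<forall>x\<in>S. \<bar>region_mean n A x - region_density f A x\<bar> \<le> 1"
        and vol: "ln (V n) \<le> V n * h n ^ (d + 1)"
        and mix: "\<forall>m::nat. real m \<le> c0 * r n \<longrightarrow>
            \<phi> (index_volume n) m * r n powr (- \<beta> / N) * (1 / h n ^ (d * (d + 2))) \<le> C2 / (V n * u_fun \<epsilon> n)"
        and y: "real (max 1 i0) + 1 \<le> (c0 * r n) powr (1 / N)" and r1: "1 \<le> r n" and h1: "h n < 1"
        and n1: "\<forall>k. exp 1 \<le> real (n $ k)" and n: "n \<in> pos_indices" and x: "x \<in> S"
      have hn: "0 < h n" using bandwidth(1) n by blast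
      have Vpos: "0 < V n" unfolding V_def by (rule volume_pos[OF n])
      have lnV: "1 \<le> ln (V n)"
      proof -
        have "exp 1 \<le> V n"
          using n1 index_volume_ge[OF n, of undefined] unfolding V_def by (meson of_nat_mono order_trans)
        then show ?thesis using Vpos by (subst ln_ge_iff) auto
      qed
      have qy: "real (q n) \<le> (c0 * r n) powr (1 / N)" "(c0 * r n) powr (1 / N) \<le> 2 * real (q n)" "1 \<le> q n" "i0 \<le> q n"
        unfolding q_def using y by linarith+
      have r0: "0 < c0 * r n" using c0 r1 by simp
      have qN: "real (q n ^ N) \<le> c0 * r n"
      proof -
        have "real (q n) ^ N \<le> ((c0 * r n) powr (1 / N)) ^ N" using qy by (intro power_mono) auto
        also have "\<dots> = ((c0 * r n) powr (1 / N)) powr real N" by (rule powr_realpow[symmetric]) (use c0 r1 in auto)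
        also have "\<dots> = c0 * r n" using r0 N by (simp add: powr_powr)
        finally show ?thesis by simp
      qed
      define c where "c = \<kappa> / (V n * h n ^ d)"
      let ?E = "exp (- c1 / (c * real (q n) ^ N))" and ?mix = "\<phi> (index_volume n) (q n ^ N) * chi (q n)" and ?range = "1 / h n ^ (d * (d + 2))"
      have c: "0 < c" using \<kappa> Vpos hn by (simp add: c_def)
      have bd: "0 \<le> region_summand n A x z \<and> region_summand n A x z \<le> c" for z
      proof -
        define s where "s = K ((x - fst z) /\<^sub>R h n) * indicator A (snd z)"
        have s: "0 \<le> s" "s \<le> \<kappa>" using K_nonneg \<kappa> by (auto simp: s_def indicator_def less_imp_le)
        have "region_summand n A x z = s / (V n * h n ^ d)" by (simp add: region_summand_def s_def V_def d_def)
        then show ?thesis using s Vpos hn by (simp add: c_def divide_right_mono)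
      qed
      have "region_mean n A x \<le> G"
        using mean x G0(2)[OF x] by (fastforce simp: G_def abs_le_iff)
      then have Gm: "(\<Sum>i\<in>index_box n. expectation (\<lambda>\<omega>. region_summand n A x (X i \<omega>, Y i \<omega>))) \<le> G"
        by (simp add: region_mean_def)
      have "prob {\<omega>\<in>space M. 2 ^ N * (2 * e) \<le> \<bar>region_est K h X Y A n \<omega> x - region_mean n A x\<bar>}
         \<le> 2 ^ N * (2 * ?E + 4 * (?mix) / e * (c * V n))"
        unfolding region_est_eq_sum region_mean_def N_def V_def c1_def
        by (rule index_box_concentration[OF mixing field_measurable region_summand_measurable[OF A] bd c _ Gm G e(1)]) (use qy in auto)
      then have P: "prob (?dev n x)
         \<le> 2 ^ N * (2 * ?E + 4 * (?mix) / e * (c * V n))"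
        by (simp add: e(2))
      have E1: "?E \<le> 1 / V n ^ (d + 2)"
      proof -
        have "c * real (q n) ^ N \<le> c * (c0 * r n)" using qN c by (intro mult_left_mono) auto
        also have "\<dots> = \<kappa> * c0 / ln (V n)" using Vpos hn by (simp add: c_def r_def)
        also have "\<dots> = c1 / ((real d + 2) * ln (V n))" using \<kappa> by (simp add: c0_def)
        finally have "c * real (q n) ^ N \<le> c1 / ((real d + 2) * ln (V n))" .
        moreover have "0 < (real d + 2) * ln (V n)" using lnV by simp
        moreover have "0 < c * real (q n) ^ N" using c qy by simp
        ultimately have "(real d + 2) * ln (V n) \<le> c1 / (c * real (q n) ^ N)" by (simp add: field_simps)
        then have "?E \<le> exp (- ((real d + 2) * ln (V n)))" by simp
        also have "\<dots> = 1 / V n ^ (d + 2)"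
        proof -
          have "exp ((real d + 2) * ln (V n)) = exp (ln (V n)) ^ (d + 2)"
            unfolding exp_of_nat_mult[symmetric] by simp
          then show ?thesis using Vpos by (simp add: exp_minus inverse_eq_divide)
        qed
        finally show ?thesis .
      qed
      have E2: "chi (q n) \<le> C3 * 2 powr \<beta> * c0 powr (- \<beta> / N) * r n powr (- \<beta> / N)"
      proof -
        have "chi (q n) \<le> C3 * real (q n) powr (- \<beta>)" using C3(2) qy by blast
        also have "\<dots> \<le> C3 * ((c0 * r n) powr (1 / N) / 2) powr (- \<beta>)"
          using qy(2) r0 beta(1) C3(1) by (intro mult_left_mono powr_mono2') auto
        also have "((c0 * r n) powr (1 / N) / 2) powr (- \<beta>) = 2 powr \<beta> * (c0 powr (- \<beta> / N) * r n powr (- \<beta> / N))"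
          using c0 r1 by (simp add: powr_divide powr_powr powr_mult powr_minus field_simps)
        finally show ?thesis by (simp add: mult.assoc)
      qed
      have H1: "1 / h n ^ (d * (d + 1)) \<le> V n ^ d"
      proof -
        have "1 \<le> V n * h n ^ (d + 1)" using lnV vol by linarith
        then have "1 / h n ^ (d + 1) \<le> V n" using hn by (simp add: field_simps)
        then have "(1 / h n ^ (d + 1)) ^ d \<le> V n ^ d" using hn by (intro power_mono) auto
        then show ?thesis by (simp only: power_divide power_mult[symmetric] power_one mult.commute)
      qed
      have "prob (?dev n x) / h n ^ (d * (d + 1))
         \<le> 2 ^ N * (2 * ?E + 4 * (?mix) / e * (c * V n)) / h n ^ (d * (d + 1))"
        using P hn by (intro divide_right_mono) auto
      also have "\<dots> = D1 * (?E * (1 / h n ^ (d * (d + 1))))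
         + 2 ^ N * (4 / e * \<kappa>) * (?mix * ?range)"
      proof -
        have eq: "c * V n / h n ^ (d * (d + 1)) = \<kappa> * ?range"
          using Vpos hn by (simp add: c_def power_add[symmetric] algebra_simps)
        have "t * (2 * E + 4 * p / e * w) / k = t * 2 * (E * (1 / k)) + t * (4 / e) * p * (w / k)" for t E p w k :: real
          by (simp add: add_divide_distrib distrib_left)
        then show ?thesis unfolding D1_def by (simp only: eq) (simp only: mult_ac)
      qed
      also have "\<dots> \<le> D1 * (1 / V n ^ 2) + D2 / (V n * u_fun \<epsilon> n)"
      proof (rule add_mono)
        have "?E * (1 / h n ^ (d * (d + 1))) \<le> 1 / V n ^ (d + 2) * V n ^ d"
          using E1 H1 Vpos hn by (intro mult_mono) auto
        also have "\<dots> = 1 / V n ^ 2" using Vpos by (simp add: power_add power2_eq_square)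
        finally show "D1 * (?E * (1 / h n ^ (d * (d + 1)))) \<le> D1 * (1 / V n ^ 2)"
          by (intro mult_left_mono) (auto simp: D1_def)
        have "?mix * ?range
           \<le> \<phi> (index_volume n) (q n ^ N) * (C3 * 2 powr \<beta> * c0 powr (- \<beta> / N) * r n powr (- \<beta> / N)) * ?range"
          using E2 phi0 hn by (intro mult_right_mono mult_left_mono) auto
        also have "\<dots> = (C3 * 2 powr \<beta> * c0 powr (- \<beta> / N)) * (\<phi> (index_volume n) (q n ^ N) * r n powr (- \<beta> / N) * ?range)"
          by simp
        also have "\<dots> \<le> (C3 * 2 powr \<beta> * c0 powr (- \<beta> / N)) * (C2 / (V n * u_fun \<epsilon> n))"
          using mix qN C3 by (intro mult_left_mono) auto
        finally have *: "?mix * ?range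
            \<le> (C3 * 2 powr \<beta> * c0 powr (- \<beta> / N)) * (C2 / (V n * u_fun \<epsilon> n))" .
        have "2 ^ N * (4 / e * \<kappa>) * (?mix * ?range)
           \<le> 2 ^ N * (4 / e * \<kappa>) * ((C3 * 2 powr \<beta> * c0 powr (- \<beta> / N)) * (C2 / (V n * u_fun \<epsilon> n)))"
          using e \<kappa> by (intro mult_left_mono[OF *]) auto
        also have "\<dots> = D2 / (V n * u_fun \<epsilon> n)" by (simp add: D2_def)
        finally show "2 ^ N * (4 / e * \<kappa>) * (?mix * ?range) \<le> D2 / (V n * u_fun \<epsilon> n)" .
      qed
      finally show "prob (?dev n x)
        / h n ^ (CARD('d) * (CARD('d) + 1)) \<le> D1 / real (index_volume n) ^ 2 + D2 / (real (index_volume n) * u_fun \<epsilon> n)"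
        by (simp add: d_def V_def)
    qed
  qed
qed

lemma region_est_measurable:
  assumes "A \<in> sets borel" shows "random_variable borel (\<lambda>\<omega>. region_est K h X Y A n \<omega> x)"
  unfolding region_est_eq_sum
proof (rule borel_measurable_sum)
  fix i assume "i \<in> index_box n"
  then have "i \<in> pos_indices" using index_box_pos by blast
  from measurable_compose[OF field_measurable[OF this] region_summand_measurable[OF assms]]
  show "random_variable borel (\<lambda>\<omega>. region_summand n A x (X i \<omega>, Y i \<omega>))" .
qed

text \<open>
  Counting all observations, and not only those near \<open>x\<close>, gives the constant \<open>h\<^bsup>- (d + 1)\<^esup>\<close>, which dictates the
  mesh of the net.
\<close>

lemma region_est_lipschitz:
  assumes L: "L-lipschitz_on UNIV K" and n: "n \<in> pos_indices"
  shows "\<bar>region_est K h X Y A n \<omega> x - region_est K h X Y A n \<omega> y\<bar> \<le> L * dist x y / h n ^ (CARD('d) + 1)"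
proof -
  have hn: "0 < h n" using bandwidth(1) n by blast
  note V = volume_pos[OF n]
  define c where "c = 1 / (real (index_volume n) * h n ^ CARD('d))"
  have c: "0 \<le> c" using V hn by (simp add: c_def)
  have diff: "\<bar>K ((x - u) /\<^sub>R h n) * indicator A v - K ((y - u) /\<^sub>R h n) * indicator A v\<bar> \<le> L * (dist x y / h n)" for u v
  proof -
    have "\<bar>K ((x - u) /\<^sub>R h n) - K ((y - u) /\<^sub>R h n)\<bar> \<le> L * dist ((x - u) /\<^sub>R h n) ((y - u) /\<^sub>R h n)"
      using lipschitz_onD[OF L, of "(x - u) /\<^sub>R h n" "(y - u) /\<^sub>R h n"] by (simp add: dist_real_def)
    also have "dist ((x - u) /\<^sub>R h n) ((y - u) /\<^sub>R h n) = dist x y / h n"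
      unfolding dist_norm scaleR_diff_right[symmetric] norm_scaleR using hn by (simp add: divide_inverse mult.commute)
    finally have 1: "\<bar>K ((x - u) /\<^sub>R h n) - K ((y - u) /\<^sub>R h n)\<bar> \<le> L * (dist x y / h n)" .
    then show ?thesis by (cases "v \<in> A") (auto intro: order_trans[OF abs_ge_zero])
  qed
  have "region_est K h X Y A n \<omega> x - region_est K h X Y A n \<omega> y
     = c * (\<Sum>i\<in>index_box n. K ((x - X i \<omega>) /\<^sub>R h n) * indicator A (Y i \<omega>) - K ((y - X i \<omega>) /\<^sub>R h n) * indicator A (Y i \<omega>))"
    by (simp only: region_est_def c_def sum_subtractf right_diff_distrib)
  also have "\<bar>\<dots>\<bar> = c * \<bar>\<Sum>i\<in>index_box n. K ((x - X i \<omega>) /\<^sub>R h n) * indicator A (Y i \<omega>) - K ((y - X i \<omega>) /\<^sub>R h n) * indicator A (Y i \<omega>)\<bar>"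
    using c by (simp only: abs_mult abs_of_nonneg)
  also have "\<dots> \<le> c * (\<Sum>i\<in>index_box n. L * (dist x y / h n))"
    by (intro mult_left_mono[OF _ c] order_trans[OF sum_abs] sum_mono diff)
  also have "\<dots> = L * dist x y / h n ^ (CARD('d) + 1)"
    using V by (simp add: c_def card_index_box)
  finally show ?thesis .
qed

text \<open>
  The error \<open>\<eta>\<close> is divided equally among four parts: passing from \<open>x\<close> to the nearest point of the net in
  the estimate, the stochastic error and the bias at that point, and the way back in the limit.
  The bad events involve only the finite net, which makes them measurable.
\<close>

theorem region_est_uniformly_consistent:
  assumes A: "A \<in> sets borel" and \<eta>: "0 < \<eta>"
  shows "AE \<omega> in M. eventually (\<lambda>n. \<forall>x\<in>S. \<bar>region_est K h X Y A n \<omega> x - region_density f A x\<bar> \<le> \<eta>) index_at_top"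
proof -
  define d where "d = CARD('d)"
  obtain C1 where C1: "0 < C1" and cover:
    "\<forall>\<rho>. 0 < \<rho> \<longrightarrow> \<rho> \<le> 1 \<longrightarrow> (\<exists>P\<subseteq>S. finite P \<and> real (card P) \<le> C1 / \<rho> ^ d \<and> (\<forall>x\<in>S. \<exists>y\<in>P. dist x y \<le> \<rho>))"
    using covering_number_bound[OF compact_imp_bounded[OF S(1)]] unfolding d_def by (elim exE conjE)
  obtain L where L: "L-lipschitz_on UNIV K" using K(2) by blast
  have L0: "0 \<le> L" by (rule lipschitz_on_nonneg[OF L])
  define \<eta>4 where "\<eta>4 = \<eta> / 4"
  have \<eta>4: "0 < \<eta>4" using \<eta> by (simp add: \<eta>4_def)
  from region_density_uniform[OF A \<eta>4]
  obtain \<delta> where \<delta>: "0 < \<delta>" "\<forall>x\<in>S. \<forall>s. dist x s < \<delta> \<longrightarrow> \<bar>region_density f A s - region_density f A x\<bar> < \<eta>4"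
    by (elim exE conjE)
  define a where "a = min 1 (\<eta>4 / (L + 1))"
  have a: "0 < a" "a \<le> 1" "L * a \<le> \<eta>4"
  proof -
    show "0 < a" "a \<le> 1" using \<eta>4 L0 by (simp_all add: a_def)
    then have "L * a \<le> (L + 1) * a" by simp
    also have "\<dots> \<le> (L + 1) * (\<eta>4 / (L + 1))" using L0 by (intro mult_left_mono) (auto simp: a_def)
    also have "\<dots> = \<eta>4" using L0 by simp
    finally show "L * a \<le> \<eta>4" .
  qed
  define \<rho> where "\<rho> n = a * h n ^ (d + 1)" for n
  \<comment> \<open>The empty default keeps \<open>P n\<close> finite for all \<open>n\<close>, so that every bad event is measurable.\<close>
  define P where "P n = (if 0 < \<rho> n \<and> \<rho> n \<le> 1 then SOME P. P \<subseteq> S \<and> finite P \<and> real (card P) \<le> C1 / \<rho> n ^ d \<and> (\<forall>x\<in>S. \<exists>y\<in>P. dist x y \<le> \<rho> n) else {})" for n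
  have P: "P n \<subseteq> S \<and> finite (P n) \<and> real (card (P n)) \<le> C1 / \<rho> n ^ d \<and> (\<forall>x\<in>S. \<exists>y\<in>P n. dist x y \<le> \<rho> n)"
    if "0 < \<rho> n" "\<rho> n \<le> 1" for n
    using someI_ex[OF cover[rule_format, OF that]] that by (simp add: P_def)
  have Pfin: "finite (P n)" for n
    using P[of n] by (cases "0 < \<rho> n \<and> \<rho> n \<le> 1") (auto simp: P_def)
  define dev where "dev n x = {\<omega>\<in>space M. \<eta>4 \<le> \<bar>region_est K h X Y A n \<omega> x - region_mean n A x\<bar>}" for n x
  have [measurable]: "dev n x \<in> events" for n x
  proof -
    note [measurable] = region_est_measurable[OF A, of n x]
    show ?thesis unfolding dev_def by measurable
  qed
  define Bad where "Bad n = (\<Union>x\<in>P n. dev n x)" for n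
  have Bad_ev: "Bad n \<in> events" for n
    unfolding Bad_def using Pfin by (intro sets.finite_UN) auto
  obtain D1 D2 where D: "0 < D1" "0 < D2" and
    tail: "eventually (\<lambda>n. \<forall>x\<in>S. prob (dev n x) / h n ^ (d * (d + 1)) \<le> D1 / real (index_volume n) ^ 2 + D2 / (real (index_volume n) * u_fun \<epsilon> n)) index_at_top"
    unfolding dev_def d_def by (rule region_tail[OF A \<eta>4])
  define b where "b m = (if exp (exp 1) \<le> real m
           then 1 / (real m * (ln (real m) * ln (ln (real m)) powr (1 + \<epsilon>))) else 0)" for m :: nat
  have b: "summable b" "0 \<le> b m" for m
  proof -
    show "summable b" unfolding b_def by (rule summable_bertrand[OF eps])
    show "0 \<le> b m"
    proof (cases "exp (exp 1) \<le> real m")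
      case True
      moreover have "1 \<le> exp (exp (1::real))" by simp
      ultimately have "1 \<le> real m" by linarith
      then show ?thesis by (simp add: b_def)
    qed (simp add: b_def)
  qed
  have sq: "summable (\<lambda>m. 1 / real m ^ 2)"
    using inverse_power_summable[of 2, where 'a=real] by (simp add: inverse_eq_divide)
  define s where "s n = C1 / a ^ d * D1 * (\<Prod>k\<in>UNIV. 1 / real (n $ k) ^ 2) + C1 / a ^ d * D2 * (\<Prod>k\<in>UNIV. b (n $ k))" for n :: "nat ^ 'N"
  have "s summable_on UNIV"
    unfolding s_def
    by (intro summable_on_add summable_on_cmult_right summable_on_index_product b sq) auto
  moreover have "0 \<le> s n" for n
    unfolding s_def using C1 a D b by (intro add_nonneg_nonneg mult_nonneg_nonneg prod_nonneg) auto
  moreover have "eventually (\<lambda>n. prob (Bad n) \<le> s n) index_at_top"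
  proof -
    have "eventually (\<lambda>n. h n < 1) index_at_top" by (rule order_tendstoD(2)[OF bandwidth(2)]) simp
    then show ?thesis
      using tail eventually_index_ge_real[of "exp (exp 1)"] eventually_index_pos
    proof eventually_elim
      case (elim n)
      have hn: "0 < h n" using bandwidth(1) elim by blast
      have \<rho>: "0 < \<rho> n" "\<rho> n \<le> 1"
        using hn a elim(1) by (auto simp: \<rho>_def intro!: mult_le_one power_le_one)
      define B where "B = D1 / real (index_volume n) ^ 2 + D2 / (real (index_volume n) * u_fun \<epsilon> n)"
      have "prob (Bad n) \<le> (\<Sum>x\<in>P n. prob (dev n x))"
        unfolding Bad_def by (rule finite_measure_subadditive_finite[OF Pfin]) auto
      also have "\<dots> \<le> (\<Sum>x\<in>P n. B * h n ^ (d * (d + 1)))"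
      proof (rule sum_mono)
        fix x assume "x \<in> P n"
        then have "x \<in> S" using P[OF \<rho>] by blast
        with elim(2) have "prob (dev n x) / h n ^ (d * (d + 1)) \<le> B" unfolding B_def by blast
        then show "prob (dev n x) \<le> B * h n ^ (d * (d + 1))" using hn by (simp add: pos_divide_le_eq)
      qed
      also have "\<dots> = real (card (P n)) * (B * h n ^ (d * (d + 1)))" by simp
      also have "\<dots> \<le> C1 / \<rho> n ^ d * (B * h n ^ (d * (d + 1)))"
      proof (rule mult_right_mono)
        show "real (card (P n)) \<le> C1 / \<rho> n ^ d" using P[OF \<rho>] by blast
        have "1 \<le> u_fun \<epsilon> n" using u_fun_ge_1[OF eps] elim(3) by blast
        then show "0 \<le> B * h n ^ (d * (d + 1))" using D hn by (simp add: B_def)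
      qed
      also have "\<rho> n ^ d = a ^ d * h n ^ (d * (d + 1))"
        unfolding \<rho>_def power_mult_distrib power_mult[symmetric] by (simp only: mult.commute)
      also have "C1 / (a ^ d * h n ^ (d * (d + 1))) * (B * h n ^ (d * (d + 1))) = C1 / a ^ d * B"
        using hn by simp
      also have "\<dots> = s n"
      proof -
        have V: "real (index_volume n) = (\<Prod>k\<in>UNIV. real (n $ k))" by (simp add: index_volume_def)
        have 1: "1 / real (index_volume n) ^ 2 = (\<Prod>k\<in>UNIV. 1 / real (n $ k) ^ 2)"
          unfolding V by (simp add: prod_dividef prod_power_distrib)
        have "(\<Prod>k\<in>UNIV. b (n $ k)) = (\<Prod>k\<in>UNIV. 1 / (real (n $ k) * (ln (real (n $ k)) * ln (ln (real (n $ k))) powr (1 + \<epsilon>))))"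
          using elim(3) by (intro prod.cong) (auto simp: b_def)
        also have "\<dots> = 1 / (real (index_volume n) * u_fun \<epsilon> n)"
          unfolding V u_fun_def by (simp add: prod_dividef prod.distrib)
        finally have 2: "1 / (real (index_volume n) * u_fun \<epsilon> n) = (\<Prod>k\<in>UNIV. b (n $ k))" by simp
        have "B = D1 * (1 / real (index_volume n) ^ 2) + D2 * (1 / (real (index_volume n) * u_fun \<epsilon> n))"
          by (simp add: B_def)
        then show ?thesis unfolding s_def 1 2 by (simp only: distrib_left mult.assoc)
      qed
      finally show ?case .
    qed
  qed
  ultimately have "AE \<omega> in M. eventually (\<lambda>n. \<omega> \<notin> Bad n) index_at_top"
    by (rule borel_cantelli_index[OF Bad_ev])
  then show ?thesis
    using AE_space
  proof eventually_elim
    case (elim \<omega>)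
    have 1: "eventually (\<lambda>n. h n < min 1 \<delta>) index_at_top"
      by (rule order_tendstoD(2)[OF bandwidth(2)]) (use \<delta> in simp)
    show ?case
      using 1 elim(1) eventually_index_pos eventually_region_mean[OF A \<eta>4]
    proof (eventually_elim, intro ballI)
      fix n x assume h1: "h n < min 1 \<delta>" and good: "\<omega> \<notin> Bad n" and n: "n \<in> pos_indices"
        and mean: "\<forall>x\<in>S. \<bar>region_mean n A x - region_density f A x\<bar> \<le> \<eta>4" and x: "x \<in> S"
      have hn: "0 < h n" using bandwidth(1) n by blast
      have hd: "h n ^ (d + 1) \<le> h n"
        using power_decreasing[of 1 "d + 1" "h n"] hn h1 by simp
      then have \<rho>: "0 < \<rho> n" "\<rho> n \<le> h n"
        using hn a mult_mono[of a 1 "h n ^ (d + 1)" "h n"] by (auto simp: \<rho>_def)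
      then have \<rho>1: "\<rho> n \<le> 1" "\<rho> n < \<delta>" using h1 by auto
      obtain y where y: "y \<in> P n" "dist x y \<le> \<rho> n" "y \<in> S" using P[OF \<rho>(1) \<rho>1(1)] x by blast
      have "\<bar>region_est K h X Y A n \<omega> x - region_est K h X Y A n \<omega> y\<bar> \<le> L * dist x y / h n ^ (d + 1)"
        unfolding d_def by (rule region_est_lipschitz[OF L n])
      also have "\<dots> \<le> L * \<rho> n / h n ^ (d + 1)"
        using y(2) L0 hn by (intro divide_right_mono mult_left_mono) auto
      also have "\<dots> = L * a" using hn by (simp add: \<rho>_def)
      finally have 1: "\<bar>region_est K h X Y A n \<omega> x - region_est K h X Y A n \<omega> y\<bar> \<le> \<eta>4" using a(3) by linarith
      have "\<omega> \<notin> dev n y" using good y(1) by (auto simp: Bad_def)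
      then have 2: "\<bar>region_est K h X Y A n \<omega> y - region_mean n A y\<bar> < \<eta>4"
        using elim(2) by (simp add: dev_def)
      have 3: "\<bar>region_mean n A y - region_density f A y\<bar> \<le> \<eta>4" using mean y(3) by blast
      have "dist y x < \<delta>" using y(2) \<rho>1 by (simp add: dist_commute)
      then have 4: "\<bar>region_density f A x - region_density f A y\<bar> < \<eta>4" using \<delta>(2) y(3) by blast
      have "\<eta> = \<eta>4 + \<eta>4 + \<eta>4 + \<eta>4" by (simp add: \<eta>4_def)
      then show "\<bar>region_est K h X Y A n \<omega> x - region_density f A x\<bar> \<le> \<eta>" using 1 2 3 4 by linarith
    qed
  qed
qed

end

section \<open>From uniform consistency to conditional quantiles\<close>

lemma cdf_of_density:
  fixes k :: "real \<Rightarrow> real"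
  assumes k: "prob_density k"
  defines "G \<equiv> \<lambda>y. LINT z:{..y}|lborel. k z"
  shows "mono G" "continuous_on UNIV G" "(G \<longlongrightarrow> 0) at_bot" "(G \<longlongrightarrow> 1) at_top" "0 \<le> G y" "G y \<le> 1"
proof -
  have k0: "\<And>s. 0 \<le> k s" and ki: "integrable lborel k" and k1: "(LINT s|lborel. k s) = 1"
    using k by (auto simp: prob_density_def)
  have [measurable]: "k \<in> borel_measurable borel" using ki by auto
  define D where "D = density lborel (\<lambda>z. ennreal (k z))"
  have "emeasure D (space D) = 1"
    using nn_integral_eq_integral[OF ki] k0 k1 by (simp add: D_def emeasure_density)
  then interpret D: prob_space D by (rule prob_spaceI)
  interpret D: real_distribution D by unfold_locales (simp_all add: D_def)
  have meas: "measure D A = (LINT z:A|lborel. k z)" if "A \<in> sets borel" for A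
  proof -
    have "measure D A = (LINT z|D. indicator A z)" using that by (simp add: D_def)
    also have "\<dots> = (LINT z|lborel. k z * indicator A z)"
      unfolding D_def by (rule integral_real_density) (use that k0 in auto)
    finally show ?thesis by (simp add: set_lebesgue_integral_def mult.commute)
  qed
  have G: "G = cdf D" by (simp add: G_def cdf_def meas fun_eq_iff)
  show "mono G" unfolding G by (simp add: mono_def D.cdf_nondecreasing)
  show "continuous_on UNIV G"
    unfolding G
  proof (rule continuous_at_imp_continuous_on, rule ballI)
    fix x
    have "(LINT z:{x}|lborel. k z) = 0"
      unfolding set_lebesgue_integral_def
    proof (rule integral_eq_zero_AE)
      show "AE z in lborel. indicator {x} z *\<^sub>R k z = 0"
        using AE_lborel_singleton[of x] by eventually_elim simp
    qed
    then have "measure D {x} = 0" by (simp add: meas)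
    then show "isCont (cdf D) x" by (simp add: D.isCont_cdf)
  qed
  show "(G \<longlongrightarrow> 0) at_bot" unfolding G by (rule D.cdf_lim_at_bot)
  show "(G \<longlongrightarrow> 1) at_top" unfolding G by (rule D.cdf_lim_at_top_prob)
  show "0 \<le> G y" "G y \<le> 1" unfolding G by (simp_all add: D.cdf_nonneg D.cdf_bounded_prob)
qed

lemma cdf_of_density_attains:
  fixes k :: "real \<Rightarrow> real"
  assumes k: "prob_density k" and v: "0 < v" "v < 1"
  obtains y where "(LINT z:{..y}|lborel. k z) = v"
proof -
  note G = cdf_of_density[OF k]
  have "eventually (\<lambda>y. (LINT z:{..y}|lborel. k z) < v) at_bot" by (rule order_tendstoD(2)[OF G(3) v(1)])
  then obtain y1 where y1: "\<And>y. y \<le> y1 \<Longrightarrow> (LINT z:{..y}|lborel. k z) < v" by (auto simp: eventually_at_bot_linorder)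
  have "eventually (\<lambda>y. v < (LINT z:{..y}|lborel. k z)) at_top" by (rule order_tendstoD(1)[OF G(4) v(2)])
  then obtain y2 where y2: "\<And>y. y2 \<le> y \<Longrightarrow> v < (LINT z:{..y}|lborel. k z)" by (auto simp: eventually_at_top_linorder)
  have "\<exists>y\<ge>y1. y \<le> max y1 y2 \<and> (LINT z:{..y}|lborel. k z) = v"
    by (rule IVT') (use y1[of y1] y2[of "max y1 y2"] in \<open>auto intro: continuous_on_subset[OF G(2)]\<close>)
  then show thesis using that by blast
qed

lemma conditional_prob_density:
  assumes "0 < marginal_density f x" "\<And>z. 0 \<le> f z"
  shows "prob_density (\<lambda>y. f (x, y) / marginal_density f x)"
  using assms integrable_slice[OF assms(1)] by (auto simp: prob_density_def marginal_density_def[symmetric] less_imp_le)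

lemma cond_cdf_eq_region: "cond_cdf f y x = region_density f {..y} x / marginal_density f x"
  by (simp add: cond_cdf_def region_density_def)

lemma region_density_UNIV: "region_density f UNIV x = marginal_density f x"
  by (simp add: region_density_def marginal_density_def set_lebesgue_integral_def)

lemma g_est_eq_region: "g_est K h X n \<omega> x = region_est K h X Y UNIV n \<omega> x"
  by (simp add: g_est_def region_est_def)

lemma shifted_kernel_cdf:
  fixes w :: "real \<Rightarrow> real"
  assumes w: "prob_density w" "continuous_on UNIV w" "\<And>t. w (- t) = w t" and h: "0 < h"
  shows "prob_density (\<lambda>z. w ((z - Y) / h) / h)"
proof -
  have wm: "w \<in> borel_measurable borel" using w(2) by (rule borel_measurable_continuous_onI)
  have "w ((z - Y) / h) = w ((Y - z) /\<^sub>R h)" for z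
  proof -
    have "(Y - z) /\<^sub>R h = - ((z - Y) / h)" by (simp add: divide_inverse algebra_simps)
    then show ?thesis using w(3)[of "(z - Y) / h"] by (simp only:)
  qed
  then show ?thesis
    using rescaled_kernel_integral[OF w(1) wm h, of Y] w(1) h
    by (simp add: prob_density_def has_bochner_integral_iff)
qed

text \<open>
  Divided by \<open>h\<close>, the integrated kernel is a distribution function that reaches 0 and 1 within distance \<open>h R\<close> of \<open>Y\<close>.
\<close>

lemma smoothed_indicator_bounds:
  fixes w :: "real \<Rightarrow> real"
  assumes w: "prob_density w" "continuous_on UNIV w" "\<And>t. w (- t) = w t"
    and R: "\<And>t. R < norm t \<Longrightarrow> w t = 0" and h: "0 < h"
  shows "a + h * R < y \<Longrightarrow> h * indicator {..a} Y \<le> (LINT z:{..y}|lborel. w ((z - Y) / h))"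
    and "y < a - h * R \<Longrightarrow> (LINT z:{..y}|lborel. w ((z - Y) / h)) \<le> h * indicator {..a} Y"
proof -
  define k where "k z = w ((z - Y) / h) / h" for z
  have k: "prob_density k" unfolding k_def by (rule shifted_kernel_cdf[OF w h])
  have eq: "(LINT z:A|lborel. w ((z - Y) / h)) = h * (LINT z:A|lborel. k z)" for A
    using h by (simp add: k_def)
  have zero: "k z = 0" if "h * R < \<bar>z - Y\<bar>" for z
  proof -
    have "R < norm ((z - Y) / h)" using that h by (simp add: field_simps)
    then show ?thesis using R by (simp add: k_def)
  qed
  note G = cdf_of_density[OF k]
  {
    assume y: "a + h * R < y"
    have "indicator {..a} Y \<le> (LINT z:{..y}|lborel. k z)"
    proof (cases "Y \<le> a")
      case True
      have "(LINT z:{..y}|lborel. k z) = (LINT z|lborel. k z)"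
        unfolding set_lebesgue_integral_def
      proof (rule Bochner_Integration.integral_cong[OF refl])
        fix z
        show "indicator {..y} z *\<^sub>R k z = k z"
          using zero[of z] True y by (cases "z \<le> y") auto
      qed
      then show ?thesis using k by (simp add: prob_density_def indicator_def)
    qed (use G(5) in simp)
    then show "h * indicator {..a} Y \<le> (LINT z:{..y}|lborel. w ((z - Y) / h))"
      unfolding eq using h by (intro mult_left_mono) auto
  next
    assume y: "y < a - h * R"
    have "(LINT z:{..y}|lborel. k z) \<le> indicator {..a} Y"
    proof (cases "Y \<le> a")
      case False
      have "(LINT z:{..y}|lborel. k z) = (LINT (z::real)|lborel. (0::real))"
        unfolding set_lebesgue_integral_def
      proof (rule Bochner_Integration.integral_cong[OF refl])
        fix z
        show "indicator {..y} z *\<^sub>R k z = 0"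
          using zero[of z] False y by (cases "z \<le> y") auto
      qed
      then show ?thesis using False by simp
    qed (use G(6) in simp)
    then show "(LINT z:{..y}|lborel. w ((z - Y) / h)) \<le> h * indicator {..a} Y"
      unfolding eq using h by (intro mult_left_mono) auto
  }
qed

text \<open>
  At a single \<open>x\<close> the levels are taken where the continuous function \<open>y \<mapsto> F(y | x)\<close> attains the two values that
  trisect \<open>{a..b}\<close>.  The strict inequalities persist near \<open>x\<close>, and compactness leaves
  finitely many pairs.
\<close>

lemma separating_levels:
  fixes f :: "(real ^ 'd) \<times> real \<Rightarrow> real"
  assumes f: "continuous_on UNIV f" "\<And>z. 0 \<le> f z" and g: "continuous_on UNIV (marginal_density f)"
    and S: "compact S" "\<And>x. x \<in> S \<Longrightarrow> 0 < marginal_density f x"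
    and ab: "0 \<le> a" "a < b" "b \<le> 1"
  shows "\<exists>Q. finite Q \<and> (\<forall>(y1, y2)\<in>Q. y1 < y2) \<and> (\<forall>x\<in>S. \<exists>(y1, y2)\<in>Q. a < cond_cdf f y1 x \<and> cond_cdf f y2 x < b)"
proof -
  define U where "U = {x. 0 < marginal_density f x}"
  have U: "open U" unfolding U_def by (rule open_Collect_less[OF continuous_on_const g])
  have cont: "continuous_on U (cond_cdf f y)" for y
    unfolding cond_cdf_eq_region[abs_def] U_def
    by (intro continuous_on_divide continuous_on_region_density f g continuous_on_subset[OF g]) auto
  define W where "W y1 y2 = (U \<inter> cond_cdf f y1 -` {a<..}) \<inter> (U \<inter> cond_cdf f y2 -` {..<b})" for y1 y2
  have W: "open (W y1 y2)" for y1 y2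
    unfolding W_def by (intro open_Int continuous_open_preimage[OF cont U]) auto
  have "\<exists>y1 y2. y1 < y2 \<and> x \<in> W y1 y2" if "x \<in> S" for x
  proof -
    have gx: "0 < marginal_density f x" using S that by blast
    note k = conditional_prob_density[OF gx f(2)]
    obtain y1 where y1: "cond_cdf f y1 x = (2 * a + b) / 3"
      using cdf_of_density_attains[OF k, of "(2 * a + b) / 3"] ab unfolding cond_cdf_def by auto
    obtain y2 where y2: "cond_cdf f y2 x = (a + 2 * b) / 3"
      using cdf_of_density_attains[OF k, of "(a + 2 * b) / 3"] ab unfolding cond_cdf_def by auto
    have "y1 < y2"
    proof (rule ccontr)
      assume "\<not> y1 < y2"
      then have "cond_cdf f y2 x \<le> cond_cdf f y1 x"
        unfolding cond_cdf_def using monoD[OF cdf_of_density(1)[OF k]] by simp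
      then show False using y1 y2 ab by simp
    qed
    moreover have "x \<in> W y1 y2" using y1 y2 ab gx by (auto simp: W_def U_def)
    ultimately show ?thesis by blast
  qed
  then have cover: "S \<subseteq> (\<Union>t\<in>{(y1, y2). y1 < y2}. W (fst t) (snd t))" by fastforce
  obtain Q where Q: "Q \<subseteq> {(y1, y2). y1 < y2}" "finite Q" "S \<subseteq> (\<Union>t\<in>Q. W (fst t) (snd t))"
    by (rule compactE_image[OF S(1) W cover])
  show ?thesis
  proof (intro exI[of _ Q] conjI ballI)
    fix x assume "x \<in> S"
    then obtain t where "t \<in> Q" "x \<in> W (fst t) (snd t)" using Q(3) by blast
    then show "\<exists>(y1, y2)\<in>Q. a < cond_cdf f y1 x \<and> cond_cdf f y2 x < b"
      by (intro bexI[of _ t]) (auto simp: W_def split: prod.splits)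
  qed (use Q in auto)
qed

context mixing_kernel_field begin

lemma psi_est_sandwich:
  assumes w: "prob_density w" "continuous_on UNIV w" "\<And>t. w (- t) = w t"
    and R: "\<And>t. R < norm t \<Longrightarrow> w t = 0" and n: "n \<in> pos_indices"
  shows "a + h n * R < y \<Longrightarrow> region_est K h X Y {..a} n \<omega> x \<le> psi_est K w h X Y n \<omega> x y"
    and "y < a - h n * R \<Longrightarrow> psi_est K w h X Y n \<omega> x y \<le> region_est K h X Y {..a} n \<omega> x"
proof -
  have hn: "0 < h n" using bandwidth(1) n by blast
  have V: "0 \<le> 1 / (real (index_volume n) * h n ^ (CARD('d) + 1))" using hn by simp
  have eq: "region_est K h X Y A n \<omega> x = 1 / (real (index_volume n) * h n ^ (CARD('d) + 1)) *
     (\<Sum>i\<in>index_box n. K ((x - X i \<omega>) /\<^sub>R h n) * (h n * indicator A (Y i \<omega>)))" for A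
    using hn by (simp add: region_est_def sum_distrib_left mult_ac)
  show "region_est K h X Y {..a} n \<omega> x \<le> psi_est K w h X Y n \<omega> x y" if "a + h n * R < y"
    unfolding eq psi_est_def
    by (intro mult_left_mono[OF _ V] sum_mono mult_left_mono[OF _ K_nonneg] smoothed_indicator_bounds(1)[OF w R hn that])
  show "psi_est K w h X Y n \<omega> x y \<le> region_est K h X Y {..a} n \<omega> x" if "y < a - h n * R"
    unfolding eq psi_est_def
    by (intro mult_left_mono[OF _ V] sum_mono mult_left_mono[OF _ K_nonneg] smoothed_indicator_bounds(2)[OF w R hn that])
qed

text \<open>
  The numerator is continuous in \<open>y\<close>.  It vanishes below all observations and equals the
  denominator above all of them, as \<open>w\<close> has compact support.
\<close>

lemma estimated_quantile_exists:
  assumes w: "prob_density w" "continuous_on UNIV w" "\<And>t. w (- t) = w t"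
    and R: "\<And>t. R < norm t \<Longrightarrow> w t = 0" and n: "n \<in> pos_indices" and p: "0 < p" "p < 1"
    and pos: "0 < g_est K h X n \<omega> x"
  shows "\<exists>z. F_est K w h X Y n \<omega> z x = p"
proof -
  have hn: "0 < h n" using bandwidth(1) n by blast
  define g0 where "g0 = g_est K h X n \<omega> x"
  have g0: "0 < g0" using pos by (simp add: g0_def)
  have cont: "continuous_on UNIV (psi_est K w h X Y n \<omega> x)"
  proof -
    have "continuous_on UNIV (\<lambda>y. LINT z:{..y}|lborel. w ((z - Y i \<omega>) / h n))" for i
    proof -
      have "continuous_on UNIV (\<lambda>y. h n * (LINT z:{..y}|lborel. w ((z - Y i \<omega>) / h n) / h n))"
        by (intro continuous_on_mult continuous_on_const cdf_of_density(2) shifted_kernel_cdf w hn)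
      then show ?thesis using hn by simp
    qed
    then show ?thesis unfolding psi_est_def[abs_def] by (intro continuous_intros)
  qed
  obtain B where B: "\<And>i. i \<in> index_box n \<Longrightarrow> \<bar>Y i \<omega>\<bar> < B"
  proof
    fix i assume "i \<in> index_box n"
    then have "\<bar>Y i \<omega>\<bar> \<le> (\<Sum>i\<in>index_box n. \<bar>Y i \<omega>\<bar>)"
      by (intro member_le_sum) (auto simp: finite_index_box)
    then show "\<bar>Y i \<omega>\<bar> < (\<Sum>i\<in>index_box n. \<bar>Y i \<omega>\<bar>) + 1" by simp
  qed
  define H where "H = h n * \<bar>R\<bar>"
  define lo where "lo = - B - H - 1"
  define hi where "hi = B + H + 1"
  have hR: "h n * R \<le> H" "0 \<le> H" using hn by (auto simp: H_def)
  have lo: "lo < - B - h n * R" and hi: "B + h n * R < hi" unfolding lo_def hi_def using hR by linarith+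
  have B0: "0 < B"
  proof -
    have "n \<in> index_box n" using n by (auto simp: index_box_def pos_indices_def)
    from B[OF this] show ?thesis by linarith
  qed
  have "psi_est K w h X Y n \<omega> x lo \<le> region_est K h X Y {..- B} n \<omega> x"
    by (rule psi_est_sandwich[where R=R, OF w R n]) (use lo in auto)
  also have "region_est K h X Y {..- B} n \<omega> x = 0"
    unfolding region_est_def using B by (force intro!: sum.neutral simp: indicator_def)
  finally have 1: "psi_est K w h X Y n \<omega> x lo \<le> p * g0" using p g0 by (smt (verit) mult_pos_pos)
  have "g0 = region_est K h X Y {..B} n \<omega> x"
    unfolding g0_def g_est_eq_region[of K h X n \<omega> x Y] region_est_def using B
    by (intro arg_cong2[of _ _ _ _ "(*)"] refl sum.cong) (force simp: indicator_def)
  also have "\<dots> \<le> psi_est K w h X Y n \<omega> x hi"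
    by (rule psi_est_sandwich[where R=R, OF w R n]) (use hi in auto)
  finally have 2: "p * g0 \<le> psi_est K w h X Y n \<omega> x hi"
    using p g0 mult_right_mono[of p 1 g0] by linarith
  have "lo \<le> hi" using hR B0 by (simp add: lo_def hi_def)
  then obtain z where "psi_est K w h X Y n \<omega> x z = p * g0"
    using IVT'[OF 1 2 _ continuous_on_subset[OF cont]] by auto
  then have "F_est K w h X Y n \<omega> z x = p" using g0 by (simp add: F_est_def g0_def)
  then show ?thesis ..
qed

text \<open>
  If \<open>F(z | x) \<ge> p + \<eta>\<close> at the root \<open>z\<close>, then \<open>z\<close> lies to the right of a pair \<open>y1 < y2\<close> of levels with
  \<open>F(y1 | x) > a > p\<close>, and the numerator at \<open>z\<close> is at least the estimate for \<open>{..y1}\<close>, because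
  \<open>h R\<close> fits between \<open>y1\<close> and \<open>y2\<close>.  That estimate is close to \<open>F(y1 | x) g(x) > a g(x)\<close>, whereas the numerator at the root is
  \<open>p\<close> times an estimate of \<open>g(x)\<close>: a contradiction once the errors are below \<open>\<tau>\<close>.  The other side is symmetric.
\<close>

theorem level_of_estimated_quantile:
  assumes w: "prob_density w" "continuous_on UNIV w" "\<And>t. w (- t) = w t" "compact_support w"
    and p: "0 < p" "p < 1" and q: "quantile_estimator K w h X Y p M S q" and \<eta>: "0 < \<eta>"
  shows "AE \<omega> in M. eventually (\<lambda>n. \<forall>x\<in>S. \<bar>cond_cdf f (q n \<omega> x) x - p\<bar> \<le> \<eta>) index_at_top"
proof (cases "S = {}")
  case False
  obtain R where R: "0 < R" "\<And>t. R < norm t \<Longrightarrow> w t = 0" using compact_support_zero_outside[OF w(4)] by blast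
  define F where "F = cond_cdf f"
  \<comment> \<open>The levels are truncated to \<open>{0..1}\<close>, so that values of \<open>F\<close> can be found between them.\<close>
  define b where "b = min 1 (p + \<eta>)"
  define a where "a = (p + b) / 2"
  define a' where "a' = max 0 (p - \<eta>)"
  define b' where "b' = (a' + p) / 2"
  have ab: "p < a" "a < b" "b \<le> 1" "0 \<le> a" using p \<eta> by (auto simp: a_def b_def)
  have ab': "0 \<le> a'" "a' < b'" "b' < p" "b' \<le> 1" using p \<eta> by (auto simp: a'_def b'_def)
  obtain Q where Q: "finite Q" "\<And>y1 y2. (y1, y2) \<in> Q \<Longrightarrow> y1 < y2"
      "\<And>x. x \<in> S \<Longrightarrow> \<exists>y1 y2. (y1, y2) \<in> Q \<and> a < F y1 x \<and> F y2 x < b"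
    using separating_levels[OF f_continuous f_nonneg g_continuous S ab(4,2,3)] unfolding F_def by fast
  obtain Q' where Q': "finite Q'" "\<And>y1 y2. (y1, y2) \<in> Q' \<Longrightarrow> y1 < y2"
      "\<And>x. x \<in> S \<Longrightarrow> \<exists>y1 y2. (y1, y2) \<in> Q' \<and> a' < F y1 x \<and> F y2 x < b'"
    using separating_levels[OF f_continuous f_nonneg g_continuous S ab'(1,2,4)] unfolding F_def by fast
  obtain \<gamma> where \<gamma>: "0 < \<gamma>" "\<And>x. x \<in> S \<Longrightarrow> \<gamma> \<le> marginal_density f x"
  proof -
    obtain x0 where "x0 \<in> S" "\<And>x. x \<in> S \<Longrightarrow> marginal_density f x0 \<le> marginal_density f x"
      using continuous_attains_inf[OF S(1) False continuous_on_subset[OF g_continuous]] by auto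
    then show thesis using S(2) that by blast
  qed
  \<comment> \<open>The factor 1/2 keeps the estimated marginal density positive; the factors 1/4 leave room for the errors
    \<open>\<tau>\<close> and \<open>p \<tau>\<close> of numerator and denominator.\<close>
  define \<tau> where "\<tau> = min (1 / 2) (min (a - p) (p - b') / 4) * \<gamma>"
  have \<tau>: "0 < \<tau>" "\<tau> \<le> \<gamma> / 2" "\<tau> \<le> (a - p) / 4 * \<gamma>" "\<tau> \<le> (p - b') / 4 * \<gamma>"
  proof -
    show "0 < \<tau>" using \<gamma> ab ab' by (simp add: \<tau>_def)
    have "min (1 / 2) (min (a - p) (p - b') / 4) \<le> 1 / 2" "min (1 / 2) (min (a - p) (p - b') / 4) \<le> (a - p) / 4"
      "min (1 / 2) (min (a - p) (p - b') / 4) \<le> (p - b') / 4" by (auto simp: min_def)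
    from this[THEN mult_right_mono, of \<gamma>] show "\<tau> \<le> \<gamma> / 2" "\<tau> \<le> (a - p) / 4 * \<gamma>" "\<tau> \<le> (p - b') / 4 * \<gamma>"
      using \<gamma>(1) unfolding \<tau>_def by simp_all
  qed
  define \<A> where "\<A> = insert UNIV ((\<lambda>(y1, y2). {..y1}) ` Q \<union> (\<lambda>(y1, y2). {..y2}) ` Q')"
  have \<A>: "finite \<A>" "\<And>A. A \<in> \<A> \<Longrightarrow> A \<in> sets borel" using Q(1) Q'(1) by (auto simp: \<A>_def)
  have "AE \<omega> in M. \<forall>A\<in>\<A>. eventually (\<lambda>n. \<forall>x\<in>S. \<bar>region_est K h X Y A n \<omega> x - region_density f A x\<bar> \<le> \<tau>) index_at_top"
    using \<A> region_est_uniformly_consistent[OF _ \<tau>(1)] by (intro AE_finite_allI) auto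
  then show ?thesis
    using AE_space
  proof eventually_elim
    case (elim \<omega>)
    have est: "eventually (\<lambda>n. \<forall>A\<in>\<A>. \<forall>x\<in>S. \<bar>region_est K h X Y A n \<omega> x - region_density f A x\<bar> \<le> \<tau>) index_at_top"
      using elim(1) \<A>(1) by (simp add: eventually_ball_finite_distrib)
    have gap: "eventually (\<lambda>n. \<forall>(y1, y2)\<in>Q \<union> Q'. h n * R < y2 - y1) index_at_top"
    proof (rule eventually_ball_finite)
      show "finite (Q \<union> Q')" using Q Q' by simp
      show "\<forall>yy\<in>Q \<union> Q'. eventually (\<lambda>n. case yy of (y1, y2) \<Rightarrow> h n * R < y2 - y1) index_at_top"
      proof (clarify)
        fix y1 y2 assume "(y1, y2) \<in> Q \<union> Q'"
        then have "0 < (y2 - y1) / R" using Q(2) Q'(2) R by fastforce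
        from order_tendstoD(2)[OF bandwidth(2) this]
        show "eventually (\<lambda>n. h n * R < y2 - y1) index_at_top"
          by eventually_elim (use R in \<open>simp add: field_simps\<close>)
      qed
    qed
    show ?case
      using est gap eventually_index_pos
    proof (eventually_elim, intro ballI)
      fix n x
      assume est: "\<forall>A\<in>\<A>. \<forall>x\<in>S. \<bar>region_est K h X Y A n \<omega> x - region_density f A x\<bar> \<le> \<tau>"
        and gap: "\<forall>(y1, y2)\<in>Q \<union> Q'. h n * R < y2 - y1" and n: "n \<in> pos_indices" and x: "x \<in> S"
      define G where "G = g_est K h X n \<omega> x"
      define g where "g = marginal_density f x"
      define z where "z = q n \<omega> x"
      have g: "\<gamma> \<le> g" "0 < g" using \<gamma> x S(2) by (auto simp: g_def)
      have "UNIV \<in> \<A>" by (simp add: \<A>_def)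
      then have Gg: "\<bar>G - g\<bar> \<le> \<tau>"
        using est x unfolding G_def g_def region_density_UNIV[of f x, symmetric] g_est_eq_region[of K h X n \<omega> x Y] by blast
      then have G0: "0 < G" using \<tau> g \<gamma> by linarith
      have "F_est K w h X Y n \<omega> z x = p"
        using q estimated_quantile_exists[OF w(1-3) R(2) n p, where \<omega>=\<omega> and x=x] G0 n elim(2) x
        unfolding quantile_estimator_def z_def G_def by blast
      then have root: "psi_est K w h X Y n \<omega> x z = p * G" using G0 by (simp add: F_est_def G_def field_simps)
      have kd: "prob_density (\<lambda>y. f (x, y) / marginal_density f x)"
        by (rule conditional_prob_density[OF S(2)[OF x] f_nonneg])
      have Fmono: "F y x \<le> F y' x" if "y \<le> y'" for y y'
        using monoD[OF cdf_of_density(1)[OF kd] that] by (simp add: F_def cond_cdf_def)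
      have F01: "0 \<le> F y x" "F y x \<le> 1" for y
        using cdf_of_density(5,6)[OF kd, of y] by (simp_all add: F_def cond_cdf_def)
      have Fg: "region_density f {..y} x = F y x * g" for y
        using g by (simp add: F_def cond_cdf_eq_region g_def)
      have t: "(a - p) / 4 * \<gamma> \<le> (a - p) / 4 * g" "(p - b') / 4 * \<gamma> \<le> (p - b') / 4 * g"
        using ab ab' g by (intro mult_left_mono; simp)+
      have p\<tau>: "p * \<tau> \<le> \<tau>" "0 \<le> p * \<tau>" using p \<tau>(1) by (simp_all add: mult_left_le_one_le)
      have pG: "p * G \<le> p * (g + \<tau>)" "p * (g - \<tau>) \<le> p * G" using Gg p by (auto intro!: mult_left_mono)
      have upper: "F z x < p + \<eta>"
      proof (rule ccontr)
        assume "\<not> F z x < p + \<eta>"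
        then have Fz: "b \<le> F z x" by (simp add: b_def)
        obtain y1 y2 where y: "(y1, y2) \<in> Q" "a < F y1 x" "F y2 x < b" using Q(3)[OF x] by blast
        have "y2 < z" using Fmono[of z y2] Fz y(3) by linarith
        moreover have "h n * R < y2 - y1" using gap y(1) by blast
        ultimately have "region_est K h X Y {..y1} n \<omega> x \<le> p * G"
          unfolding root[symmetric] by (intro psi_est_sandwich(1)[OF w(1-3) R(2) n]) auto
        moreover have "{..y1} \<in> \<A>" using y(1) by (force simp: \<A>_def)
        then have "region_density f {..y1} x - \<tau> \<le> region_est K h X Y {..y1} n \<omega> x"
          using est x by (smt (verit))
        moreover have "a * g < F y1 x * g" using y(2) g by simp
        ultimately have "a * g - \<tau> < p * (g + \<tau>)" using pG(1) unfolding Fg by linarith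
        then have "(a - p) * g < 2 * \<tau>" using p\<tau> by (simp add: algebra_simps)
        moreover have "(a - p) / 4 * g = (a - p) * g / 4" by simp
        ultimately show False using \<tau>(1,3) t(1) by linarith
      qed
      have lower: "p - \<eta> < F z x"
      proof (rule ccontr)
        assume "\<not> p - \<eta> < F z x"
        then have Fz: "F z x \<le> a'" by (simp add: a'_def)
        obtain y1 y2 where y: "(y1, y2) \<in> Q'" "a' < F y1 x" "F y2 x < b'" using Q'(3)[OF x] by blast
        have "z < y1" using Fmono[of y1 z] Fz y(2) by linarith
        moreover have "h n * R < y2 - y1" using gap y(1) by blast
        ultimately have "p * G \<le> region_est K h X Y {..y2} n \<omega> x"
          unfolding root[symmetric] by (intro psi_est_sandwich(2)[OF w(1-3) R(2) n]) auto
        moreover have "{..y2} \<in> \<A>" using y(1) by (force simp: \<A>_def)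
        then have "region_est K h X Y {..y2} n \<omega> x \<le> region_density f {..y2} x + \<tau>"
          using est x by (smt (verit))
        moreover have "F y2 x * g < b' * g" using y(3) g by simp
        ultimately have "p * (g - \<tau>) < b' * g + \<tau>" using pG(2) unfolding Fg by linarith
        then have "(p - b') * g < 2 * \<tau>" using p\<tau> by (simp add: algebra_simps)
        moreover have "(p - b') / 4 * g = (p - b') * g / 4" by simp
        ultimately show False using \<tau>(1,4) t(2) by linarith
      qed
      show "\<bar>cond_cdf f (q n \<omega> x) x - p\<bar> \<le> \<eta>"
        using upper lower unfolding F_def z_def by linarith
    qed
  qed
qed simp

end

section \<open>Strong uniform consistency of the conditional quantile estimator\<close>

lemma sup_dist_on_commute: "sup_dist_on S p q = sup_dist_on S q p"
  by (simp add: sup_dist_on_def abs_minus_commute)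

lemma tendsto_0_ennrealI:
  fixes s :: "'a \<Rightarrow> ennreal"
  assumes "\<And>m. eventually (\<lambda>n. s n < ennreal (1 / Suc m)) \<F>" shows "(s \<longlongrightarrow> 0) \<F>"
proof (rule order_tendstoI)
  fix a :: ennreal assume "0 < a"
  obtain e where e: "0 < e" "ennreal e < a"
  proof (cases a)
    case (real r)
    then have "0 < r / 2" "ennreal (r / 2) < a" using \<open>0 < a\<close> by (auto simp: ennreal_less_iff)
    then show thesis by (rule that)
  next
    case top
    then show thesis using that[of 1] by simp
  qed
  obtain m where "1 / real (Suc m) < e" using e(1) nat_approx_posE by blast
  then have m: "ennreal (1 / Suc m) < a" using e by (meson ennreal_leI le_less_trans less_imp_le)
  show "eventually (\<lambda>n. s n < a) \<F>"
    by (rule eventually_mono[OF assms[of m]]) (rule less_trans[OF _ m])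
qed simp

theorem theorem2:
  fixes M :: "'w measure"
    and X :: "nat ^ 'N \<Rightarrow> 'w \<Rightarrow> real ^ 'd"
    and Y :: "nat ^ 'N \<Rightarrow> 'w \<Rightarrow> real"
    and f :: "(real ^ 'd) \<times> real \<Rightarrow> real"
    and g :: "real ^ 'd \<Rightarrow> real"
    and F :: "real \<Rightarrow> real ^ 'd \<Rightarrow> real"
    and h :: "nat ^ 'N \<Rightarrow> real"
    and K :: "real ^ 'd \<Rightarrow> real" and w :: "real \<Rightarrow> real"
    and p :: real
    and \<mu> :: "real ^ 'd \<Rightarrow> real"
    and q :: "nat ^ 'N \<Rightarrow> 'w \<Rightarrow> real ^ 'd \<Rightarrow> real"
    and \<phi> :: "nat \<Rightarrow> nat \<Rightarrow> real" and chi :: "real \<Rightarrow> real"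
    and \<beta> \<epsilon> :: real
    and S :: "(real ^ 'd) set"
  defines "g \<equiv> marginal_density f"
    and "F \<equiv> cond_cdf f"
  assumes prob: "prob_space M"
    and stationary: "strictly_stationary M (\<lambda>i \<omega>. (X i \<omega>, Y i \<omega>))"
    and f_nonneg: "\<forall>z. 0 \<le> f z"
    and density: "\<forall>i\<in>pos_indices. distributed M lborel (\<lambda>\<omega>. (X i \<omega>, Y i \<omega>)) (\<lambda>z. ennreal (f z))"
    and mixing: "mixing_field M (\<lambda>i \<omega>. (X i \<omega>, Y i \<omega>)) \<phi> chi"
    and beta: "0 < \<beta>" "(\<lambda>i::nat. chi (real i)) \<in> O(\<lambda>i. real i powr (- \<beta>))"
    and bandwidth: "\<forall>n\<in>pos_indices. 0 < h n" "(h \<longlongrightarrow> 0) index_at_top"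
    and S: "compact S"
    and p: "0 < p" "p < 1"
    and quantile: "\<forall>x\<in>S. F (\<mu> x) x = p"
    and estimator: "quantile_estimator K w h X Y p M S q"
    and eps: "0 < \<epsilon>"
    and i: "continuous_on UNIV f" "continuous_on UNIV g" "\<exists>L. L-lipschitz_on UNIV g"
           "\<forall>x\<in>S. 0 < g x"
    and ii: "\<exists>D\<ge>0. \<exists>c\<ge>0. \<forall>i\<in>pos_indices. \<forall>j\<in>pos_indices. dist (real_index i) (real_index j) > D \<longrightarrow>
       (\<exists>g\<^sub>2 f\<^sub>2.
          (\<forall>u v. 0 \<le> g\<^sub>2 (u, v)) \<and>
          distributed M lborel (\<lambda>\<omega>. (X i \<omega>, X j \<omega>)) (\<lambda>z. ennreal (g\<^sub>2 z)) \<and>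
          (\<forall>s t. 0 \<le> f\<^sub>2 (s, t)) \<and>
          distributed M lborel (\<lambda>\<omega>. ((X i \<omega>, Y i \<omega>), (X j \<omega>, Y j \<omega>))) (\<lambda>z. ennreal (f\<^sub>2 z)) \<and>
          (\<forall>s t. \<bar>f\<^sub>2 (s, t) - f s * f t\<bar> \<le> c) \<and>
          (\<forall>u v. \<bar>g\<^sub>2 (u, v) - g u * g v\<bar> \<le> c))"
    and iii_f: "\<forall>i j l. i + j \<le> 2 \<longrightarrow>
       mixed_partial_exists l i j f \<and> bounded (range (mixed_partial l i j f)) \<and>
       integrable lborel (mixed_partial l i j f)"
    and iii_F: "\<forall>k l. continuous_second_partial_on (x_dir k) (x_dir l) (\<lambda>(x, y). F y x)
                        (cond_domain f)"
    and iv: "continuous_second_partial_on y_dir y_dir (\<lambda>(x, y). F y x) (cond_domain f)"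
    and v: "prob_density K" "\<forall>s. K (- s) = K s" "\<exists>L. L-lipschitz_on UNIV K" "compact_support K"
           "integrable lborel (\<lambda>s. (norm s)\<^sup>2 * K s)"
    and vi: "prob_density w" "\<forall>t. w (- t) = w t" "\<exists>L. L-lipschitz_on UNIV w" "compact_support w"
    and vii: "((\<lambda>n. real (index_volume n) * h n ^ (CARD('d) + 2) / ln (real (index_volume n)))
                 \<longlongrightarrow> 0) index_at_top"
    and viii: "\<forall>\<epsilon>'>0. \<exists>\<eta>>0. \<forall>r :: real ^ 'd \<Rightarrow> real.
       ennreal \<epsilon>' \<le> sup_dist_on S \<mu> r \<longrightarrow>
       ennreal \<eta> \<le> sup_dist_on S (\<lambda>x. F (\<mu> x) x) (\<lambda>x. F (r x) x)"
    and ix: "mixing_bandwidth_a h (real CARD('d)) \<epsilon> \<beta> \<phi> \<or> mixing_bandwidth_b h (real CARD('d)) \<epsilon> \<beta> \<phi>"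
  shows "AE \<omega> in M. ((\<lambda>n. sup_dist_on S (q n \<omega>) \<mu>) \<longlongrightarrow> 0) index_at_top"
proof -
  have gpos: "\<And>x. x \<in> S \<Longrightarrow> 0 < marginal_density f x" using i(4) unfolding g_def by blast
  interpret prob_space M by (rule prob)
  interpret mixing_kernel_field M X Y f h K \<phi> chi \<beta> \<epsilon> S
  proof unfold_locales
    show "\<And>i. i \<in> pos_indices \<Longrightarrow> random_variable borel (\<lambda>\<omega>. (X i \<omega>, Y i \<omega>))"
      using stationary unfolding strictly_stationary_def by blast
    show "continuous_on UNIV (marginal_density f)" using i(2) unfolding g_def .
  qed (use f_nonneg density mixing beta bandwidth eps S gpos i v ix in blast)+
  have wc: "continuous_on UNIV w" using vi(3) lipschitz_on_continuous_on by blast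
  have w: "prob_density w" "continuous_on UNIV w" "\<And>t. w (- t) = w t" "compact_support w" using vi wc by auto
  \<comment> \<open>Half of the \<open>\<eta>\<close> from the separation condition is used, because that condition is contradicted only by a
    supremum strictly smaller than \<open>\<eta>\<close>.\<close>
  have level: "AE \<omega> in M. eventually (\<lambda>n. sup_dist_on S (q n \<omega>) \<mu> < ennreal (1 / Suc m)) index_at_top" for m
  proof -
    have "0 < 1 / real (Suc m)" by simp
    with viii obtain \<eta> where \<eta>: "0 < \<eta>" "\<And>r. ennreal (1 / Suc m) \<le> sup_dist_on S \<mu> r \<Longrightarrow>
        ennreal \<eta> \<le> sup_dist_on S (\<lambda>x. F (\<mu> x) x) (\<lambda>x. F (r x) x)" by meson
    have "0 < \<eta> / 2" using \<eta>(1) by simp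
    from level_of_estimated_quantile[OF w p estimator this] show ?thesis
    proof eventually_elim
      case (elim \<omega>)
      then show ?case
      proof eventually_elim
        case (elim n)
        have "sup_dist_on S (\<lambda>x. F (\<mu> x) x) (\<lambda>x. F (q n \<omega> x) x) \<le> ennreal (\<eta> / 2)"
          unfolding sup_dist_on_def
        proof (rule SUP_least, rule ennreal_leI)
          fix x assume x: "x \<in> S"
          have "F (\<mu> x) x = p" using quantile x by blast
          moreover have "\<bar>F (q n \<omega> x) x - p\<bar> \<le> \<eta> / 2" using elim x unfolding F_def by blast
          ultimately show "\<bar>F (\<mu> x) x - F (q n \<omega> x) x\<bar> \<le> \<eta> / 2" by linarith
        qed
        also have "\<dots> < ennreal \<eta>" using \<eta>(1) by (simp add: ennreal_less_iff)
        finally have "\<not> ennreal (1 / Suc m) \<le> sup_dist_on S \<mu> (q n \<omega>)" using \<eta>(2)[of "q n \<omega>"] by (meson not_le)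
        then show ?case by (simp only: sup_dist_on_commute[of S \<mu>] not_le)
      qed
    qed
  qed
  then have "AE \<omega> in M. \<forall>m. eventually (\<lambda>n. sup_dist_on S (q n \<omega>) \<mu> < ennreal (1 / Suc m)) index_at_top"
    unfolding AE_all_countable by blast
  then show ?thesis
    by eventually_elim (rule tendsto_0_ennrealI, blast)
qed

end
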